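(* Let $\mathcal X,\mathcal Y$ be finite sets, let $P_{XY}$ (hypothesis $H_0$) and $P_{\bar X\bar Y}$ (hypothesis $H_1$) be probability measures on $\mathcal X\times\mathcal Y$, and let $R\ge 0$. Let $\mathscr S(R)$ be the set of all pairs of random variables $(U,V)$ with values in finite sets $\mathcal U,\mathcal V$ (of arbitrary finite cardinality), jointly distributed with $(X,Y)\sim P_{XY}$, such that $U - X - Y$ is a Markov chain, $V-(U,Y)-X$ is a Markov chain, and $$I(U;X)+I(V;Y|U)\le R .$$ For $(U,V)\in\mathscr S(R)$ let $\mathscr L(U,V)$ be the set of all $(\tilde U,\tilde V,\tilde X,\tilde Y)$ with values in $\mathcal U\times\mathcal V\times\mathcal X\times\mathcal Y$ such that $$P_{\tilde U\tilde V\tilde X}=P_{UVX},\qquad P_{\tilde U\tilde V\tilde Y}=P_{UVY},$$ and let $P_{\bar U\bar V\bar X\bar Y}(u,v,x,y)=P_{\bar X\bar Y}(x,y)\,P_{U|X}(u|x)\,P_{V|UY}(v|u,y)$. Then, for one round of interaction ($K=1$) and total exchange rate $R$, $$\lim_{\epsilon\to0}\ \liminf_{n\to\infty}\ -\frac1n\log\beta_n(R,\epsilon\,|\,K=1)\ \ \ge\ \sup_{(U,V)\in\mathscr S(R)}\ \ \min_{(\tilde U,\tilde V,\tilde X,\tilde Y)\in\mathscr L(U,V)}\ \mathcal D\big(P_{\tilde U\tilde V\tilde X\tilde Y}\,\|\,P_{\bar U\bar V\bar X\bar Y}\big).$$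
   Context: All logarithms and exponentials are in base 2; $I(\cdot;\cdot)$, $I(\cdot;\cdot|\cdot)$ are (conditional) mutual information and $\mathcal D(\cdot\|\cdot)$ is Kullback–Leibler divergence (equal to $+\infty$ when absolute continuity fails). Collaborative hypothesis testing. Node $A$ observes $X^n$ and node $B$ observes $Y^n$, where $(X_i,Y_i)_{i=1}^n$ are i.i.d. with law $P_{XY}$ under $H_0$ and $P_{\bar X\bar Y}$ under $H_1$. A $K$-round code of blocklength $n$ consists of encoders, for $k=1,\dots,K$, $$f_{[k]}:\mathcal X^n\times\prod_{i=1}^{k-1}\{1,\dots,|g_{[i]}|\}\to\{1,\dots,|f_{[k]}|\},\qquad g_{[k]}:\mathcal Y^n\times\prod_{i=1}^{k}\{1,\dots,|f_{[i]}|\}\to\{1,\dots,|g_{[k]}|\},$$ and a decision map $\phi:\mathcal X^n\times\prod_{i=1}^K\{1,\dots,|g_{[i]}|\}\to\{0,1\}$, where $|f_{[k]}|,|g_{[k]}|$ denote the sizes of the ranges. The messages are produced successively: $f_{[1]}$ is evaluated at $X^n$, then $g_{[1]}$ at $Y^n$ and the message of $f_{[1]}$, and so on. The error probabilities are $$\alpha_n=\Pr[\phi(X^n,g_{[1:K]})=1\mid (X_i,Y_i)\text{ i.i.d. }\sim P_{XY}],\qquad \beta_n=\Pr[\phi(X^n,g_{[1:K]})=0\mid (X_i,Y_i)\text{ i.i.d. }\sim P_{\bar X\bar Y}],$$ where $g_{[1:K]}$ denotes the tuple of all messages sent by node $B$. For $0<\epsilon<1$, a number $E$ is a feasible exponent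 for $(R,\epsilon)$ with $K$ rounds if for every $\varepsilon>0$ and all sufficiently large $n$ there is a $K$-round code of blocklength $n$ with $$-\tfrac1n\log\beta_n\ge E-\varepsilon,\qquad \tfrac1n\sum_{k=1}^K\log\big(|f_{[k]}||g_{[k]}|\big)\le R+\varepsilon,\qquad \alpha_n\le\epsilon .$$ The expression $\liminf_{n\to\infty}-\frac1n\log\beta_n(R,\epsilon|K)$ denotes the optimal error exponent for $(R,\epsilon)$, i.e. the supremum (in $[0,+\infty]$) of all feasible exponents. It is nondecreasing in $\epsilon$; $\lim_{\epsilon\to0}$ means $\epsilon\downarrow0$. In the definition of $P_{\bar U\bar V\bar X\bar Y}$, the conditional laws $P_{U|X}$, $P_{V|UY}$ are those of $(U,V)$ under $P_{XY}$ (fixed arbitrarily as stochastic kernels where the conditioning event has probability zero under $H_0$). *)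

theory Defs
  imports "HOL-Probability.Probability"
begin

section \<open>Information measures of discrete laws\<close>

text \<open>
  A family of random variables is a family of functions on a common probability mass
  function \<open>Q\<close>.  \<^const>\<open>KL_divergence\<close> is real-valued, with the reference measure as its
  second argument, so the value \<open>\<infinity>\<close> is added by hand below, and the arguments are swapped:
  \<open>kl_div T B\<close> is the divergence of \<open>T\<close> from \<open>B\<close>.
\<close>

definition kl_div :: "'a pmf \<Rightarrow> 'a pmf \<Rightarrow> ereal" where
  "kl_div T B =
     (if absolutely_continuous (measure_pmf B) (measure_pmf T)
      then ereal (KL_divergence 2 (measure_pmf B) (measure_pmf T)) else \<infinity>)"

definition mut_info :: "'w pmf \<Rightarrow> ('w \<Rightarrow> 'a) \<Rightarrow> ('w \<Rightarrow> 'b) \<Rightarrow> real" where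
  "mut_info Q A B =
     prob_space.mutual_information (measure_pmf Q) 2 (count_space UNIV) (count_space UNIV) A B"

definition cond_mut_info :: "'w pmf \<Rightarrow> ('w \<Rightarrow> 'a) \<Rightarrow> ('w \<Rightarrow> 'b) \<Rightarrow> ('w \<Rightarrow> 'c) \<Rightarrow> real" where
  "cond_mut_info Q A B C =
     prob_space.conditional_mutual_information (measure_pmf Q) 2
       (count_space UNIV) (count_space UNIV) (count_space UNIV) A B C"

text \<open>\<open>A - B - C\<close>: given \<open>B\<close>, the variables \<open>A\<close> and \<open>C\<close> are independent (the conditional
  probabilities are cleared of their denominators).\<close>

definition markov_chain :: "'w pmf \<Rightarrow> ('w \<Rightarrow> 'a) \<Rightarrow> ('w \<Rightarrow> 'b) \<Rightarrow> ('w \<Rightarrow> 'c) \<Rightarrow> bool" where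
  "markov_chain Q A B C \<longleftrightarrow>
     (\<forall>a b c. pmf (map_pmf (\<lambda>w. (A w, B w, C w)) Q) (a, b, c) * pmf (map_pmf B Q) b =
              pmf (map_pmf (\<lambda>w. (A w, B w)) Q) (a, b) * pmf (map_pmf (\<lambda>w. (B w, C w)) Q) (b, c))"

text \<open>\<open>\<kappa>\<close> is a version of the conditional law of \<open>A\<close> given \<open>B\<close>; \<open>\<kappa> b\<close> is unconstrained where
  \<open>B = b\<close> has probability zero.\<close>

definition is_cond_law :: "'w pmf \<Rightarrow> ('w \<Rightarrow> 'a) \<Rightarrow> ('w \<Rightarrow> 'b) \<Rightarrow> ('b \<Rightarrow> 'a pmf) \<Rightarrow> bool" where
  "is_cond_law Q A B \<kappa> \<longleftrightarrow>
     (\<forall>a b. pmf (map_pmf (\<lambda>w. (A w, B w)) Q) (a, b) = pmf (map_pmf B Q) b * pmf (\<kappa> b) a)"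

section \<open>Interactive codes\<close>

text \<open>
  Rounds are numbered from \<open>0\<close>, and messages of round \<open>k\<close> range over \<open>{1..fsize c k}\<close> (from
  node A) and \<open>{1..gsize c k}\<close> (from node B).  The second argument of \<open>fenc c k\<close>, \<open>genc c k\<close>
  and \<open>reject c\<close> is the list of messages received so far; \<open>reject c\<close> is true if the decision
  is \<open>1\<close>.
\<close>

record ('x, 'y) code =
  fsize :: "nat \<Rightarrow> nat"
  gsize :: "nat \<Rightarrow> nat"
  fenc :: "nat \<Rightarrow> 'x list \<Rightarrow> nat list \<Rightarrow> nat"
  genc :: "nat \<Rightarrow> 'y list \<Rightarrow> nat list \<Rightarrow> nat"
  reject :: "'x list \<Rightarrow> nat list \<Rightarrow> bool"

definition message_tuples :: "(nat \<Rightarrow> nat) \<Rightarrow> nat \<Rightarrow> nat list set" where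
  "message_tuples N k = {ms. length ms = k \<and> (\<forall>i<k. ms ! i \<in> {1..N i})}"

definition is_code :: "nat \<Rightarrow> nat \<Rightarrow> ('x, 'y) code \<Rightarrow> bool" where
  "is_code K n c \<longleftrightarrow>
     (\<forall>k<K. \<forall>xs ms. length xs = n \<longrightarrow> ms \<in> message_tuples (gsize c) k \<longrightarrow>
        fenc c k xs ms \<in> {1..fsize c k}) \<and>
     (\<forall>k<K. \<forall>ys ms. length ys = n \<longrightarrow> ms \<in> message_tuples (fsize c) (Suc k) \<longrightarrow>
        genc c k ys ms \<in> {1..gsize c k})"

text \<open>The messages of the two nodes after \<open>k\<close> rounds.\<close>

primrec transcript ::
    "('x, 'y) code \<Rightarrow> 'x list \<Rightarrow> 'y list \<Rightarrow> nat \<Rightarrow> nat list \<times> nat list" where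
  "transcript c xs ys 0 = ([], [])"
| "transcript c xs ys (Suc k) =
     (let (fs, gs) = transcript c xs ys k;
          fs' = fs @ [fenc c k xs gs]
      in (fs', gs @ [genc c k ys fs']))"

definition decides_one :: "nat \<Rightarrow> ('x, 'y) code \<Rightarrow> ('x \<times> 'y) list \<Rightarrow> bool" where
  "decides_one K c zs \<longleftrightarrow>
     (let xs = map fst zs; ys = map snd zs in reject c xs (snd (transcript c xs ys K)))"

definition err_alpha :: "('x \<times> 'y) pmf \<Rightarrow> nat \<Rightarrow> nat \<Rightarrow> ('x, 'y) code \<Rightarrow> real" where
  "err_alpha P0 K n c = measure_pmf.prob (replicate_pmf n P0) {zs. decides_one K c zs}"

definition err_beta :: "('x \<times> 'y) pmf \<Rightarrow> nat \<Rightarrow> nat \<Rightarrow> ('x, 'y) code \<Rightarrow> real" where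
  "err_beta P1 K n c = measure_pmf.prob (replicate_pmf n P1) {zs. \<not> decides_one K c zs}"

definition code_rate :: "nat \<Rightarrow> nat \<Rightarrow> ('x, 'y) code \<Rightarrow> real" where
  "code_rate K n c = (\<Sum>k<K. log 2 (real (fsize c k) * real (gsize c k))) / real n"

text \<open>The exponent \<open>- log \<beta> / n\<close>; the case \<open>\<beta> = 0\<close> is separate because \<open>log 2 0 = 0\<close>.\<close>

definition exponent :: "nat \<Rightarrow> real \<Rightarrow> ereal" where
  "exponent n \<beta> = (if \<beta> = 0 then \<infinity> else ereal (- log 2 \<beta> / real n))"

definition feasible_exponent ::
    "('x \<times> 'y) pmf \<Rightarrow> ('x \<times> 'y) pmf \<Rightarrow> real \<Rightarrow> real \<Rightarrow> nat \<Rightarrow> real \<Rightarrow> bool" where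
  "feasible_exponent P0 P1 R \<epsilon> K E \<longleftrightarrow>
     (\<forall>\<delta>>0. \<forall>\<^sub>F n in sequentially. \<exists>c :: ('x, 'y) code. is_code K n c \<and>
        exponent n (err_beta P1 K n c) \<ge> ereal (E - \<delta>) \<and>
        code_rate K n c \<le> R + \<delta> \<and>
        err_alpha P0 K n c \<le> \<epsilon>)"

definition optimal_exponent ::
    "('x \<times> 'y) pmf \<Rightarrow> ('x \<times> 'y) pmf \<Rightarrow> real \<Rightarrow> real \<Rightarrow> nat \<Rightarrow> ereal" where
  "optimal_exponent P0 P1 R \<epsilon> K = (SUP E \<in> {E. feasible_exponent P0 P1 R \<epsilon> K E}. ereal E)"

section \<open>Auxiliary random variables\<close>

text \<open>
  A pair \<open>(U, V)\<close> jointly distributed with \<open>(X, Y)\<close> is given by the joint law of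
  \<open>(U, V, X, Y)\<close>, the four variables being the coordinates.  Arbitrary finite alphabets
  for \<open>U\<close> and \<open>V\<close> are realised as finite sets of natural numbers.
\<close>

type_synonym ('x, 'y) joint = "(nat \<times> nat \<times> 'x \<times> 'y) pmf"

abbreviation rvU :: "nat \<times> nat \<times> 'x \<times> 'y \<Rightarrow> nat" where "rvU \<equiv> (\<lambda>(u, v, x, y). u)"
abbreviation rvV :: "nat \<times> nat \<times> 'x \<times> 'y \<Rightarrow> nat" where "rvV \<equiv> (\<lambda>(u, v, x, y). v)"
abbreviation rvX :: "nat \<times> nat \<times> 'x \<times> 'y \<Rightarrow> 'x" where "rvX \<equiv> (\<lambda>(u, v, x, y). x)"
abbreviation rvY :: "nat \<times> nat \<times> 'x \<times> 'y \<Rightarrow> 'y" where "rvY \<equiv> (\<lambda>(u, v, x, y). y)"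
abbreviation rvUY :: "nat \<times> nat \<times> 'x \<times> 'y \<Rightarrow> nat \<times> 'y" where "rvUY \<equiv> (\<lambda>(u, v, x, y). (u, y))"

definition aux_set :: "('x \<times> 'y) pmf \<Rightarrow> real \<Rightarrow> ('x, 'y) joint set" where
  "aux_set P0 R = {Q. finite (set_pmf Q) \<and>
     map_pmf (\<lambda>(u, v, x, y). (x, y)) Q = P0 \<and>
     markov_chain Q rvU rvX rvY \<and>
     markov_chain Q rvV rvUY rvX \<and>
     mut_info Q rvU rvX + cond_mut_info Q rvV rvY rvU \<le> R}"

definition tilde_set :: "('x, 'y) joint \<Rightarrow> ('x, 'y) joint set" where
  "tilde_set Q = {T.
     map_pmf (\<lambda>(u, v, x, y). (u, v, x)) T = map_pmf (\<lambda>(u, v, x, y). (u, v, x)) Q \<and>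
     map_pmf (\<lambda>(u, v, x, y). (u, v, y)) T = map_pmf (\<lambda>(u, v, x, y). (u, v, y)) Q}"

definition bar_law ::
    "('x \<times> 'y) pmf \<Rightarrow> ('x \<Rightarrow> nat pmf) \<Rightarrow> (nat \<times> 'y \<Rightarrow> nat pmf) \<Rightarrow> ('x, 'y) joint" where
  "bar_law P1 \<kappa> \<mu> =
     do {(x, y) \<leftarrow> P1; u \<leftarrow> \<kappa> x; v \<leftarrow> \<mu> (u, y); return_pmf (u, v, x, y)}"

end

theory Submission
  imports Defs "HOL-Real_Asymp.Real_Asymp"
begin

text \<open>
  Fix \<open>(U, V)\<close>.  Node A quantises \<open>X\<^sup>n\<close> with a codebook of about \<open>2 ^ (n I(U; X))\<close> sequences \<open>u\<close>, and node
  B quantises \<open>Y\<^sup>n\<close>, given \<open>u\<close>, with a codebook of about \<open>2 ^ (n I(V; Y | U))\<close> sequences \<open>v\<close>; \<open>H\<^sub>0\<close> is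
  accepted if \<open>(u, v, x)\<close> and \<open>(u, v, y)\<close> both have the empirical laws expected under \<open>H\<^sub>0\<close>.

  Under \<open>H\<^sub>1\<close> any codebooks of these sizes will do.  For fixed \<open>(u, v)\<close>, the probability that
  \<open>(u, v, x, y)\<close> has type \<open>T\<close> is at most \<open>2 ^ (-n D(T || T\<^sub>U\<^sub>V \<times> P\<^sub>1))\<close>, and on the set of admissible \<open>T\<close> this
  exponent exceeds the divergence from \<open>bar_law\<close> by exactly \<open>I(U; X) + I(V; Y | U)\<close>, which is what the
  union bound over the codewords costs.  Compactness handles types that are admissible only
  approximately.

  Under \<open>H\<^sub>0\<close> the codebooks are built backwards.  Given \<open>u\<close>, B's codewords cover those \<open>y\<close> for which the
  conditional probability of an atypical outcome given \<open>(u, v, y)\<close> is small; the failure probability of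
  this second stage is then a function of \<open>(u, x)\<close>, and A's codewords only need to cover those \<open>x\<close> for
  which it is small.  No Markov lemma is needed.
\<close>

section \<open>Information measures as finite sums\<close>

text \<open>The cancellation of the union bound is exact because the log-ratio of
  \<open>bar_law\<close> to the product of \<open>P1\<close> with the law of \<open>(u, v)\<close>
  is an information density in \<open>(u, x)\<close> plus one in \<open>(u, v, y)\<close>. Both are
  functions of marginals that \<open>tilde_set\<close> prescribes, so their averages agree for all
  admissible laws, even those far from \<open>Q\<close>.

  The obstacle under the null hypothesis is that A picks \<open>u\<close> from \<open>x\<close>
  alone and B picks \<open>v\<close> from \<open>(u, y)\<close> alone: a codeword that fits the
  source at hand need not fit the other one. Each encoder therefore asks for a small conditional
  probability of the bad event given what it sees. Markov's inequality provides this for most draws,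
  at the price of dividing the error by a threshold. There are two thresholds, both fixed in terms
  of \<epsilon> while \<open>n\<close> grows, so it is enough that the error of the ideal
  experiment, in which \<open>(U, V, X, Y)\<close> is drawn from \<open>Q\<close>, tends to 0.

  The coding lemmas concern arbitrary weights on finite sets; block length enters only when these
  weights become products.\<close>

lemma finite_measure_measure_pmf: "finite_measure (measure_pmf p)"
  using prob_space_measure_pmf by (rule prob_space.axioms(1))

lemma prob_pmf_mono:
  "(\<And>x. x \<in> set_pmf p \<Longrightarrow> x \<in> A \<Longrightarrow> x \<in> B) \<Longrightarrow> measure_pmf.prob p A \<le> measure_pmf.prob p B"
  by (rule finite_measure.finite_measure_mono_AE[OF finite_measure_measure_pmf]) (auto intro: AE_pmfI)

lemma prob_pmf_UN_le:
  "finite I \<Longrightarrow> measure_pmf.prob p (\<Union>i\<in>I. A i) \<le> (\<Sum>i\<in>I. measure_pmf.prob p (A i))"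
  by (rule finite_measure.finite_measure_subadditive_finite[OF finite_measure_measure_pmf]) auto

text \<open>A divergence is evaluated from a density with respect to the reference measure. Off the
  support of \<open>B\<close> the quotient is 0 by convention, in agreement with \<open>A\<close>,
  which has no mass there.\<close>

lemma measure_pmf_eq_density_pmf:
  assumes "set_pmf A \<subseteq> set_pmf B"
  shows "measure_pmf A = density (measure_pmf B) (\<lambda>x. ennreal (pmf A x / pmf B x))"
proof -
  have "density (measure_pmf B) (\<lambda>x. ennreal (pmf A x / pmf B x)) =
    density (count_space UNIV) (\<lambda>x. ennreal (pmf B x) * ennreal (pmf A x / pmf B x))"
    unfolding measure_pmf_eq_density[of B] by (subst density_density_eq) auto
  also have "(\<lambda>x. ennreal (pmf B x) * ennreal (pmf A x / pmf B x)) = (\<lambda>x. ennreal (pmf A x))"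
  proof
    fix x
    show "ennreal (pmf B x) * ennreal (pmf A x / pmf B x) = ennreal (pmf A x)"
    proof (cases "x \<in> set_pmf B")
      case True
      then show ?thesis by (simp add: ennreal_mult[symmetric] set_pmf_iff)
    next
      case False
      then have "pmf A x = 0" "pmf B x = 0" using assms by (auto simp: set_pmf_iff)
      then show ?thesis by simp
    qed
  qed
  also have "density (count_space UNIV) (\<lambda>x. ennreal (pmf A x)) = measure_pmf A"
    by (rule measure_pmf_eq_density[symmetric])
  finally show ?thesis by simp
qed

lemma KL_divergence_pmf:
  assumes fin: "finite (set_pmf A)" and sub: "set_pmf A \<subseteq> set_pmf B"
  shows "KL_divergence 2 (measure_pmf B) (measure_pmf A) =
    (\<Sum>x\<in>set_pmf A. pmf A x * log 2 (pmf A x / pmf B x))"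
proof -
  have "KL_divergence 2 (measure_pmf B) (measure_pmf A) =
      (\<integral>x. (pmf A x / pmf B x) * log 2 (pmf A x / pmf B x) \<partial>measure_pmf B)"
    unfolding measure_pmf_eq_density_pmf[OF sub]
    by (rule sigma_finite_measure.KL_density) 
       (auto simp: AE_measure_pmf_iff intro: prob_space_imp_sigma_finite prob_space_measure_pmf)
  also have "\<dots> = (\<Sum>x\<in>set_pmf A. (pmf A x / pmf B x) * log 2 (pmf A x / pmf B x) * pmf B x)"
    by (rule integral_measure_pmf_real[OF fin]) (auto simp: set_pmf_iff)
  also have "\<dots> = (\<Sum>x\<in>set_pmf A. pmf A x * log 2 (pmf A x / pmf B x))"
    using sub by (intro sum.cong) (auto simp: set_pmf_iff)
  finally show ?thesis .
qed

lemma absolutely_continuous_pmf_iff: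
  "absolutely_continuous (measure_pmf B) (measure_pmf A) \<longleftrightarrow> set_pmf A \<subseteq> set_pmf B"
proof
  assume ac: "absolutely_continuous (measure_pmf B) (measure_pmf A)"
  show "set_pmf A \<subseteq> set_pmf B"
  proof
    fix x assume x: "x \<in> set_pmf A"
    show "x \<in> set_pmf B"
    proof (rule ccontr)
      assume "x \<notin> set_pmf B"
      then have "{x} \<in> null_sets (measure_pmf B)"
        by (simp add: null_sets_def emeasure_pmf_single set_pmf_iff)
      then have "{x} \<in> null_sets (measure_pmf A)" 
        using ac by (auto simp: absolutely_continuous_def)
      then show False using x by (simp add: null_sets_def emeasure_pmf_single set_pmf_iff)
    qed
  qed
next
  assume "set_pmf A \<subseteq> set_pmf B"
  then show "absolutely_continuous (measure_pmf B) (measure_pmf A)"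
    unfolding absolutely_continuous_def
    by (auto simp: null_sets_def finite_measure.emeasure_eq_measure[OF finite_measure_measure_pmf] measure_pmf_zero_iff)
qed

lemma kl_div_eq_sum:
  assumes "finite (set_pmf T)"
  shows "kl_div T B = (if set_pmf T \<subseteq> set_pmf B
    then ereal (\<Sum>x\<in>set_pmf T. pmf T x * log 2 (pmf T x / pmf B x)) else \<infinity>)"
  using assms by (simp add: kl_div_def absolutely_continuous_pmf_iff KL_divergence_pmf)

lemma sum_pmf_comp_map:
  assumes "finite (set_pmf Q)"
  shows "(\<Sum>y\<in>set_pmf (map_pmf f Q). pmf (map_pmf f Q) y * g y) =
    (\<Sum>w\<in>set_pmf Q. pmf Q w * (g (f w) :: real))"
proof -
  have "(\<Sum>y\<in>set_pmf (map_pmf f Q). pmf (map_pmf f Q) y * g y) =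
      measure_pmf.expectation (map_pmf f Q) g"
    using assms by (subst integral_measure_pmf_real[where A="set_pmf (map_pmf f Q)"]) (auto simp: mult.commute)
  also have "\<dots> = measure_pmf.expectation Q (\<lambda>w. g (f w))" by simp
  also have "\<dots> = (\<Sum>w\<in>set_pmf Q. pmf Q w * g (f w))"
    using assms by (subst integral_measure_pmf_real[where A="set_pmf Q"]) (auto simp: mult.commute)
  finally show ?thesis .
qed

lemma sigma_finite_count_space_UNIV:
  "sigma_finite_measure (count_space UNIV :: 'b::countable measure)"
  by (rule sigma_finite_measure_count_space_countable) simp

lemma sigma_finite_density_pmf:
  "sigma_finite_measure (density (count_space UNIV) (\<lambda>x. ennreal (pmf B x)))"
  unfolding measure_pmf_eq_density[symmetric]
  by (rule prob_space_imp_sigma_finite[OF prob_space_measure_pmf])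

lemma pair_measure_pmf_eq_density:
  fixes A :: "'a::countable pmf" and B :: "'b::countable pmf"
  shows "measure_pmf A \<Otimes>\<^sub>M measure_pmf B =
      density (count_space UNIV \<Otimes>\<^sub>M count_space UNIV) (\<lambda>(x, y). ennreal (pmf A x) * ennreal (pmf B y))"
  unfolding measure_pmf_eq_density
  by (rule pair_measure_density[OF _ _ sigma_finite_count_space_UNIV sigma_finite_density_pmf]) simp_all

lemma pmf_pair_pmf_eq:
  "(\<lambda>(x, y). ennreal (pmf A x) * ennreal (pmf B y)) = (\<lambda>z. ennreal (pmf (pair_pmf A B) z))"
  by (auto simp add: pmf_pair ennreal_mult)

lemma count_space_UNIV_pair:
  "(count_space UNIV :: 'a::countable measure) \<Otimes>\<^sub>M (count_space UNIV :: 'b::countable measure) =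
    count_space UNIV"
  by (subst pair_measure_countable) simp_all

text \<open>On countable types the product of two discrete sigma-algebras is the full power set.
  Hence the product measure in the definition of mutual information is itself a pmf, and the finite
  formula for the divergence applies to it.\<close>

lemma pair_measure_measure_pmf:
  fixes A :: "'a::countable pmf" and B :: "'b::countable pmf"
  shows "measure_pmf A \<Otimes>\<^sub>M measure_pmf B = measure_pmf (pair_pmf A B)"
  unfolding pair_measure_pmf_eq_density pmf_pair_pmf_eq count_space_UNIV_pair
  by (simp only: measure_pmf_eq_density[of "pair_pmf A B"])

lemma mut_info_eq_sum:
  fixes A :: "'w \<Rightarrow> 'a::countable" and B :: "'w \<Rightarrow> 'b::countable"
  assumes fin: "finite (set_pmf Q)"
  shows "mut_info Q A B = (\<Sum>w\<in>set_pmf Q. pmf Q w *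
    log 2 (pmf (map_pmf (\<lambda>w. (A w, B w)) Q) (A w, B w) /
           (pmf (map_pmf A Q) (A w) * pmf (map_pmf B Q) (B w))))"
proof -
  let ?J = "map_pmf (\<lambda>w. (A w, B w)) Q"
  let ?P = "pair_pmf (map_pmf A Q) (map_pmf B Q)"
  have "mut_info Q A B = KL_divergence 2 (measure_pmf ?P) (measure_pmf ?J)"
    unfolding mut_info_def prob_space.mutual_information_def[OF prob_space_measure_pmf]
    by (simp add: map_pmf_rep_eq[symmetric] pair_measure_measure_pmf pair_measure_countable)
  also have "\<dots> = (\<Sum>x\<in>set_pmf ?J. pmf ?J x * log 2 (pmf ?J x / pmf ?P x))"
    using fin by (intro KL_divergence_pmf) auto
  also have "\<dots> = (\<Sum>w\<in>set_pmf Q. pmf Q w * log 2 (pmf ?J (A w, B w) / pmf ?P (A w, B w)))"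
    by (rule sum_pmf_comp_map[OF fin])
  finally show ?thesis by (simp add: pmf_pair)
qed

text \<open>Conditional mutual information is defined through the chain rule, so all that remains is
  to identify the product sigma-algebra for \<open>(B, C)\<close> with the discrete one.\<close>

lemma cond_mut_info_eq_diff:
  fixes A :: "'w \<Rightarrow> 'a::countable" and B :: "'w \<Rightarrow> 'b::countable" and C :: "'w \<Rightarrow> 'c::countable"
  shows "cond_mut_info Q A B C = mut_info Q A (\<lambda>w. (B w, C w)) - mut_info Q A C"
  unfolding cond_mut_info_def mut_info_def
    prob_space.conditional_mutual_information_def[OF prob_space_measure_pmf]
  by (simp add: pair_measure_countable)

section \<open>Covering with a side-information cost\<close>

lemma sum_nonneg_le_average:
  fixes q f :: "'a \<Rightarrow> real"
  assumes "finite A" "\<And>a. a \<in> A \<Longrightarrow> 0 \<le> q a" "sum q A = 1"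
  shows "\<exists>a\<in>A. f a \<le> (\<Sum>a\<in>A. q a * f a)"
proof (rule ccontr)
  assume *: "\<not> ?thesis"
  define m where "m = (\<Sum>a\<in>A. q a * f a)"
  have lt: "m < f a" if "a \<in> A" for a using * that by (auto simp: m_def)
  obtain a0 where a0: "a0 \<in> A" "q a0 \<noteq> 0" 
    using assms(3) by (metis sum.neutral zero_neq_one)
  have "(\<Sum>a\<in>A. q a * m) < (\<Sum>a\<in>A. q a * f a)"
  proof (rule sum_strict_mono_ex1[OF assms(1)])
    show "\<forall>a\<in>A. q a * m \<le> q a * f a"
      using less_imp_le[OF lt] assms(2) by (auto intro!: mult_left_mono)
    have "0 < q a0" using a0 assms(2)[of a0] by linarith
    then show "\<exists>a\<in>A. q a * m < q a * f a" using lt a0 by (auto intro!: bexI[of _ a0])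
  qed
  then show False using assms(3) by (simp add: m_def sum_distrib_right[symmetric])
qed

text \<open>As a function of \<open>x\<close> the left side is convex, hence below its chord
  \<open>1 - x + x * (1 - y) ^ M\<close> over the unit interval; the induction proves this chord
  bound. In the application \<open>x\<close> is the probability that the channel produces an
  acceptable codeword, and \<open>1 / y\<close> is the cost of drawing codewords from another
  law.\<close>

lemma one_minus_mult_power_le:
  fixes x y :: real
  assumes "0 \<le> x" "x \<le> 1" "0 \<le> y" "y \<le> 1"
  shows "(1 - x * y) ^ M \<le> 1 - x + exp (- (y * real M))"
proof -
  have "(1 - x * y) ^ M \<le> 1 - x + x * (1 - y) ^ M"
  proof (induction M)
    case (Suc M)
    have xy: "0 \<le> 1 - x * y" using assms by (simp add: mult_le_one)
    have "(1 - x * y) ^ Suc M \<le> (1 - x * y) * (1 - x + x * (1 - y) ^ M)"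
      using Suc xy by (simp add: mult_left_mono)
    also have "\<dots> = 1 - x + x * (1 - y) ^ Suc M - (x * y) * (1 - x) * (1 - (1 - y) ^ M)"
      by (simp add: algebra_simps)
    also have "\<dots> \<le> 1 - x + x * (1 - y) ^ Suc M"
      using assms by (simp add: power_le_one)
    finally show ?case .
  qed simp
  also have "x * (1 - y) ^ M \<le> 1 * (exp (- y)) ^ M"
    using assms exp_ge_add_one_self[of "-y"] by (intro mult_mono power_mono) auto
  also have "\<dots> = exp (- (y * real M))"
    by (simp add: exp_of_nat_mult[symmetric] mult.commute)
  finally show ?thesis by simp
qed

text \<open>Averaging over one codeword at a time replaces the random choice of a codebook.\<close>

lemma exists_codebook_uncovered_power:
  fixes q :: "'a \<Rightarrow> real" and r :: "'s \<Rightarrow> real"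
  assumes A: "finite A" "\<And>a. a \<in> A \<Longrightarrow> 0 \<le> q a" "sum q A = 1"
    and r: "\<And>s. s \<in> S \<Longrightarrow> 0 \<le> r s"
  shows "\<exists>C\<subseteq>A. card C \<le> M \<and> (M > 0 \<longrightarrow> C \<noteq> {}) \<and>
    (\<Sum>s\<in>S. r s * of_bool (\<forall>a\<in>C. \<not> G a s)) \<le> (\<Sum>s\<in>S. r s * (\<Sum>a\<in>A. q a * of_bool (\<not> G a s)) ^ M)"
  using r
proof (induction M arbitrary: r)
  case 0
  show ?case by (intro exI[of _ "{}"]) simp
next
  case (Suc M)
  define p where "p s = (\<Sum>a\<in>A. q a * of_bool (\<not> G a s))" for s
  \<comment> \<open>Method of conditional expectations: \<open>p s ^ M\<close> is the chance that
    the remaining \<open>M\<close> random codewords all fail for \<open>s\<close>, so this weight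
    anticipates the bound that the induction hypothesis will give.\<close>
  have "\<exists>a\<in>A. (\<Sum>s\<in>S. r s * p s ^ M * of_bool (\<not> G a s)) \<le>
    (\<Sum>a\<in>A. q a * (\<Sum>s\<in>S. r s * p s ^ M * of_bool (\<not> G a s)))"
    by (rule sum_nonneg_le_average[OF A])
  then obtain a where a: "a \<in> A" "(\<Sum>s\<in>S. r s * p s ^ M * of_bool (\<not> G a s)) \<le>
    (\<Sum>a\<in>A. q a * (\<Sum>s\<in>S. r s * p s ^ M * of_bool (\<not> G a s)))" by (rule bexE)
  define r' where "r' s = r s * of_bool (\<not> G a s)" for s
  have "\<exists>C\<subseteq>A. card C \<le> M \<and> (M > 0 \<longrightarrow> C \<noteq> {}) \<and>
    (\<Sum>s\<in>S. r' s * of_bool (\<forall>a\<in>C. \<not> G a s)) \<le> (\<Sum>s\<in>S. r' s * (\<Sum>a\<in>A. q a * of_bool (\<not> G a s)) ^ M)"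
    by (rule Suc.IH) (auto simp: r'_def Suc.prems)
  then obtain C where C: "C \<subseteq> A" "card C \<le> M"
    "(\<Sum>s\<in>S. r' s * of_bool (\<forall>a\<in>C. \<not> G a s)) \<le> (\<Sum>s\<in>S. r' s * p s ^ M)"
    unfolding p_def by (elim exE conjE)
  have "(\<Sum>s\<in>S. r s * of_bool (\<forall>a\<in>insert a C. \<not> G a s)) = (\<Sum>s\<in>S. r' s * of_bool (\<forall>a\<in>C. \<not> G a s))"
    by (intro sum.cong) (auto simp: r'_def)
  also note C(3)
  also have "(\<Sum>s\<in>S. r' s * p s ^ M) = (\<Sum>s\<in>S. r s * p s ^ M * of_bool (\<not> G a s))"
    by (intro sum.cong) (auto simp: r'_def)
  also note a(2)
  also have "(\<Sum>a\<in>A. q a * (\<Sum>s\<in>S. r s * p s ^ M * of_bool (\<not> G a s))) = (\<Sum>s\<in>S. r s * p s ^ Suc M)"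
    unfolding sum_distrib_left
  proof (subst sum.swap, intro sum.cong refl)
    fix s
    have "(\<Sum>a\<in>A. q a * (r s * p s ^ M * of_bool (\<not> G a s))) = r s * p s ^ M * (\<Sum>a\<in>A. q a * of_bool (\<not> G a s))"
      by (simp add: sum_distrib_left mult_ac del: of_bool_not_iff)
    then show "(\<Sum>a\<in>A. q a * (r s * p s ^ M * of_bool (\<not> G a s))) = r s * p s ^ Suc M"
      by (simp add: p_def)
  qed
  finally have "(\<Sum>s\<in>S. r s * of_bool (\<forall>a\<in>insert a C. \<not> G a s)) \<le> (\<Sum>s\<in>S. r s * p s ^ Suc M)" .
  moreover have "card (insert a C) \<le> Suc M" "insert a C \<subseteq> A"
    using C a by (auto simp: card_insert_if finite_subset[OF _ A(1)])
  ultimately show ?case unfolding p_def by (intro exI[of _ "insert a C"] conjI) auto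
qed

text \<open>A change of measure: where \<open>G\<close> holds the channel \<open>k\<close> is
  dominated by \<open>c\<close> times \<open>q\<close>. If the channel produces an acceptable
  codeword for \<open>s\<close> with probability \<open>x\<close>, a codeword drawn from
  \<open>q\<close> is acceptable with probability at least \<open>x / c\<close>, so slightly more
  than \<open>c\<close> codewords suffice. The channel has to be stochastic only at sources of
  positive weight: elsewhere a version of a conditional law may charge points outside the finite set
  \<open>A\<close>.\<close>

lemma covering:
  fixes q :: "'a \<Rightarrow> real" and r :: "'s \<Rightarrow> real" and k :: "'a \<Rightarrow> 's \<Rightarrow> real"
  assumes A: "finite A" "\<And>a. a \<in> A \<Longrightarrow> 0 \<le> q a" "sum q A = 1"
    and S: "finite S" "\<And>s. s \<in> S \<Longrightarrow> 0 \<le> r s"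
    and k: "\<And>a s. a \<in> A \<Longrightarrow> s \<in> S \<Longrightarrow> 0 \<le> k a s"
    and k1: "\<And>s. s \<in> S \<Longrightarrow> r s \<noteq> 0 \<Longrightarrow> (\<Sum>a\<in>A. k a s) = 1"
    and c: "c \<ge> 1"
    and G: "\<And>a s. a \<in> A \<Longrightarrow> s \<in> S \<Longrightarrow> r s \<noteq> 0 \<Longrightarrow> G a s \<Longrightarrow> k a s \<le> q a * c"
  shows "\<exists>C\<subseteq>A. card C \<le> M \<and> (M > 0 \<longrightarrow> C \<noteq> {}) \<and>
    (\<Sum>s\<in>S. r s * of_bool (\<forall>a\<in>C. \<not> G a s)) \<le>
    (\<Sum>s\<in>S. \<Sum>a\<in>A. r s * k a s * of_bool (\<not> G a s)) + sum r S * exp (- (real M / c))"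
proof -
  obtain C where C: "C \<subseteq> A" "card C \<le> M" "M > 0 \<longrightarrow> C \<noteq> {}"
    "(\<Sum>s\<in>S. r s * of_bool (\<forall>a\<in>C. \<not> G a s)) \<le> (\<Sum>s\<in>S. r s * (\<Sum>a\<in>A. q a * of_bool (\<not> G a s)) ^ M)"
  proof -
    have "\<exists>C\<subseteq>A. card C \<le> M \<and> (M > 0 \<longrightarrow> C \<noteq> {}) \<and>
      (\<Sum>s\<in>S. r s * of_bool (\<forall>a\<in>C. \<not> G a s)) \<le> (\<Sum>s\<in>S. r s * (\<Sum>a\<in>A. q a * of_bool (\<not> G a s)) ^ M)"
      by (rule exists_codebook_uncovered_power) (use A S in auto)
    then show ?thesis using that by (elim exE conjE)
  qed
  have "r s * (\<Sum>a\<in>A. q a * of_bool (\<not> G a s)) ^ M \<le>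
     (\<Sum>a\<in>A. r s * k a s * of_bool (\<not> G a s)) + r s * exp (- (real M / c))" if s: "s \<in> S" for s
  proof (cases "r s = 0")
    case False
    define x where "x = (\<Sum>a\<in>A. k a s * of_bool (G a s))"
    have "x \<le> (\<Sum>a\<in>A. k a s)" unfolding x_def using k s by (intro sum_mono) auto
    then have x1: "x \<le> 1" using k1[OF s False] by simp
    have x0: "0 \<le> x" unfolding x_def using k s by (intro sum_nonneg) auto
    have "x \<le> (\<Sum>a\<in>A. q a * c * of_bool (G a s))"
      unfolding x_def using G[OF _ s False] by (intro sum_mono) auto
    also have "\<dots> = c * (\<Sum>a\<in>A. q a * of_bool (G a s))"
      by (simp add: sum_distrib_left mult_ac)
    finally have le: "x * (1 / c) \<le> (\<Sum>a\<in>A. q a * of_bool (G a s))"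
      using c by (simp add: field_simps)
    have "(\<Sum>a\<in>A. q a * of_bool (\<not> G a s)) + (\<Sum>a\<in>A. q a * of_bool (G a s)) = 1"
      unfolding sum.distrib[symmetric] A(3)[symmetric] by (intro sum.cong) auto
    then have "(\<Sum>a\<in>A. q a * of_bool (\<not> G a s)) \<le> 1 - x * (1 / c)" using le by linarith
    then have "(\<Sum>a\<in>A. q a * of_bool (\<not> G a s)) ^ M \<le> (1 - x * (1 / c)) ^ M"
      using A(2) by (intro power_mono) (auto intro!: sum_nonneg)
    also have "\<dots> \<le> 1 - x + exp (- (1 / c * real M))"
      using c x0 x1 by (intro one_minus_mult_power_le) auto
    also have "1 - x = (\<Sum>a\<in>A. k a s * of_bool (\<not> G a s))"
    proof -
      have "(\<Sum>a\<in>A. k a s * of_bool (\<not> G a s)) + x = 1"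
        unfolding x_def sum.distrib[symmetric] k1[OF s False, symmetric] by (intro sum.cong) auto
      then show ?thesis by simp
    qed
    finally have "r s * (\<Sum>a\<in>A. q a * of_bool (\<not> G a s)) ^ M \<le>
      r s * ((\<Sum>a\<in>A. k a s * of_bool (\<not> G a s)) + exp (- (1 / c * real M)))"
      using S(2)[OF s] by (rule mult_left_mono)
    then show ?thesis by (simp add: distrib_left sum_distrib_left mult_ac)
  qed simp
  then have "(\<Sum>s\<in>S. r s * (\<Sum>a\<in>A. q a * of_bool (\<not> G a s)) ^ M) \<le>
     (\<Sum>s\<in>S. (\<Sum>a\<in>A. r s * k a s * of_bool (\<not> G a s)) + r s * exp (- (real M / c)))"
    by (rule sum_mono)
  also have "\<dots> = (\<Sum>s\<in>S. \<Sum>a\<in>A. r s * k a s * of_bool (\<not> G a s)) + sum r S * exp (- (real M / c))"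
    by (simp add: sum.distrib sum_distrib_right)
  finally show ?thesis using C by (intro exI[of _ C]) auto
qed

text \<open>The source \<open>s\<close> is encoded without knowledge of \<open>z\<close>.  A codeword \<open>a\<close> is acceptable for \<open>s\<close> if
  the conditional probability of the bad event given \<open>s\<close> is at most \<open>\<theta>\<close>; this makes the
  Markov lemma unnecessary.\<close>

lemma one_sided_encoder:
  fixes g :: "'s \<Rightarrow> 'z \<Rightarrow> real" and k :: "'a \<Rightarrow> 's \<Rightarrow> real" and q :: "'a \<Rightarrow> real"
    and Bad :: "'a \<Rightarrow> 's \<Rightarrow> 'z \<Rightarrow> bool" and Z :: "'z set"
  defines "r \<equiv> \<lambda>s. \<Sum>z\<in>Z. g s z"
  assumes A: "finite A" "\<And>a. a \<in> A \<Longrightarrow> 0 \<le> q a" "sum q A = 1"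
    and S: "finite S" and Z: "finite Z"
    and g: "\<And>s z. s \<in> S \<Longrightarrow> z \<in> Z \<Longrightarrow> 0 \<le> g s z"
    and k: "\<And>a s. a \<in> A \<Longrightarrow> s \<in> S \<Longrightarrow> 0 \<le> k a s"
    and k1: "\<And>s. s \<in> S \<Longrightarrow> r s \<noteq> 0 \<Longrightarrow> (\<Sum>a\<in>A. k a s) = 1"
    and c: "c \<ge> 1" and th: "\<theta> > 0" and M: "M > 0"
  shows "\<exists>C\<subseteq>A. \<exists>e. C \<noteq> {} \<and> card C \<le> M \<and> (\<forall>s. e s \<in> C) \<and>
    (\<Sum>s\<in>S. \<Sum>z\<in>Z. g s z * of_bool (Bad (e s) s z)) \<le>
      \<theta> * sum r S + (\<Sum>s\<in>S. \<Sum>a\<in>A. \<Sum>z\<in>Z. g s z * k a s * of_bool (Bad a s z)) / \<theta>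
      + (\<Sum>s\<in>S. \<Sum>a\<in>A. r s * k a s * of_bool (q a * c < k a s))
      + sum r S * exp (- (real M / c))"
proof -
  define b where "b a s = (\<Sum>z\<in>Z. g s z * of_bool (Bad a s z))" for a s
  define G where "G a s \<longleftrightarrow> b a s \<le> \<theta> * r s \<and> k a s \<le> q a * c" for a s
  have r0: "\<And>s. s \<in> S \<Longrightarrow> 0 \<le> r s" unfolding r_def using g by (auto intro!: sum_nonneg)
  have b0: "\<And>s a. s \<in> S \<Longrightarrow> 0 \<le> b a s" unfolding b_def using g by (auto intro!: sum_nonneg)
  have br: "b a s \<le> r s" if "s \<in> S" for a s
    unfolding b_def r_def using g that by (auto intro!: sum_mono)
  obtain C where C: "C \<subseteq> A" "card C \<le> M" "C \<noteq> {}"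
    "(\<Sum>s\<in>S. r s * of_bool (\<forall>a\<in>C. \<not> G a s)) \<le>
    (\<Sum>s\<in>S. \<Sum>a\<in>A. r s * k a s * of_bool (\<not> G a s)) + sum r S * exp (- (real M / c))"
  proof -
    have "\<exists>C\<subseteq>A. card C \<le> M \<and> (M > 0 \<longrightarrow> C \<noteq> {}) \<and>
      (\<Sum>s\<in>S. r s * of_bool (\<forall>a\<in>C. \<not> G a s)) \<le>
      (\<Sum>s\<in>S. \<Sum>a\<in>A. r s * k a s * of_bool (\<not> G a s)) + sum r S * exp (- (real M / c))"
      by (rule covering[OF A S r0 k k1 c]) (auto simp: G_def)
    then show ?thesis using that M by (elim exE conjE) simp
  qed
  \<comment> \<open>A source without an acceptable codeword gets an arbitrary one, which needs a
    nonempty codebook; it is counted as an error with its full weight \<open>r s\<close>.\<close>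
  define e where "e s = (if \<exists>a\<in>C. G a s then SOME a. a \<in> C \<and> G a s else SOME a. a \<in> C)" for s
  have eC: "e s \<in> C" for s
  proof (cases "\<exists>a\<in>C. G a s")
    case True
    then show ?thesis unfolding e_def using someI_ex[of "\<lambda>a. a \<in> C \<and> G a s"] by auto
  next
    case False
    then show ?thesis using C(3) unfolding e_def by (simp add: some_in_eq)
  qed
  have eG: "G (e s) s" if "\<exists>a\<in>C. G a s" for s
    unfolding e_def using someI_ex[of "\<lambda>a. a \<in> C \<and> G a s"] that by auto
  have "(\<Sum>s\<in>S. b (e s) s) \<le> (\<Sum>s\<in>S. \<theta> * r s + r s * of_bool (\<forall>a\<in>C. \<not> G a s))"
  proof (rule sum_mono)
    fix s assume s: "s \<in> S"
    show "b (e s) s \<le> \<theta> * r s + r s * of_bool (\<forall>a\<in>C. \<not> G a s)"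
    proof (cases "\<exists>a\<in>C. G a s")
      case True
      then show ?thesis using eG[OF True] r0[OF s] by (auto simp: G_def)
    next
      case False
      then show ?thesis using br[OF s, of "e s"] r0[OF s] th by (auto intro: add_increasing)
    qed
  qed
  also have "\<dots> = \<theta> * sum r S + (\<Sum>s\<in>S. r s * of_bool (\<forall>a\<in>C. \<not> G a s))"
    by (simp add: sum.distrib sum_distrib_left)
  also have "\<dots> \<le> \<theta> * sum r S + ((\<Sum>s\<in>S. \<Sum>a\<in>A. r s * k a s * of_bool (\<not> G a s)) + sum r S * exp (- (real M / c)))"
    using C(4) by simp
  \<comment> \<open>A codeword produced by the channel is unacceptable for one of two reasons: its
    bad mass exceeds the threshold, which Markov's inequality charges to
    \<open>b a s / \<theta>\<close>, or its likelihood ratio exceeds \<open>c\<close>.\<close>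
  also have "(\<Sum>s\<in>S. \<Sum>a\<in>A. r s * k a s * of_bool (\<not> G a s)) \<le>
     (\<Sum>s\<in>S. \<Sum>a\<in>A. k a s * b a s / \<theta> + r s * k a s * of_bool (q a * c < k a s))"
  proof (intro sum_mono)
    fix s a assume s: "s \<in> S" and a: "a \<in> A"
    show "r s * k a s * of_bool (\<not> G a s) \<le> k a s * b a s / \<theta> + r s * k a s * of_bool (q a * c < k a s)"
    proof (cases "b a s \<le> \<theta> * r s")
      case True
      then show ?thesis using k[OF a s] r0[OF s] b0[OF s, of a] th by (auto simp: G_def)
    next
      case False
      then have "r s \<le> b a s / \<theta>" using th by (simp add: field_simps)
      then have "k a s * r s \<le> k a s * (b a s / \<theta>)" using k[OF a s] by (rule mult_left_mono)
      moreover have "0 \<le> r s * k a s * of_bool (q a * c < k a s)" using k[OF a s] r0[OF s] by simp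
      ultimately show ?thesis using False by (auto simp: G_def mult.commute)
    qed
  qed
  also have "\<dots> = (\<Sum>s\<in>S. \<Sum>a\<in>A. k a s * b a s) / \<theta> + (\<Sum>s\<in>S. \<Sum>a\<in>A. r s * k a s * of_bool (q a * c < k a s))"
    by (simp add: sum.distrib sum_divide_distrib)
  also have "(\<Sum>s\<in>S. \<Sum>a\<in>A. k a s * b a s) = (\<Sum>s\<in>S. \<Sum>a\<in>A. \<Sum>z\<in>Z. g s z * k a s * of_bool (Bad a s z))"
    unfolding b_def by (simp add: sum_distrib_left mult_ac)
  finally have "(\<Sum>s\<in>S. \<Sum>z\<in>Z. g s z * of_bool (Bad (e s) s z)) \<le>
      \<theta> * sum r S + (\<Sum>s\<in>S. \<Sum>a\<in>A. \<Sum>z\<in>Z. g s z * k a s * of_bool (Bad a s z)) / \<theta>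
      + (\<Sum>s\<in>S. \<Sum>a\<in>A. r s * k a s * of_bool (q a * c < k a s))
      + sum r S * exp (- (real M / c))"
    by (simp add: b_def)
  then show ?thesis using C eC by (intro exI[of _ C]) auto
qed

text \<open>B's encoder comes first: for each \<open>u\<close> it has source \<open>y\<close>,
  hidden variable \<open>x\<close> and weights \<open>p x y * k u x\<close>. Once \<open>eV\<close>
  is fixed, \<open>Bad u (eV u y) x y\<close> is an event in \<open>(u, x, y)\<close>, hence a
  legitimate bad event for A's encoder, whose source is \<open>x\<close> and whose hidden variable
  is \<open>y\<close>. Its mass in the ideal experiment is the sum over \<open>u\<close> of B's
  error bounds, which explains the nested division by \<open>\<theta>\<^sub>2\<close> and then
  \<open>\<theta>\<^sub>1\<close>.\<close>

lemma interactive_one_shot: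
  fixes p :: "'x \<Rightarrow> 'y \<Rightarrow> real" and k :: "'u \<Rightarrow> 'x \<Rightarrow> real" and m :: "'v \<Rightarrow> 'u \<Rightarrow> 'y \<Rightarrow> real"
    and Bad :: "'u \<Rightarrow> 'v \<Rightarrow> 'x \<Rightarrow> 'y \<Rightarrow> bool"
    and SX :: "'x set" and SY :: "'y set" and SU :: "'u set" and SV :: "'v set"
    and q\<^sub>1 :: "'u \<Rightarrow> real" and q\<^sub>2 :: "'v \<Rightarrow> 'u \<Rightarrow> real" and c\<^sub>1 c\<^sub>2 :: real
  defines "\<eta> \<equiv> \<Sum>u\<in>SU. \<Sum>y\<in>SY. \<Sum>v\<in>SV. \<Sum>x\<in>SX. p x y * k u x * m v u y * of_bool (Bad u v x y)"
    and "\<eta>\<^sub>1 \<equiv> \<Sum>x\<in>SX. \<Sum>u\<in>SU. (\<Sum>y\<in>SY. p x y) * k u x * of_bool (q\<^sub>1 u * c\<^sub>1 < k u x)"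
    and "\<eta>\<^sub>2 \<equiv> \<Sum>u\<in>SU. \<Sum>y\<in>SY. \<Sum>v\<in>SV. (\<Sum>x\<in>SX. p x y * k u x) * m v u y * of_bool (q\<^sub>2 v u * c\<^sub>2 < m v u y)"
  assumes fin: "finite SX" "finite SY" "finite SU" "finite SV" and ne: "SV \<noteq> {}"
    and p0: "\<And>x y. x \<in> SX \<Longrightarrow> y \<in> SY \<Longrightarrow> 0 \<le> p x y"
    and k0: "\<And>u x. u \<in> SU \<Longrightarrow> x \<in> SX \<Longrightarrow> 0 \<le> k u x"
    and m0: "\<And>v u y. v \<in> SV \<Longrightarrow> u \<in> SU \<Longrightarrow> y \<in> SY \<Longrightarrow> 0 \<le> m v u y"
    and q10: "\<And>u. u \<in> SU \<Longrightarrow> 0 \<le> q\<^sub>1 u" and q11: "sum q\<^sub>1 SU = 1"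
    and q20: "\<And>v u. v \<in> SV \<Longrightarrow> u \<in> SU \<Longrightarrow> 0 \<le> q\<^sub>2 v u"
    and q21: "\<And>u. u \<in> SU \<Longrightarrow> (\<Sum>y\<in>SY. \<Sum>x\<in>SX. p x y * k u x) \<noteq> 0 \<Longrightarrow> (\<Sum>v\<in>SV. q\<^sub>2 v u) = 1"
    and p1: "(\<Sum>x\<in>SX. \<Sum>y\<in>SY. p x y) = 1"
    and k1: "\<And>x. x \<in> SX \<Longrightarrow> (\<Sum>y\<in>SY. p x y) \<noteq> 0 \<Longrightarrow> (\<Sum>u\<in>SU. k u x) = 1"
    and m1: "\<And>u y. u \<in> SU \<Longrightarrow> y \<in> SY \<Longrightarrow> (\<Sum>x\<in>SX. p x y * k u x) \<noteq> 0 \<Longrightarrow> (\<Sum>v\<in>SV. m v u y) = 1"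
    and c: "c\<^sub>1 \<ge> 1" "c\<^sub>2 \<ge> 1" and th: "\<theta>\<^sub>1 > 0" "\<theta>\<^sub>2 > 0" and M: "M\<^sub>1 > 0" "M\<^sub>2 > 0"
  shows "\<exists>CU eU CV eV. CU \<subseteq> SU \<and> CU \<noteq> {} \<and> card CU \<le> M\<^sub>1 \<and> (\<forall>x. eU x \<in> CU) \<and>
    (\<forall>u\<in>SU. CV u \<subseteq> SV \<and> CV u \<noteq> {} \<and> card (CV u) \<le> M\<^sub>2 \<and> (\<forall>y. eV u y \<in> CV u)) \<and>
    (\<Sum>x\<in>SX. \<Sum>y\<in>SY. p x y * of_bool (Bad (eU x) (eV (eU x) y) x y)) \<le>
      \<theta>\<^sub>1 + (\<theta>\<^sub>2 + \<eta> / \<theta>\<^sub>2 + \<eta>\<^sub>2 + exp (- (real M\<^sub>2 / c\<^sub>2))) / \<theta>\<^sub>1 + \<eta>\<^sub>1 + exp (- (real M\<^sub>1 / c\<^sub>1))"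
proof -
  define t where "t u = (\<Sum>y\<in>SY. \<Sum>x\<in>SX. p x y * k u x)" for u
  define b where "b u = (\<Sum>y\<in>SY. \<Sum>v\<in>SV. \<Sum>x\<in>SX. p x y * k u x * m v u y * of_bool (Bad u v x y))" for u
  define i where "i u = (\<Sum>y\<in>SY. \<Sum>v\<in>SV. (\<Sum>x\<in>SX. p x y * k u x) * m v u y * of_bool (q\<^sub>2 v u * c\<^sub>2 < m v u y))" for u
  define good where "good u C e \<longleftrightarrow> C \<subseteq> SV \<and> C \<noteq> {} \<and> card C \<le> M\<^sub>2 \<and> (\<forall>y. e y \<in> C) \<and>
     (\<Sum>y\<in>SY. \<Sum>x\<in>SX. p x y * k u x * of_bool (Bad u (e y) x y)) \<le>
      \<theta>\<^sub>2 * t u + b u / \<theta>\<^sub>2 + i u + t u * exp (- (real M\<^sub>2 / c\<^sub>2))"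
    for u C and e :: "'y \<Rightarrow> 'v"
  have "\<exists>C e. good u C e" if u: "u \<in> SU" for u
  proof (cases "t u = 0")
    \<comment> \<open>At a null \<open>u\<close> the weights \<open>q\<^sub>2 v u\<close> need not
      sum to one, but there is no mass to lose either, so a single arbitrary codeword will
      do.\<close>
    case True
    obtain v where v: "v \<in> SV" using ne by auto
    have g0: "\<And>x y. x \<in> SX \<Longrightarrow> y \<in> SY \<Longrightarrow> 0 \<le> p x y * k u x" using p0 k0 u by simp
    have "(\<Sum>y\<in>SY. \<Sum>x\<in>SX. p x y * k u x * of_bool (Bad u v x y)) \<le> t u"
      unfolding t_def using g0 by (intro sum_mono) auto
    moreover have "0 \<le> b u" "0 \<le> i u" unfolding b_def i_def using p0 k0 m0 u
      by (auto intro!: sum_nonneg mult_nonneg_nonneg)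
    ultimately have "(\<Sum>y\<in>SY. \<Sum>x\<in>SX. p x y * k u x * of_bool (Bad u v x y)) \<le>
      \<theta>\<^sub>2 * t u + b u / \<theta>\<^sub>2 + i u + t u * exp (- (real M\<^sub>2 / c\<^sub>2))" 
      using True th by (auto intro: order_trans add_nonneg_nonneg)
    then show ?thesis using v M by (intro exI[of _ "{v}"] exI[of _ "\<lambda>_. v"]) (auto simp: good_def)
  next
    case False
    have "\<exists>C\<subseteq>SV. \<exists>e. C \<noteq> {} \<and> card C \<le> M\<^sub>2 \<and> (\<forall>y. e y \<in> C) \<and>
     (\<Sum>y\<in>SY. \<Sum>x\<in>SX. p x y * k u x * of_bool (Bad u (e y) x y)) \<le>
      \<theta>\<^sub>2 * (\<Sum>y\<in>SY. \<Sum>x\<in>SX. p x y * k u x)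
      + (\<Sum>y\<in>SY. \<Sum>v\<in>SV. \<Sum>x\<in>SX. p x y * k u x * m v u y * of_bool (Bad u v x y)) / \<theta>\<^sub>2
      + (\<Sum>y\<in>SY. \<Sum>v\<in>SV. (\<Sum>x\<in>SX. p x y * k u x) * m v u y * of_bool (q\<^sub>2 v u * c\<^sub>2 < m v u y))
      + (\<Sum>y\<in>SY. \<Sum>x\<in>SX. p x y * k u x) * exp (- (real M\<^sub>2 / c\<^sub>2))"
      by (rule one_sided_encoder)
         (simp_all add: fin p0 k0 m0 q20 q21 m1 c th M u False[unfolded t_def])
    then show ?thesis unfolding good_def t_def b_def i_def by (elim exE conjE) (intro exI conjI)
  qed
  then have "\<exists>CV eV. \<forall>u\<in>SU. good u (CV u) (eV u)" by metis
  then obtain CV eV where "\<And>u. u \<in> SU \<Longrightarrow> good u (CV u) (eV u)" by blast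
  note V = this[unfolded good_def]
  have t1: "sum t SU = 1"
  proof -
    have "sum t SU = (\<Sum>u\<in>SU. \<Sum>x\<in>SX. \<Sum>y\<in>SY. p x y * k u x)"
      unfolding t_def by (intro sum.cong refl sum.swap)
    also have "\<dots> = (\<Sum>x\<in>SX. \<Sum>u\<in>SU. \<Sum>y\<in>SY. p x y * k u x)" by (rule sum.swap)
    also have "\<dots> = (\<Sum>x\<in>SX. (\<Sum>y\<in>SY. p x y) * (\<Sum>u\<in>SU. k u x))"
      by (simp add: sum_distrib_left sum_distrib_right)
    also have "\<dots> = (\<Sum>x\<in>SX. (\<Sum>y\<in>SY. p x y))"
    proof (intro sum.cong refl)
      fix x assume "x \<in> SX"
      then show "(\<Sum>y\<in>SY. p x y) * (\<Sum>u\<in>SU. k u x) = (\<Sum>y\<in>SY. p x y)"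
        using k1[of x] by (cases "(\<Sum>y\<in>SY. p x y) = 0") auto
    qed
    finally show ?thesis using p1 by simp
  qed
  have "(\<Sum>x\<in>SX. \<Sum>u\<in>SU. \<Sum>y\<in>SY. p x y * k u x * of_bool (Bad u (eV u y) x y)) =
    (\<Sum>u\<in>SU. \<Sum>y\<in>SY. \<Sum>x\<in>SX. p x y * k u x * of_bool (Bad u (eV u y) x y))"
    by (subst sum.swap) (intro sum.cong refl sum.swap)
  also have "\<dots> \<le> (\<Sum>u\<in>SU. \<theta>\<^sub>2 * t u + b u / \<theta>\<^sub>2 + i u + t u * exp (- (real M\<^sub>2 / c\<^sub>2)))"
    using V by (intro sum_mono) auto
  also have "\<dots> = \<theta>\<^sub>2 * sum t SU + sum b SU / \<theta>\<^sub>2 + sum i SU + sum t SU * exp (- (real M\<^sub>2 / c\<^sub>2))"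
    by (simp add: sum.distrib sum_distrib_left sum_distrib_right sum_divide_distrib)
  also have "\<dots> = \<theta>\<^sub>2 + \<eta> / \<theta>\<^sub>2 + \<eta>\<^sub>2 + exp (- (real M\<^sub>2 / c\<^sub>2))"
    by (simp add: t1 b_def[abs_def] i_def[abs_def] \<eta>_def \<eta>\<^sub>2_def)
  finally have fail: "(\<Sum>x\<in>SX. \<Sum>u\<in>SU. \<Sum>y\<in>SY. p x y * k u x * of_bool (Bad u (eV u y) x y)) \<le>
    \<theta>\<^sub>2 + \<eta> / \<theta>\<^sub>2 + \<eta>\<^sub>2 + exp (- (real M\<^sub>2 / c\<^sub>2))" .
  have "\<exists>C\<subseteq>SU. \<exists>e. C \<noteq> {} \<and> card C \<le> M\<^sub>1 \<and> (\<forall>x. e x \<in> C) \<and>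
     (\<Sum>x\<in>SX. \<Sum>y\<in>SY. p x y * of_bool (Bad (e x) (eV (e x) y) x y)) \<le>
      \<theta>\<^sub>1 * (\<Sum>x\<in>SX. \<Sum>y\<in>SY. p x y)
      + (\<Sum>x\<in>SX. \<Sum>u\<in>SU. \<Sum>y\<in>SY. p x y * k u x * of_bool (Bad u (eV u y) x y)) / \<theta>\<^sub>1
      + (\<Sum>x\<in>SX. \<Sum>u\<in>SU. (\<Sum>y\<in>SY. p x y) * k u x * of_bool (q\<^sub>1 u * c\<^sub>1 < k u x))
      + (\<Sum>x\<in>SX. \<Sum>y\<in>SY. p x y) * exp (- (real M\<^sub>1 / c\<^sub>1))"
    by (rule one_sided_encoder) (simp_all add: fin p0 k0 q10 q11 k1 c th M)
  then obtain CU eU where U: "CU \<subseteq> SU" "CU \<noteq> {}" "card CU \<le> M\<^sub>1" "\<forall>x. eU x \<in> CU"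
     "(\<Sum>x\<in>SX. \<Sum>y\<in>SY. p x y * of_bool (Bad (eU x) (eV (eU x) y) x y)) \<le>
      \<theta>\<^sub>1 + (\<Sum>x\<in>SX. \<Sum>u\<in>SU. \<Sum>y\<in>SY. p x y * k u x * of_bool (Bad u (eV u y) x y)) / \<theta>\<^sub>1 + \<eta>\<^sub>1
       + exp (- (real M\<^sub>1 / c\<^sub>1))"
    unfolding p1 \<eta>\<^sub>1_def mult_1_right mult_1_left by (elim exE conjE)
  note U(5)
  also have "(\<Sum>x\<in>SX. \<Sum>u\<in>SU. \<Sum>y\<in>SY. p x y * k u x * of_bool (Bad u (eV u y) x y)) / \<theta>\<^sub>1 \<le>
    (\<theta>\<^sub>2 + \<eta> / \<theta>\<^sub>2 + \<eta>\<^sub>2 + exp (- (real M\<^sub>2 / c\<^sub>2))) / \<theta>\<^sub>1"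
    using fail th by (intro divide_right_mono) auto
  finally have "(\<Sum>x\<in>SX. \<Sum>y\<in>SY. p x y * of_bool (Bad (eU x) (eV (eU x) y) x y)) \<le>
     \<theta>\<^sub>1 + (\<theta>\<^sub>2 + \<eta> / \<theta>\<^sub>2 + \<eta>\<^sub>2 + exp (- (real M\<^sub>2 / c\<^sub>2))) / \<theta>\<^sub>1 + \<eta>\<^sub>1 + exp (- (real M\<^sub>1 / c\<^sub>1))"
    by simp
  then show ?thesis using U V by (intro exI[of _ CU] exI[of _ eU] exI[of _ CV] exI[of _ eV]) blast
qed

section \<open>Sequences and the weak law\<close>

definition seqs :: "nat \<Rightarrow> 'a set \<Rightarrow> 'a list set" where
  "seqs n A = {xs. set xs \<subseteq> A \<and> length xs = n}"

lemma finite_seqs [simp]: "finite A \<Longrightarrow> finite (seqs n A)"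
  unfolding seqs_def by (rule finite_lists_length_eq)

lemma seqs_0 [simp]: "seqs 0 A = {[]}"
  by (auto simp: seqs_def)

lemma seqs_UNIV [simp]: "seqs n UNIV = {xs. length xs = n}"
  by (simp add: seqs_def)

lemma length_seqs: "xs \<in> seqs n A \<Longrightarrow> length xs = n"
  by (auto simp: seqs_def)

lemma sum_seqs_Suc:
  "(\<Sum>xs\<in>seqs (Suc n) A. f xs) = (\<Sum>a\<in>A. \<Sum>xs\<in>seqs n A. f (a # xs))"
proof -
  have "(\<Sum>xs\<in>seqs (Suc n) A. f xs) = (\<Sum>(a, xs)\<in>A \<times> seqs n A. f (a # xs))"
    by (rule sum.reindex_bij_witness[where i="\<lambda>(a, xs). a # xs" and j="\<lambda>xs. (hd xs, tl xs)"])
       (auto simp: seqs_def length_Suc_conv)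
  then show ?thesis by (simp add: sum.cartesian_product)
qed

lemma sum_seqs_Times:
  "(\<Sum>zs\<in>seqs n (A \<times> B). f (map fst zs) (map snd zs)) = (\<Sum>xs\<in>seqs n A. \<Sum>ys\<in>seqs n B. f xs ys)"
proof -
  have "(\<Sum>zs\<in>seqs n (A \<times> B). f (map fst zs) (map snd zs)) = (\<Sum>(xs, ys)\<in>seqs n A \<times> seqs n B. f xs ys)"
    by (rule sum.reindex_bij_witness[where i="\<lambda>(xs, ys). zip xs ys" and j="\<lambda>zs. (map fst zs, map snd zs)"])
       (auto simp: seqs_def zip_map_fst_snd dest: set_zip_leftD set_zip_rightD)
  then show ?thesis by (simp add: sum.cartesian_product)
qed

text \<open>The factors may depend on the position, so that this also sums a memoryless channel over
  its outputs for a fixed input sequence.\<close>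

lemma sum_prod_seqs:
  fixes f :: "nat \<Rightarrow> 'a \<Rightarrow> real"
  shows "(\<Sum>xs\<in>seqs n A. \<Prod>i<n. f i (xs ! i)) = (\<Prod>i<n. \<Sum>a\<in>A. f i a)"
proof (induction n arbitrary: f)
  case (Suc n)
  show ?case
    by (simp add: sum_seqs_Suc prod.lessThan_Suc_shift sum_distrib_left[symmetric]
        sum_distrib_right[symmetric] Suc.IH[of "\<lambda>i. f (Suc i)"] del: prod.lessThan_Suc)
qed simp

lemma pmf_replicate_pmf:
  "pmf (replicate_pmf n p) xs = (if length xs = n then \<Prod>i<n. pmf p (xs ! i) else 0)"
proof (induction n arbitrary: xs)
  case (Suc n)
  have eq: "replicate_pmf (Suc n) p = map_pmf (\<lambda>(x, xs). x # xs) (pair_pmf p (replicate_pmf n p))"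
    by (simp add: pair_pmf_def map_pmf_def bind_assoc_pmf bind_return_pmf)
  show ?case
  proof (cases xs)
    case Nil
    have "[] \<notin> set_pmf (replicate_pmf (Suc n) p)" by (simp only: set_replicate_pmf) auto
    then show ?thesis by (simp only: Nil) (simp del: replicate_pmf.simps add: set_pmf_iff)
  next
    case (Cons y ys)
    have "pmf (replicate_pmf (Suc n) p) xs =
        pmf (map_pmf (\<lambda>(x, xs). x # xs) (pair_pmf p (replicate_pmf n p))) ((\<lambda>(x, xs). x # xs) (y, ys))"
      by (simp only: eq Cons) simp
    also have "\<dots> = pmf (pair_pmf p (replicate_pmf n p)) (y, ys)"
      by (rule pmf_map_inj') (auto simp: inj_on_def)
    finally show ?thesis
      by (simp only: pmf_pair Suc.IH) (simp add: Cons prod.lessThan_Suc_shift del: prod.lessThan_Suc)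
  qed
qed simp

lemma prob_replicate_pmf:
  assumes "finite A" "set_pmf p \<subseteq> A"
  shows "measure_pmf.prob (replicate_pmf n p) {xs. E xs} =
    (\<Sum>xs\<in>seqs n A. (\<Prod>i<n. pmf p (xs ! i)) * of_bool (E xs))"
proof -
  have "measure_pmf.prob (replicate_pmf n p) {xs. E xs} =
      measure_pmf.prob (replicate_pmf n p) {xs \<in> seqs n A. E xs}"
    using assms by (intro measure_prob_cong_0) (auto simp: set_pmf_iff[symmetric] set_replicate_pmf seqs_def
        pmf_eq_0_set_pmf)
  also have "\<dots> = (\<Sum>xs\<in>{xs \<in> seqs n A. E xs}. pmf (replicate_pmf n p) xs)"
    using assms by (intro measure_measure_pmf_finite) auto
  also have "\<dots> = (\<Sum>xs\<in>seqs n A. (\<Prod>i<n. pmf p (xs ! i)) * of_bool (E xs))"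
    using assms by (intro sum.mono_neutral_cong_left) (auto simp: pmf_replicate_pmf length_seqs)
  finally show ?thesis .
qed

text \<open>Additivity of the variance: in the induction step the cross term carries the mean of
  \<open>h\<close>, which is zero.\<close>

lemma second_moment_seqs:
  fixes w h :: "'a \<Rightarrow> real"
  assumes "sum w A = 1" "(\<Sum>a\<in>A. w a * h a) = 0"
  shows "(\<Sum>xs\<in>seqs n A. (\<Prod>i<n. w (xs ! i)) * (\<Sum>i<n. h (xs ! i))\<^sup>2) = real n * (\<Sum>a\<in>A. w a * (h a)\<^sup>2)"
proof (induction n)
  case (Suc n)
  define W where "W xs = (\<Prod>i<n. w (xs ! i))" for xs
  define S where "S xs = (\<Sum>i<n. h (xs ! i))" for xs
  have W1: "sum W (seqs n A) = 1"
    unfolding W_def[abs_def] using sum_prod_seqs[where n=n and A=A and f="\<lambda>_. w"] assms by simp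
  have "(\<Sum>xs\<in>seqs (Suc n) A. (\<Prod>i<Suc n. w (xs ! i)) * (\<Sum>i<Suc n. h (xs ! i))\<^sup>2) =
      (\<Sum>a\<in>A. \<Sum>xs\<in>seqs n A. w a * W xs * (h a + S xs)\<^sup>2)"
    unfolding sum_seqs_Suc prod.lessThan_Suc_shift sum.lessThan_Suc_shift by (simp add: W_def S_def)
  also have "\<dots> = (\<Sum>a\<in>A. \<Sum>xs\<in>seqs n A. w a * (h a)\<^sup>2 * W xs + (w a * h a) * (2 * (W xs * S xs)) + w a * (W xs * (S xs)\<^sup>2))"
    by (intro sum.cong refl) (simp add: power2_sum algebra_simps)
  also have "\<dots> = (\<Sum>a\<in>A. w a * (h a)\<^sup>2) * sum W (seqs n A)
     + (\<Sum>a\<in>A. w a * h a) * (\<Sum>xs\<in>seqs n A. 2 * (W xs * S xs))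
     + sum w A * (\<Sum>xs\<in>seqs n A. W xs * (S xs)\<^sup>2)"
    by (simp only: sum.distrib sum_product)
  also have "\<dots> = (\<Sum>a\<in>A. w a * (h a)\<^sup>2) + real n * (\<Sum>a\<in>A. w a * (h a)\<^sup>2)"
    using Suc.IH assms W1 by (simp add: W_def S_def)
  finally show ?case by (simp add: algebra_simps)
qed simp

text \<open>Chebyshev's inequality, with bound \<open>V / \<delta>\<^sup>2\<close> divided by
  \<open>n\<close>. Mere convergence to 0 is enough later, since only the first kind of error is
  controlled by it.\<close>

lemma weak_law_replicate_pmf:
  fixes g :: "'a \<Rightarrow> real"
  assumes fin: "finite (set_pmf Q)" and d: "\<delta> > 0"
  defines "\<mu> \<equiv> \<Sum>z\<in>set_pmf Q. pmf Q z * g z"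
  shows "(\<lambda>n. measure_pmf.prob (replicate_pmf n Q) {zs. real n * \<delta> < \<bar>(\<Sum>i<n. g (zs ! i)) - real n * \<mu>\<bar>}) \<longlonglongrightarrow> 0"
proof -
  let ?A = "set_pmf Q"
  define h where "h z = g z - \<mu>" for z
  define V where "V = (\<Sum>a\<in>?A. pmf Q a * (h a)\<^sup>2)"
  have Q1: "sum (pmf Q) ?A = 1" using fin by (simp add: sum_pmf_eq_1)
  have h0: "(\<Sum>a\<in>?A. pmf Q a * h a) = 0"
    using Q1 by (simp add: h_def right_diff_distrib sum_subtractf sum_distrib_right[symmetric] \<mu>_def)
  have "measure_pmf.prob (replicate_pmf n Q) {zs. real n * \<delta> < \<bar>(\<Sum>i<n. g (zs ! i)) - real n * \<mu>\<bar>}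
    \<le> V / \<delta>\<^sup>2 * inverse (real n)" if n: "n > 0" for n
  proof -
    have "(\<Sum>i<n. h (zs ! i)) = (\<Sum>i<n. g (zs ! i)) - real n * \<mu>" for zs
      by (simp add: h_def sum_subtractf)
    then have "measure_pmf.prob (replicate_pmf n Q) {zs. real n * \<delta> < \<bar>(\<Sum>i<n. g (zs ! i)) - real n * \<mu>\<bar>} =
      (\<Sum>xs\<in>seqs n ?A. (\<Prod>i<n. pmf Q (xs ! i)) * of_bool (real n * \<delta> < \<bar>\<Sum>i<n. h (xs ! i)\<bar>))"
      using prob_replicate_pmf[OF fin subset_refl] by simp
    also have "\<dots> \<le> (\<Sum>xs\<in>seqs n ?A. (\<Prod>i<n. pmf Q (xs ! i)) * ((\<Sum>i<n. h (xs ! i))\<^sup>2 / (real n * \<delta>)\<^sup>2))"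
    proof (intro sum_mono mult_left_mono)
      fix xs
      show "of_bool (real n * \<delta> < \<bar>\<Sum>i<n. h (xs ! i)\<bar>) \<le> (\<Sum>i<n. h (xs ! i))\<^sup>2 / (real n * \<delta>)\<^sup>2"
      proof (cases "real n * \<delta> < \<bar>\<Sum>i<n. h (xs ! i)\<bar>")
        case True
        have "(real n * \<delta>)\<^sup>2 \<le> \<bar>\<Sum>i<n. h (xs ! i)\<bar>\<^sup>2"
          using True d by (intro power_mono) auto
        then show ?thesis using True n d by (simp add: field_simps)
      qed simp
    qed (auto intro: prod_nonneg)
    also have "\<dots> = real n * V / (real n * \<delta>)\<^sup>2"
      unfolding V_def second_moment_seqs[OF Q1 h0, symmetric] by (simp add: sum_divide_distrib)
    also have "\<dots> = V / \<delta>\<^sup>2 * inverse (real n)"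
      using n by (simp add: field_simps power2_eq_square)
    finally show ?thesis .
  qed
  then have "eventually (\<lambda>n. measure_pmf.prob (replicate_pmf n Q) {zs. real n * \<delta> < \<bar>(\<Sum>i<n. g (zs ! i)) - real n * \<mu>\<bar>}
    \<le> V / \<delta>\<^sup>2 * inverse (real n)) sequentially"
    by (rule eventually_mono[OF eventually_gt_at_top[of 0]])
  moreover have "(\<lambda>n. V / \<delta>\<^sup>2 * inverse (real n)) \<longlonglongrightarrow> 0"
    using tendsto_mult_right_zero[OF lim_inverse_n] by blast
  ultimately show ?thesis
    by (rule tendsto_sandwich[OF always_eventually _ tendsto_const, rotated]) auto
qed

section \<open>Types\<close>

text \<open>The product vanishes at 0 and is continuous on \<open>{0..}\<close>, so entropy-like
  sums can be passed to limits in which some probabilities disappear.\<close>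

definition xlog :: "real \<Rightarrow> real" where "xlog t = t * log 2 t"

lemma continuous_on_xlog: "continuous_on {0..} xlog"
proof (rule continuous_on_eq_continuous_within[THEN iffD2], rule ballI)
  fix t :: real assume t: "t \<in> {0..}"
  show "continuous (at t within {0..}) xlog"
  proof (cases "t = 0")
    case True
    have "((\<lambda>x::real. x * log 2 x) \<longlongrightarrow> 0) (at_right 0)" by real_asymp
    moreover have "at (0::real) within {0..} = at_right 0" by (simp add: at_within_Ici_at_right)
    ultimately show ?thesis by (simp add: True continuous_within xlog_def[abs_def])
  next
    case False
    then have "isCont (\<lambda>t. t * log 2 t) t" using t by (intro continuous_intros) auto
    then show ?thesis unfolding xlog_def[abs_def] by (rule continuous_at_imp_continuous_within)
  qed
qed

lemma tendsto_xlog: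
  assumes "f \<longlonglongrightarrow> l" "\<And>n. 0 \<le> f n"
  shows "(\<lambda>n. xlog (f n)) \<longlonglongrightarrow> xlog l"
proof -
  have "0 \<le> l" using assms by (intro LIMSEQ_le_const) auto
  then show ?thesis
    using continuous_on_tendsto_compose[OF continuous_on_xlog assms(1)] assms(2) by auto
qed

text \<open>Bolzano-Weierstrass, refining the subsequence for one coordinate after another.\<close>

lemma finite_pointwise_convergent_subsequence:
  fixes f :: "nat \<Rightarrow> 's \<Rightarrow> real"
  assumes "finite S" "\<And>k s. s \<in> S \<Longrightarrow> \<bar>f k s\<bar> \<le> B"
  shows "\<exists>r l. strict_mono r \<and> (\<forall>s\<in>S. (\<lambda>k. f (r k) s) \<longlonglongrightarrow> l s)"
  using assms
proof (induction S)
  case empty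
  show ?case by (intro exI[of _ id]) (simp add: strict_mono_def)
next
  case (insert a S)
  then obtain r l where r: "strict_mono r" "\<forall>s\<in>S. (\<lambda>k. f (r k) s) \<longlonglongrightarrow> l s" by auto
  have "bounded (range (\<lambda>k. f (r k) a))"
    using insert.prems by (auto simp: bounded_iff)
  then obtain m r' where r': "strict_mono (r' :: nat \<Rightarrow> nat)" "((\<lambda>k. f (r k) a) \<circ> r') \<longlonglongrightarrow> m"
    using bounded_imp_convergent_subsequence by blast
  have "(\<lambda>k. f ((r \<circ> r') k) s) \<longlonglongrightarrow> (l(a := m)) s" if "s \<in> insert a S" for s
  proof (cases "s = a")
    case True
    then show ?thesis using r'(2) by (simp add: o_def)
  next
    case False
    then have "(\<lambda>k. f (r k) s) \<longlonglongrightarrow> l s" using r that by simp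
    from LIMSEQ_subseq_LIMSEQ[OF this r'(1)] show ?thesis using False by (simp add: o_def)
  qed
  then show ?case using strict_mono_o[OF r(1) r'(1)] by blast
qed

text \<open>For the joint law \<open>T\<close> of two variables, \<open>rate_fun W p T\<close> is the divergence of \<open>T\<close> from the law
  with the same first marginal under which the second variable is independent of the first and
  has law \<open>p\<close> (provided that \<open>T\<close> vanishes where \<open>p\<close> does).\<close>

definition rate_fun :: "'w set \<Rightarrow> ('z \<Rightarrow> real) \<Rightarrow> ('w \<times> 'z::finite \<Rightarrow> real) \<Rightarrow> real" where
  "rate_fun W p T = (\<Sum>w\<in>W. (\<Sum>z\<in>UNIV. xlog (T (w, z)) - T (w, z) * log 2 (p z)) - xlog (\<Sum>z\<in>UNIV. T (w, z)))"

lemma tendsto_rate_fun: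
  assumes "finite W" "\<And>w z. w \<in> W \<Longrightarrow> (\<lambda>k. T k (w, z)) \<longlonglongrightarrow> L (w, z)"
    and "\<And>k w z. 0 \<le> T k (w, z)"
  shows "(\<lambda>k. rate_fun W p (T k)) \<longlonglongrightarrow> rate_fun W p L"
  unfolding rate_fun_def using assms
  by (intro tendsto_intros tendsto_xlog sum_nonneg) auto

section \<open>Counting by joint types\<close>

definition type_count :: "'w list \<Rightarrow> 'z list \<Rightarrow> 'w \<times> 'z \<Rightarrow> nat" where
  "type_count ws zs s = card {i. i < length ws \<and> (ws ! i, zs ! i) = s}"

lemma type_count_pos:
  "i < length ws \<Longrightarrow> 0 < type_count ws zs (ws ! i, zs ! i)"
  by (auto simp: type_count_def card_gt_0_iff)

lemma type_count_le: "type_count ws zs s \<le> length ws"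
proof -
  have "type_count ws zs s \<le> card {..<length ws}"
    unfolding type_count_def by (intro card_mono) auto
  then show ?thesis by simp
qed

lemma prod_type_count:
  fixes r :: "'w \<times> 'z::finite \<Rightarrow> real"
  assumes "finite W" "set ws \<subseteq> W"
  shows "(\<Prod>i<length ws. r (ws ! i, zs ! i)) = (\<Prod>s\<in>W \<times> UNIV. r s ^ type_count ws zs s)"
proof -
  have "(\<Prod>s\<in>W \<times> UNIV. r s ^ type_count ws zs s) =
      (\<Prod>s\<in>W \<times> UNIV. \<Prod>i\<in>{i. i \<in> {..<length ws} \<and> (ws ! i, zs ! i) = s}. r (ws ! i, zs ! i))"
    by (intro prod.cong refl) (simp add: type_count_def)
  also have "\<dots> = (\<Prod>i<length ws. r (ws ! i, zs ! i))"
    using assms by (intro prod.group) (auto dest: nth_mem)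
  finally show ?thesis by simp
qed

lemma sum_type_count:
  fixes r :: "'w \<times> 'z::finite \<Rightarrow> real"
  assumes "finite W" "set ws \<subseteq> W"
  shows "(\<Sum>s\<in>W \<times> UNIV. real (type_count ws zs s) * r s) = (\<Sum>i<length ws. r (ws ! i, zs ! i))"
proof -
  have "(\<Sum>s\<in>W \<times> UNIV. real (type_count ws zs s) * r s) =
      (\<Sum>s\<in>W \<times> UNIV. \<Sum>i\<in>{i. i \<in> {..<length ws} \<and> (ws ! i, zs ! i) = s}. r (ws ! i, zs ! i))"
    by (intro sum.cong refl) (simp add: type_count_def)
  also have "\<dots> = (\<Sum>i<length ws. r (ws ! i, zs ! i))"
    using assms by (intro sum.group) (auto dest: nth_mem)
  finally show ?thesis by simp
qed

text \<open>Normalising the counts changes the two \<open>xlog\<close> contributions of a row by the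
  same multiple of \<open>log 2 (real n)\<close>, so these cancel. The rest is written per count,
  ready to be compared with the exponent of a product over symbol pairs.\<close>

lemma rate_fun_scale:
  fixes N :: "'w \<times> 'z::finite \<Rightarrow> nat"
  assumes n: "n > 0"
  shows "real n * rate_fun W p (\<lambda>s. real (N s) / real n) =
    (\<Sum>w\<in>W. \<Sum>z\<in>UNIV. real (N (w, z)) * (log 2 (real (N (w, z))) - log 2 (p z) - log 2 (real (\<Sum>z\<in>UNIV. N (w, z)))))"
proof -
  have x: "real n * xlog (real a / real n) = real a * log 2 (real a) - real a * log 2 (real n)" for a
    using n by (cases "a = 0") (auto simp: xlog_def log_divide algebra_simps)
  have "real n * ((\<Sum>z\<in>UNIV. xlog (real (N (w, z)) / real n) - real (N (w, z)) / real n * log 2 (p z))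
      - xlog (\<Sum>z\<in>UNIV. real (N (w, z)) / real n)) =
    (\<Sum>z\<in>UNIV. real (N (w, z)) * (log 2 (real (N (w, z))) - log 2 (p z) - log 2 (real (\<Sum>z\<in>UNIV. N (w, z)))))" for w
  proof -
    have s: "(\<Sum>z\<in>UNIV. real (N (w, z)) / real n) = real (\<Sum>z\<in>UNIV. N (w, z)) / real n"
      by (simp add: sum_divide_distrib)
    have "real n * ((\<Sum>z\<in>UNIV. xlog (real (N (w, z)) / real n) - real (N (w, z)) / real n * log 2 (p z))
      - xlog (\<Sum>z\<in>UNIV. real (N (w, z)) / real n)) =
      (\<Sum>z\<in>UNIV. real n * xlog (real (N (w, z)) / real n) - real (N (w, z)) * log 2 (p z))
      - real n * xlog (real (\<Sum>z\<in>UNIV. N (w, z)) / real n)"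
      unfolding s right_diff_distrib sum_distrib_left using n by simp
    also have "\<dots> = (\<Sum>z\<in>UNIV. real (N (w, z)) * log 2 (real (N (w, z))) - real (N (w, z)) * log 2 (real n) - real (N (w, z)) * log 2 (p z))
      - (real (\<Sum>z\<in>UNIV. N (w, z)) * log 2 (real (\<Sum>z\<in>UNIV. N (w, z))) - real (\<Sum>z\<in>UNIV. N (w, z)) * log 2 (real n))"
      unfolding x ..
    also have "\<dots> = (\<Sum>z\<in>UNIV. real (N (w, z)) * (log 2 (real (N (w, z))) - log 2 (p z) - log 2 (real (\<Sum>z\<in>UNIV. N (w, z)))))"
      by (simp add: right_diff_distrib sum_subtractf sum_distrib_right)
    finally show ?thesis .
  qed
  then show ?thesis unfolding rate_fun_def sum_distrib_left by simp
qed

text \<open>On a type class the product law \<open>p\<close> is a constant multiple of the memoryless channel whose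
  transition probabilities are the empirical ones, and the latter has total mass at most one.\<close>

lemma type_class_prob_le:
  fixes P :: "'z::finite pmf"
  assumes W: "finite W" "set ws \<subseteq> W" and n: "n > 0" "length ws = n"
    and ac: "\<And>w z. w \<in> W \<Longrightarrow> pmf P z = 0 \<Longrightarrow> N (w, z) = 0"
  shows "measure_pmf.prob (replicate_pmf n P) {zs. \<forall>s\<in>W \<times> UNIV. type_count ws zs s = N s}
    \<le> 2 powr (- (real n * rate_fun W (pmf P) (\<lambda>s. real (N s) / real n)))"
proof -
  define Nw where "Nw w = (\<Sum>z\<in>UNIV. N (w, z))" for w
  \<comment> \<open>\<open>V\<close> is the empirical channel and \<open>r\<close> the ratio of
    \<open>pmf P\<close> to it. A row with \<open>Nw w = 0\<close> becomes a zero row through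
    division by zero, which is why row sums are bounded by one and not equal to one.\<close>
  define V where "V s = real (N s) / real (Nw (fst s))" for s
  define r where "r s = pmf P (snd s) * real (Nw (fst s)) / real (N s)" for s
  define K where "K = (\<Prod>s\<in>W \<times> UNIV. r s ^ N s)"
  have le: "N (w, z) \<le> Nw w" for w z
    unfolding Nw_def by (rule member_le_sum) auto
  have V0: "0 \<le> V s" for s by (simp add: V_def)
  have r0: "0 \<le> r s" for s by (simp add: r_def)
  have eq: "(\<Prod>i<n. pmf P (zs ! i)) = (\<Prod>i<n. V (ws ! i, zs ! i)) * K"
    if zs: "\<forall>s\<in>W \<times> UNIV. type_count ws zs s = N s" for zs
  proof -
    have "pmf P (zs ! i) = V (ws ! i, zs ! i) * r (ws ! i, zs ! i)" if i: "i < n" for i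
    proof -
      have "ws ! i \<in> W" using i n W by auto
      then have "0 < N (ws ! i, zs ! i)" using type_count_pos[of i ws zs] i n zs by simp
      then show ?thesis using le[of "ws ! i" "zs ! i"] by (simp add: V_def r_def)
    qed
    then have "(\<Prod>i<n. pmf P (zs ! i)) = (\<Prod>i<n. V (ws ! i, zs ! i) * r (ws ! i, zs ! i))"
      by (intro prod.cong) auto
    also have "\<dots> = (\<Prod>i<n. V (ws ! i, zs ! i)) * (\<Prod>s\<in>W \<times> UNIV. r s ^ type_count ws zs s)"
      unfolding prod.distrib using prod_type_count[OF W, of r zs] n by simp
    also have "(\<Prod>s\<in>W \<times> UNIV. r s ^ type_count ws zs s) = K"
      unfolding K_def using zs by (intro prod.cong) auto
    finally show ?thesis .
  qed
  have K0: "0 \<le> K" unfolding K_def using r0 by (intro prod_nonneg) auto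
  have "measure_pmf.prob (replicate_pmf n P) {zs. \<forall>s\<in>W \<times> UNIV. type_count ws zs s = N s} =
    (\<Sum>zs\<in>seqs n UNIV. (\<Prod>i<n. pmf P (zs ! i)) * of_bool (\<forall>s\<in>W \<times> UNIV. type_count ws zs s = N s))"
    by (rule prob_replicate_pmf) auto
  also have "\<dots> \<le> (\<Sum>zs\<in>seqs n UNIV. (\<Prod>i<n. V (ws ! i, zs ! i)) * K)"
  proof (rule sum_mono)
    fix zs
    show "(\<Prod>i<n. pmf P (zs ! i)) * of_bool (\<forall>s\<in>W \<times> UNIV. type_count ws zs s = N s) \<le> (\<Prod>i<n. V (ws ! i, zs ! i)) * K"
    proof (cases "\<forall>s\<in>W \<times> UNIV. type_count ws zs s = N s")
      case True
      then show ?thesis using eq[OF True] by simp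
    next
      case False
      have "0 \<le> (\<Prod>i<n. V (ws ! i, zs ! i)) * K" using K0 V0 by (intro mult_nonneg_nonneg prod_nonneg) auto
      moreover have "of_bool (\<forall>s\<in>W \<times> UNIV. type_count ws zs s = N s) = (0::real)"
        using False by (simp only: of_bool_def if_False)
      ultimately show ?thesis by (simp only: mult_zero_right)
    qed
  qed
  also have "\<dots> = (\<Prod>i<n. \<Sum>z\<in>UNIV. V (ws ! i, z)) * K"
    unfolding sum_distrib_right[symmetric] sum_prod_seqs[where f="\<lambda>i z. V (ws ! i, z)"] ..
  also have "\<dots> \<le> 1 * K"
  proof (intro mult_right_mono K0 prod_le_1 conjI)
    fix i
    show "(\<Sum>z\<in>UNIV. V (ws ! i, z)) \<le> 1"
      by (cases "Nw (ws ! i) = 0")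
        (simp_all add: V_def sum_divide_distrib[symmetric] of_nat_sum[symmetric] Nw_def[symmetric] del: of_nat_sum)
    show "0 \<le> (\<Sum>z\<in>UNIV. V (ws ! i, z))" using V0 by (intro sum_nonneg) auto
  qed
  also have "K = (\<Prod>s\<in>W \<times> UNIV. 2 powr (real (N s) * log 2 (r s)))"
    unfolding K_def
  proof (intro prod.cong refl)
    fix s :: "'a \<times> 'z" assume s: "s \<in> W \<times> UNIV"
    show "r s ^ N s = 2 powr (real (N s) * log 2 (r s))"
    proof (cases "N s = 0")
      case False
      have "0 < real (N s)" "0 < real (Nw (fst s))" using le[of "fst s" "snd s"] False by auto
      moreover have "pmf P (snd s) \<noteq> 0" using ac[of "fst s" "snd s"] s False by (cases s) auto
      then have "0 < pmf P (snd s)" using pmf_nonneg[of P "snd s"] by linarith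
      ultimately have "0 < r s" unfolding r_def by (intro divide_pos_pos mult_pos_pos)
      then have "2 powr (log 2 (r s) * real (N s)) = r s ^ N s"
        unfolding powr_powr[symmetric] by (simp add: powr_realpow)
      then show ?thesis by (simp add: mult.commute)
    qed simp
  qed
  also have "\<dots> = 2 powr (\<Sum>s\<in>W \<times> UNIV. real (N s) * log 2 (r s))"
    using W by (intro powr_sum[symmetric]) auto
  also have "(\<Sum>s\<in>W \<times> UNIV. real (N s) * log 2 (r s)) =
    - (real n * rate_fun W (pmf P) (\<lambda>s. real (N s) / real n))"
  proof -
    have "real (N (w, z)) * log 2 (r (w, z)) =
      - (real (N (w, z)) * (log 2 (real (N (w, z))) - log 2 (pmf P z) - log 2 (real (\<Sum>z\<in>UNIV. N (w, z)))))"
      if w: "w \<in> W" for w z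
    proof (cases "N (w, z) = 0")
      case False
      then have "pmf P z \<noteq> 0" using ac[OF w, of z] by auto
      then have "0 < pmf P z" using pmf_nonneg[of P z] by linarith
      moreover have "0 < Nw w" using le[of w z] False by simp
      ultimately have r: "log 2 (r (w, z)) = log 2 (pmf P z) + log 2 (real (Nw w)) - log 2 (real (N (w, z)))"
        using False by (simp add: r_def log_divide log_mult)
      show ?thesis unfolding r Nw_def by (simp add: algebra_simps)
    qed simp
    then show ?thesis
      unfolding rate_fun_scale[OF n(1)] by (simp add: sum.cartesian_product' sum_negf[symmetric] del: of_nat_sum)
  qed
  finally show ?thesis by simp
qed

text \<open>Method of types: a union over at most \<open>n + 1\<close> values for each symbol pair.
  The hypothesis \<open>rate\<close> concerns only types that vanish where \<open>pmf P\<close>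
  does, because any sequence of positive probability has such a type; a count vector met by no such
  sequence contributes nothing.\<close>

lemma prob_le_types:
  fixes P :: "'z::finite pmf"
  assumes W: "finite W" "set ws \<subseteq> W" and n: "n > 0" "length ws = n"
    and rate: "\<And>zs. length zs = n \<Longrightarrow> E zs \<Longrightarrow>
      (\<And>w z. w \<in> W \<Longrightarrow> pmf P z = 0 \<Longrightarrow> type_count ws zs (w, z) = 0) \<Longrightarrow>
      F \<le> rate_fun W (pmf P) (\<lambda>s. real (type_count ws zs s) / real n)"
  shows "measure_pmf.prob (replicate_pmf n P) {zs. E zs} \<le>
    (real n + 1) ^ card (W \<times> (UNIV :: 'z set)) * 2 powr (- (real n * F))"
proof -
  let ?S = "W \<times> (UNIV :: 'z set)"
  let ?L = "PiE ?S (\<lambda>_. {..n})"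
  define C where "C N = {zs. \<forall>s\<in>?S. type_count ws zs s = N s}" for N
  have finL: "finite ?L" using W by (intro finite_PiE) auto
  have bound: "measure_pmf.prob (replicate_pmf n P) ({zs. E zs} \<inter> C N) \<le> 2 powr (- (real n * F))" for N
  proof (cases "set_pmf (replicate_pmf n P) \<inter> ({zs. E zs} \<inter> C N) = {}")
    case True
    then have "measure_pmf.prob (replicate_pmf n P) ({zs. E zs} \<inter> C N) = 0"
      by (simp only: measure_pmf_zero_iff)
    then show ?thesis by simp
  next
    case False
    then obtain zs where zs: "zs \<in> set_pmf (replicate_pmf n P)" "E zs" "zs \<in> C N" by auto
    have len: "length zs = n" and sub: "set zs \<subseteq> set_pmf P" using zs(1) by (auto simp: set_replicate_pmf)
    have ac: "type_count ws zs (w, z) = 0" if "pmf P z = 0" for w z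
    proof -
      have "z \<notin> set zs" using that sub by (auto simp: set_pmf_iff)
      then show ?thesis unfolding type_count_def using len n by auto
    qed
    have F: "F \<le> rate_fun W (pmf P) (\<lambda>s. real (type_count ws zs s) / real n)"
      by (rule rate[OF len zs(2)]) (rule ac)
    have "C N = C (type_count ws zs)" using zs(3) by (auto simp: C_def)
    then have "measure_pmf.prob (replicate_pmf n P) ({zs. E zs} \<inter> C N) \<le>
      measure_pmf.prob (replicate_pmf n P) (C (type_count ws zs))"
      by (intro prob_pmf_mono) auto
    also have "\<dots> \<le> 2 powr (- (real n * rate_fun W (pmf P) (\<lambda>s. real (type_count ws zs s) / real n)))"
      unfolding C_def by (rule type_class_prob_le[OF W n]) (rule ac)
    also have "\<dots> \<le> 2 powr (- (real n * F))"
      using F by (intro powr_mono) (auto intro: mult_left_mono)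
    finally show ?thesis .
  qed
  have "{zs. E zs} \<subseteq> (\<Union>N\<in>?L. {zs. E zs} \<inter> C N)"
  proof
    fix zs assume "zs \<in> {zs. E zs}"
    moreover have "restrict (type_count ws zs) ?S \<in> ?L" using type_count_le[of ws zs] n by auto
    moreover have "zs \<in> C (restrict (type_count ws zs) ?S)" by (simp add: C_def)
    ultimately show "zs \<in> (\<Union>N\<in>?L. {zs. E zs} \<inter> C N)" by blast
  qed
  then have "measure_pmf.prob (replicate_pmf n P) {zs. E zs} \<le>
      measure_pmf.prob (replicate_pmf n P) (\<Union>N\<in>?L. {zs. E zs} \<inter> C N)"
    by (intro prob_pmf_mono) auto
  also have "\<dots> \<le> (\<Sum>N\<in>?L. measure_pmf.prob (replicate_pmf n P) ({zs. E zs} \<inter> C N))"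
    using finL by (intro prob_pmf_UN_le) auto
  also have "\<dots> \<le> (\<Sum>N\<in>?L. 2 powr (- (real n * F)))"
    by (intro sum_mono bound)
  also have "\<dots> = (real n + 1) ^ card ?S * 2 powr (- (real n * F))"
    using W by (simp add: card_PiE add.commute)
  finally show ?thesis .
qed

section \<open>Products, marginals and codes\<close>

lemma sum_seqs_zip:
  "(\<Sum>zs\<in>seqs n (A \<times> B). f zs) = (\<Sum>xs\<in>seqs n A. \<Sum>ys\<in>seqs n B. f (zip xs ys))"
proof -
  have "(\<Sum>zs\<in>seqs n (A \<times> B). f zs) = (\<Sum>zs\<in>seqs n (A \<times> B). f (zip (map fst zs) (map snd zs)))"
    by (simp add: zip_map_fst_snd)
  also have "\<dots> = (\<Sum>xs\<in>seqs n A. \<Sum>ys\<in>seqs n B. f (zip xs ys))"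
    by (rule sum_seqs_Times[where f="\<lambda>xs ys. f (zip xs ys)"])
  finally show ?thesis .
qed

lemma prob_replicate_pmf_pair:
  assumes "finite A" "finite B" "set_pmf R \<subseteq> A \<times> B"
  shows "measure_pmf.prob (replicate_pmf n R) {ws. E ws} =
    (\<Sum>as\<in>seqs n A. \<Sum>bs\<in>seqs n B. (\<Prod>i<n. pmf R (as ! i, bs ! i)) * of_bool (E (zip as bs)))"
proof -
  have "measure_pmf.prob (replicate_pmf n R) {ws. E ws} =
    (\<Sum>ws\<in>seqs n (A \<times> B). (\<Prod>i<n. pmf R (ws ! i)) * of_bool (E ws))"
    using assms by (intro prob_replicate_pmf) auto
  also have "\<dots> = (\<Sum>as\<in>seqs n A. \<Sum>bs\<in>seqs n B. (\<Prod>i<n. pmf R (zip as bs ! i)) * of_bool (E (zip as bs)))"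
    by (rule sum_seqs_zip)
  also have "\<dots> = (\<Sum>as\<in>seqs n A. \<Sum>bs\<in>seqs n B. (\<Prod>i<n. pmf R (as ! i, bs ! i)) * of_bool (E (zip as bs)))"
    by (intro sum.cong refl arg_cong2[where f="(*)"] prod.cong) (simp add: length_seqs)
  finally show ?thesis .
qed

section \<open>Likelihood ratios, marginals and empirical frequencies\<close>

lemma prod_pos_imp_pos:
  fixes f :: "nat \<Rightarrow> real"
  assumes "\<And>i. i < n \<Longrightarrow> 0 \<le> f i" "(\<Prod>i<n. f i) \<noteq> 0" "i < n"
  shows "0 < f i"
proof -
  have "f i \<noteq> 0" using assms(2,3) by (auto simp: prod_zero_iff)
  then show ?thesis using assms(1)[OF assms(3)] by simp
qed

text \<open>Translates the second reason for rejecting a codeword, a likelihood ratio above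
  \<open>2 powr (real n * (I + \<delta>))\<close>, into the deviation event of the weak law for the
  information density.\<close>

lemma log_ratio_deviation:
  fixes a b :: "nat \<Rightarrow> real"
  assumes pos: "\<And>i. i < n \<Longrightarrow> 0 < a i" "\<And>i. i < n \<Longrightarrow> 0 < b i"
    and lt: "(\<Prod>i<n. b i) * 2 powr (real n * (I + \<delta>)) < (\<Prod>i<n. a i)"
  shows "real n * \<delta> < \<bar>(\<Sum>i<n. log 2 (a i / b i)) - real n * I\<bar>"
proof -
  have A: "0 < (\<Prod>i<n. a i)" and B: "0 < (\<Prod>i<n. b i)" using pos by (auto intro: prod_pos)
  have "2 powr (real n * (I + \<delta>)) < (\<Prod>i<n. a i) / (\<Prod>i<n. b i)"
    using lt B by (simp add: field_simps)
  also have "\<dots> = (\<Prod>i<n. a i / b i)" by (simp add: prod_dividef)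
  also have "\<dots> = (\<Prod>i<n. 2 powr (log 2 (a i / b i)))" using pos by (intro prod.cong) auto
  also have "\<dots> = 2 powr (\<Sum>i<n. log 2 (a i / b i))" by (rule powr_sum[symmetric]) auto
  finally have "real n * (I + \<delta>) < (\<Sum>i<n. log 2 (a i / b i))" by simp
  then show ?thesis by (simp add: algebra_simps)
qed

text \<open>\<open>g\<close> parametrises a part of the fibre over \<open>b\<close> that contains
  everything of positive mass, so a marginal becomes a sum over the coordinate that is
  dropped.\<close>

lemma pmf_map_eq_sum:
  assumes "finite A" "inj_on g A" "\<And>a. a \<in> A \<Longrightarrow> f (g a) = b"
    and "\<And>w. w \<in> set_pmf Q \<Longrightarrow> f w = b \<Longrightarrow> w \<in> g ` A"
  shows "pmf (map_pmf f Q) b = (\<Sum>a\<in>A. pmf Q (g a))"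
proof -
  have "pmf (map_pmf f Q) b = measure_pmf.prob Q (f -` {b})" by (rule pmf_map)
  also have "\<dots> = measure_pmf.prob Q (g ` A)"
    using assms by (intro measure_prob_cong_0) (auto simp: pmf_eq_0_set_pmf)
  also have "\<dots> = (\<Sum>a\<in>A. pmf Q (g a))"
    using assms by (simp add: measure_measure_pmf_finite sum.reindex)
  finally show ?thesis .
qed

lemma pmf_bar_law:
  fixes P1 :: "('x::finite \<times> 'y::finite) pmf"
  shows "pmf (bar_law P1 \<kappa> \<mu>) (u, v, x, y) = pmf P1 (x, y) * pmf (\<kappa> x) u * pmf (\<mu> (u, y)) v"
proof -
  define B where "B x' y' = (\<kappa> x' \<bind> (\<lambda>u. \<mu> (u, y') \<bind> (\<lambda>v. return_pmf (u, v, x', y'))))" for x' y'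
  have v: "pmf (\<mu> (u', y) \<bind> (\<lambda>v. return_pmf (u', v, x, y))) (u, v, x, y) =
      indicator {u} u' * pmf (\<mu> (u, y)) v" for u'
  proof (cases "u' = u")
    case True
    have "pmf (map_pmf (\<lambda>v. (u, v, x, y)) (\<mu> (u, y))) ((\<lambda>v. (u, v, x, y)) v) = pmf (\<mu> (u, y)) v"
      by (rule pmf_map_inj') (auto simp: inj_on_def)
    then show ?thesis using True by (simp add: map_pmf_def)
  next
    case False
    then show ?thesis by (auto simp: pmf_eq_0_set_pmf)
  qed
  have B: "pmf (B x y) (u, v, x, y) = pmf (\<kappa> x) u * pmf (\<mu> (u, y)) v"
    unfolding B_def pmf_bind[of "\<kappa> x"] v by (simp add: measure_pmf_single)
  have B0: "pmf (B x' y') (u, v, x, y) = 0" if "(x', y') \<noteq> (x, y)" for x' y'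
    using that by (auto simp: pmf_eq_0_set_pmf B_def)
  have "bar_law P1 \<kappa> \<mu> = P1 \<bind> (\<lambda>z. B (fst z) (snd z))"
    by (simp add: bar_law_def B_def split_def)
  then have "pmf (bar_law P1 \<kappa> \<mu>) (u, v, x, y) = (\<Sum>z\<in>UNIV. pmf (B (fst z) (snd z)) (u, v, x, y) * pmf P1 z)"
    by (simp add: pmf_bind integral_measure_pmf_real[where A=UNIV])
  also have "\<dots> = (\<Sum>z\<in>{(x, y)}. pmf (B (fst z) (snd z)) (u, v, x, y) * pmf P1 z)"
  proof (intro sum.mono_neutral_right ballI)
    fix z assume "z \<in> UNIV - {(x, y)}"
    then show "pmf (B (fst z) (snd z)) (u, v, x, y) * pmf P1 z = 0"
      using B0[of "fst z" "snd z"] by (cases z) simp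
  qed auto
  also have "\<dots> = pmf P1 (x, y) * pmf (\<kappa> x) u * pmf (\<mu> (u, y)) v" by (simp add: B)
  finally show ?thesis .
qed

lemma sum_UNIV_pair:
  "(\<Sum>z\<in>UNIV. f z) = (\<Sum>x\<in>UNIV. \<Sum>y\<in>UNIV. f (x, y))"
  by (simp add: sum.cartesian_product)

definition pair_law :: "('x, 'y) joint \<Rightarrow> (nat \<times> nat) \<times> ('x \<times> 'y) \<Rightarrow> real" where
  "pair_law T = (\<lambda>((u, v), (x, y)). pmf T (u, v, x, y))"

lemma pair_law_simp [simp]: "pair_law T ((u, v), (x, y)) = pmf T (u, v, x, y)"
  by (simp add: pair_law_def)

lemma tendsto_of_inverse_Suc_bound:
  fixes X :: "nat \<Rightarrow> real"
  assumes "\<And>k. \<bar>X k - l\<bar> \<le> inverse (real (Suc k))"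
  shows "X \<longlonglongrightarrow> l"
proof -
  have "(\<lambda>k. X k - l) \<longlonglongrightarrow> 0"
    by (rule Lim_null_comparison[OF _ LIMSEQ_inverse_real_of_nat]) (use assms in auto)
  then show ?thesis by (simp add: LIM_zero_iff)
qed

lemma pmf_map_eq_sum_of_bool:
  assumes "finite (set_pmf Q)"
  shows "pmf (map_pmf f Q) b = (\<Sum>w\<in>set_pmf Q. pmf Q w * of_bool (f w = b))"
proof -
  have "pmf (map_pmf f Q) b = measure_pmf.prob Q (f -` {b})" by (rule pmf_map)
  also have "\<dots> = measure_pmf.prob Q {w\<in>set_pmf Q. f w = b}"
    by (intro measure_prob_cong_0) (auto simp: pmf_eq_0_set_pmf)
  also have "\<dots> = (\<Sum>w\<in>{w\<in>set_pmf Q. f w = b}. pmf Q w)"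
    using assms by (intro measure_measure_pmf_finite) auto
  also have "\<dots> = (\<Sum>w\<in>set_pmf Q. pmf Q w * of_bool (f w = b))"
    using assms by (intro sum.mono_neutral_cong_left) auto
  finally show ?thesis .
qed

lemma card_eq_sum_of_bool:
  fixes n :: nat
  shows "real (card {i. i < n \<and> P i}) = (\<Sum>i<n. of_bool (P i))"
proof -
  have "{i. i < n \<and> P i} = {..<n} \<inter> {i. P i}" by auto
  then show ?thesis by (subst sum_of_bool_eq) simp_all
qed

text \<open>The weak law for indicator functions, followed by a union bound over the finitely many
  values in \<open>B\<close>.\<close>

lemma frequency_tendsto:
  assumes fin: "finite (set_pmf Q)" "finite B" and e: "\<eta> > 0"
  shows "(\<lambda>n. measure_pmf.prob (replicate_pmf n Q)
    {ws. \<exists>b\<in>B. \<not> \<bar>real (card {i. i < n \<and> f (ws ! i) = b}) / real n - pmf (map_pmf f Q) b\<bar> \<le> \<eta>}) \<longlonglongrightarrow> 0"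
proof -
  define D where "D n b = {ws. real n * \<eta> < \<bar>(\<Sum>i<n. of_bool (f (ws ! i) = b)) - real n * (\<Sum>w\<in>set_pmf Q. pmf Q w * of_bool (f w = b))\<bar>}" for n b
  have lim: "(\<lambda>n. \<Sum>b\<in>B. measure_pmf.prob (replicate_pmf n Q) (D n b)) \<longlonglongrightarrow> (\<Sum>b\<in>B. 0)"
    unfolding D_def by (intro tendsto_sum weak_law_replicate_pmf fin e)
  have "measure_pmf.prob (replicate_pmf n Q)
    {ws. \<exists>b\<in>B. \<not> \<bar>real (card {i. i < n \<and> f (ws ! i) = b}) / real n - pmf (map_pmf f Q) b\<bar> \<le> \<eta>}
    \<le> (\<Sum>b\<in>B. measure_pmf.prob (replicate_pmf n Q) (D n b))" if n: "n > 0" for n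
  proof -
    have "{ws. \<exists>b\<in>B. \<not> \<bar>real (card {i. i < n \<and> f (ws ! i) = b}) / real n - pmf (map_pmf f Q) b\<bar> \<le> \<eta>}
      \<subseteq> (\<Union>b\<in>B. D n b)"
    proof clarify
      fix ws b assume b: "b \<in> B" and *: "\<not> \<bar>real (card {i. i < n \<and> f (ws ! i) = b}) / real n - pmf (map_pmf f Q) b\<bar> \<le> \<eta>"
      have "real n * \<bar>real (card {i. i < n \<and> f (ws ! i) = b}) / real n - pmf (map_pmf f Q) b\<bar> =
        \<bar>real n * (real (card {i. i < n \<and> f (ws ! i) = b}) / real n - pmf (map_pmf f Q) b)\<bar>"
        by (simp add: abs_mult)
      also have "\<dots> = \<bar>real (card {i. i < n \<and> f (ws ! i) = b}) - real n * pmf (map_pmf f Q) b\<bar>"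
        using n by (simp add: right_diff_distrib)
      finally have eq: "real n * \<bar>real (card {i. i < n \<and> f (ws ! i) = b}) / real n - pmf (map_pmf f Q) b\<bar> =
        \<bar>real (card {i. i < n \<and> f (ws ! i) = b}) - real n * pmf (map_pmf f Q) b\<bar>" .
      have "real n * \<eta> < \<bar>real (card {i. i < n \<and> f (ws ! i) = b}) - real n * pmf (map_pmf f Q) b\<bar>"
        unfolding eq[symmetric] using * n by (intro mult_strict_left_mono) (simp_all add: not_le)
      then have "ws \<in> D n b"
        unfolding D_def card_eq_sum_of_bool pmf_map_eq_sum_of_bool[OF fin(1)] by simp
      then show "ws \<in> (\<Union>b\<in>B. D n b)" using b by blast
    qed
    then have "measure_pmf.prob (replicate_pmf n Q)
      {ws. \<exists>b\<in>B. \<not> \<bar>real (card {i. i < n \<and> f (ws ! i) = b}) / real n - pmf (map_pmf f Q) b\<bar> \<le> \<eta>}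
      \<le> measure_pmf.prob (replicate_pmf n Q) (\<Union>b\<in>B. D n b)"
      by (intro prob_pmf_mono) auto
    also have "\<dots> \<le> (\<Sum>b\<in>B. measure_pmf.prob (replicate_pmf n Q) (D n b))"
      using fin by (intro prob_pmf_UN_le) auto
    finally show ?thesis .
  qed
  then have "\<forall>\<^sub>F n in sequentially. measure_pmf.prob (replicate_pmf n Q)
    {ws. \<exists>b\<in>B. \<not> \<bar>real (card {i. i < n \<and> f (ws ! i) = b}) / real n - pmf (map_pmf f Q) b\<bar> \<le> \<eta>}
    \<le> (\<Sum>b\<in>B. measure_pmf.prob (replicate_pmf n Q) (D n b))"
    by (rule eventually_mono[OF eventually_gt_at_top[of 0]])
  note le = this
  show ?thesis
  proof (rule tendsto_sandwich[OF _ le tendsto_const])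
    show "(\<lambda>n. \<Sum>b\<in>B. measure_pmf.prob (replicate_pmf n Q) (D n b)) \<longlonglongrightarrow> 0"
      using lim by simp
  qed (intro always_eventually allI measure_nonneg)
qed

text \<open>Messages are indices into the codebooks. The additional message
  \<open>Suc M\<^sub>2\<close> lets B report that its own test failed, because the decision is made
  by A, who never sees \<open>y\<close>. A knows \<open>u\<close> already and needs only the index
  of \<open>v\<close>. The encoder of B must stay in range for every list it is given; an index that
  does not decode to a member of \<open>CU\<close> is answered by the same reserved message.\<close>

lemma interactive_code_exists:
  fixes TX :: "'u \<Rightarrow> 'v \<Rightarrow> 'x list \<Rightarrow> bool" and TY :: "'u \<Rightarrow> 'v \<Rightarrow> 'y list \<Rightarrow> bool"
  assumes CU: "finite CU" "card CU \<le> M\<^sub>1" "\<And>xs. eU xs \<in> CU"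
    and CV: "\<And>u. u \<in> CU \<Longrightarrow> finite (CV u) \<and> card (CV u) \<le> M\<^sub>2 \<and> (\<forall>ys. eV u ys \<in> CV u)"
  shows "\<exists>c :: ('x, 'y) code. is_code 1 n c \<and> fsize c 0 = M\<^sub>1 \<and> gsize c 0 = Suc M\<^sub>2 \<and>
    (\<forall>zs. decides_one 1 c zs \<longleftrightarrow>
      \<not> (TX (eU (map fst zs)) (eV (eU (map fst zs)) (map snd zs)) (map fst zs) \<and>
         TY (eU (map fst zs)) (eV (eU (map fst zs)) (map snd zs)) (map snd zs)))"
proof -
  obtain hU where hU: "bij_betw hU {1..card CU} CU" using ex_bij_betw_nat_finite_1[OF CU(1)] by blast
  have "\<forall>u\<in>CU. \<exists>h. bij_betw h {1..card (CV u)} (CV u)"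
    using CV by (intro ballI ex_bij_betw_nat_finite_1) blast
  from bchoice[OF this] obtain hV where hV': "\<forall>u\<in>CU. bij_betw (hV u) {1..card (CV u)} (CV u)" ..
  note hV = bspec[OF hV']
  define iU where "iU u = inv_into {1..card CU} hU u" for u
  define iV where "iV u v = inv_into {1..card (CV u)} (hV u) v" for u v
  have iU: "iU u \<in> {1..M\<^sub>1}" "hU (iU u) = u" if "u \<in> CU" for u
  proof -
    have "iU u \<in> {1..card CU}"
      unfolding iU_def using bij_betw_imp_surj_on[OF hU] that by (intro inv_into_into) blast
    then show "iU u \<in> {1..M\<^sub>1}" using CU(2) by auto
    show "hU (iU u) = u" using hU that unfolding iU_def by (simp add: bij_betw_inv_into_right)
  qed
  have iV: "iV u v \<in> {1..M\<^sub>2}" "hV u (iV u v) = v" if "u \<in> CU" "v \<in> CV u" for u v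
  proof -
    have "iV u v \<in> {1..card (CV u)}"
      unfolding iV_def using bij_betw_imp_surj_on[OF hV[OF that(1)]] that by (intro inv_into_into) blast
    then show "iV u v \<in> {1..M\<^sub>2}" using CV[OF that(1)] by auto
    show "hV u (iV u v) = v" using hV[OF that(1)] that unfolding iV_def by (simp add: bij_betw_inv_into_right)
  qed
  define c :: "('x, 'y) code" where "c = \<lparr> fsize = (\<lambda>_. M\<^sub>1), gsize = (\<lambda>_. Suc M\<^sub>2),
    fenc = (\<lambda>_ xs _. iU (eU xs)),
    genc = (\<lambda>_ ys ms. let u = hU (hd ms) in if u \<in> CU \<and> TY u (eV u ys) ys then iV u (eV u ys) else Suc M\<^sub>2),
    reject = (\<lambda>xs ms. \<not> (hd ms \<noteq> Suc M\<^sub>2 \<and> TX (eU xs) (hV (eU xs) (hd ms)) xs)) \<rparr>"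
  have "is_code 1 n c"
  proof -
    have "fenc c k xs ms \<in> {1..fsize c k}" for k xs ms
      using iU(1)[OF CU(3)] by (simp add: c_def)
    moreover have "genc c k ys ms \<in> {1..gsize c k}" for k ys ms
    proof (cases "hU (hd ms) \<in> CU \<and> TY (hU (hd ms)) (eV (hU (hd ms)) ys) ys")
      case True
      then have "iV (hU (hd ms)) (eV (hU (hd ms)) ys) \<in> {1..M\<^sub>2}" using CV by (intro iV) auto
      then show ?thesis using True by (simp add: c_def Let_def)
    next
      case False
      then show ?thesis by (auto simp: c_def Let_def)
    qed
    ultimately show ?thesis unfolding is_code_def by (intro conjI allI impI)
  qed
  moreover have "decides_one 1 c zs \<longleftrightarrow>
      \<not> (TX (eU (map fst zs)) (eV (eU (map fst zs)) (map snd zs)) (map fst zs) \<and>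
         TY (eU (map fst zs)) (eV (eU (map fst zs)) (map snd zs)) (map snd zs))" for zs
  proof -
    define xs ys u v where "xs = map fst zs" and "ys = map snd zs" and "u = eU xs" and "v = eV u ys"
    have u: "u \<in> CU" using CU(3) by (simp add: u_def)
    then have v: "v \<in> CV u" using CV by (simp add: v_def)
    have "snd (transcript c xs ys 1) = [if TY u v ys then iV u v else Suc M\<^sub>2]"
      using iU(2)[OF u] u by (simp add: c_def u_def v_def Let_def)
    then have "decides_one 1 c zs \<longleftrightarrow> reject c xs [if TY u v ys then iV u v else Suc M\<^sub>2]"
      by (simp add: decides_one_def xs_def ys_def)
    also have "\<dots> \<longleftrightarrow> \<not> (TX u v xs \<and> TY u v ys)"
      using iV[OF u v] by (auto simp: c_def u_def[symmetric])
    finally show ?thesis by (simp add: xs_def ys_def u_def v_def)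
  qed
  ultimately show ?thesis by (intro exI[of _ c]) (simp add: c_def)
qed

text \<open>The codebook exceeds the change-of-measure factor by
  \<open>2 powr (real n * \<delta>)\<close>, so the covering failure decays doubly
  exponentially.\<close>

lemma exp_codebook_tendsto:
  fixes M :: "nat \<Rightarrow> real"
  assumes d: "\<delta> > 0" and M: "\<And>n. 2 powr (real n * (I + 2 * \<delta>)) \<le> M n"
  shows "(\<lambda>n. exp (- (M n / 2 powr (real n * (I + \<delta>))))) \<longlonglongrightarrow> 0"
proof (rule tendsto_sandwich[OF _ _ tendsto_const])
  show "(\<lambda>n. exp (- (2 powr (real n * \<delta>)))) \<longlonglongrightarrow> 0"
    using d by real_asymp
  show "\<forall>\<^sub>F n in sequentially. exp (- (M n / 2 powr (real n * (I + \<delta>)))) \<le> exp (- (2 powr (real n * \<delta>)))"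
  proof (intro always_eventually allI)
    fix n
    have "2 powr (real n * \<delta>) * 2 powr (real n * (I + \<delta>)) = 2 powr (real n * (I + 2 * \<delta>))"
      by (simp add: powr_add[symmetric] algebra_simps)
    also have "\<dots> \<le> M n" by (rule M)
    finally have "2 powr (real n * \<delta>) \<le> M n / 2 powr (real n * (I + \<delta>))"
      by (simp add: field_simps)
    then show "exp (- (M n / 2 powr (real n * (I + \<delta>)))) \<le> exp (- (2 powr (real n * \<delta>)))" by simp
  qed
qed simp

section \<open>The auxiliary variables\<close>

locale aux_vars =
  fixes P0 :: "('x::finite \<times> 'y::finite) pmf" and Q :: "('x, 'y) joint"
    and \<kappa> :: "'x \<Rightarrow> nat pmf" and \<mu> :: "nat \<times> 'y \<Rightarrow> nat pmf"
  assumes fin: "finite (set_pmf Q)"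
    and marg: "map_pmf (\<lambda>(u, v, x, y). (x, y)) Q = P0"
    and chain1: "markov_chain Q rvU rvX rvY"
    and chain2: "markov_chain Q rvV rvUY rvX"
    and cond1: "is_cond_law Q rvU rvX \<kappa>"
    and cond2: "is_cond_law Q rvV rvUY \<mu>"
begin

definition SU where "SU = rvU ` set_pmf Q"
definition SV where "SV = rvV ` set_pmf Q"

abbreviation "QU \<equiv> map_pmf (\<lambda>(u, v, x, y). u) Q"
abbreviation "QUV \<equiv> map_pmf (\<lambda>(u, v, x, y). (u, v)) Q"
abbreviation "QUX \<equiv> map_pmf (\<lambda>(u, v, x, y). (u, x)) Q"
abbreviation "QUY \<equiv> map_pmf (\<lambda>(u, v, x, y). (u, y)) Q"
abbreviation "QUXY \<equiv> map_pmf (\<lambda>(u, v, x, y). (u, x, y)) Q"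
abbreviation "QUVX \<equiv> map_pmf (\<lambda>(u, v, x, y). (u, v, x)) Q"
abbreviation "QUVY \<equiv> map_pmf (\<lambda>(u, v, x, y). (u, v, y)) Q"

text \<open>The conditional law of \<open>V\<close> given \<open>U\<close>, from which B's codewords
  are drawn; it is zero at a null \<open>u\<close> by division by zero.\<close>

definition q2 where "q2 v u = pmf QUV (u, v) / pmf QU u"

text \<open>The information densities of \<open>(U; X)\<close> and of \<open>(V; Y)\<close> given
  \<open>U\<close>. They are functions on quadruples, but \<open>info1\<close> reads only
  \<open>(u, x)\<close> and \<open>info2\<close> only \<open>(u, v, y)\<close>.\<close>

definition info1 where "info1 = (\<lambda>(u, v, x, y). log 2 (pmf (\<kappa> x) u / pmf QU u))"
definition info2 where "info2 = (\<lambda>(u, v, x, y). log 2 (pmf (\<mu> (u, y)) v / q2 v u))"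

definition I1 where "I1 = (\<Sum>w\<in>set_pmf Q. pmf Q w * info1 w)"
definition I2 where "I2 = (\<Sum>w\<in>set_pmf Q. pmf Q w * info2 w)"

lemma finSU [simp]: "finite SU" and finSV [simp]: "finite SV"
  using fin by (auto simp: SU_def SV_def)

lemma set_Q: "(u, v, x, y) \<in> set_pmf Q \<Longrightarrow> u \<in> SU \<and> v \<in> SV"
  by (force simp: SU_def SV_def)

lemma SV_ne: "SV \<noteq> {}"
  by (simp add: SV_def set_pmf_not_empty)

lemma QUX_eq: "pmf QUX (u, x) = pmf (map_pmf rvX Q) x * pmf (\<kappa> x) u"
  using cond1 by (simp add: is_cond_law_def split_def)

lemma QUVY_eq: "pmf QUVY (u, v, y) = pmf QUY (u, y) * pmf (\<mu> (u, y)) v"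
proof -
  have "pmf QUVY (u, v, y) = pmf (map_pmf (\<lambda>(u, v, y). (v, (u, y))) QUVY) ((\<lambda>(u, v, y). (v, (u, y))) (u, v, y))"
    by (rule pmf_map_inj'[symmetric]) (auto simp: inj_on_def)
  also have "\<dots> = pmf (map_pmf (\<lambda>w. (rvV w, rvUY w)) Q) (v, (u, y))"
    by (simp add: map_pmf_comp split_def)
  finally show ?thesis using cond2 by (simp add: is_cond_law_def)
qed

lemma QUXY_eq: "pmf QUXY (u, x, y) = pmf P0 (x, y) * pmf (\<kappa> x) u"
proof (cases "pmf (map_pmf rvX Q) x = 0")
  case True
  then have "x \<notin> rvX ` set_pmf Q" by (auto simp: pmf_eq_0_set_pmf)
  then have "pmf QUXY (u, x, y) = 0" "pmf P0 (x, y) = 0"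
    unfolding marg[symmetric] pmf_eq_0_set_pmf by force+
  then show ?thesis by simp
next
  case False
  have "pmf QUXY (u, x, y) * pmf (map_pmf rvX Q) x = pmf QUX (u, x) * pmf P0 (x, y)"
    using chain1[unfolded markov_chain_def] unfolding marg[symmetric] by (simp add: split_def)
  then show ?thesis using False unfolding QUX_eq by simp
qed

text \<open>The two Markov chains say that \<open>Q\<close> has the shape of \<open>bar_law\<close>
  with \<open>P0\<close> in place of \<open>P1\<close>. Cancelling the denominators of the chain
  conditions fails only at null events, where both sides vanish.\<close>

lemma pmf_Q: "pmf Q (u, v, x, y) = pmf P0 (x, y) * pmf (\<kappa> x) u * pmf (\<mu> (u, y)) v"
proof -
  have "pmf Q (u, v, x, y) = pmf QUXY (u, x, y) * pmf (\<mu> (u, y)) v"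
  proof (cases "pmf QUY (u, y) = 0")
    case True
    then have "\<not> (\<exists>v x. (u, v, x, y) \<in> set_pmf Q)" by (force simp: pmf_eq_0_set_pmf)
    then have "pmf Q (u, v, x, y) = 0" "pmf QUXY (u, x, y) = 0"
      by (auto simp: pmf_eq_0_set_pmf)
    then show ?thesis by simp
  next
    case False
    have "pmf (map_pmf (\<lambda>w. (rvV w, rvUY w, rvX w)) Q) ((\<lambda>w. (rvV w, rvUY w, rvX w)) (u, v, x, y)) = pmf Q (u, v, x, y)"
      by (rule pmf_map_inj') (auto simp: inj_on_def)
    then have a: "pmf (map_pmf (\<lambda>w. (rvV w, rvUY w, rvX w)) Q) (v, (u, y), x) = pmf Q (u, v, x, y)" by simp
    have "pmf (map_pmf (\<lambda>(u, x, y). ((u, y), x)) QUXY) ((\<lambda>(u, x, y). ((u, y), x)) (u, x, y)) = pmf QUXY (u, x, y)"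
      by (rule pmf_map_inj') (auto simp: inj_on_def)
    then have b: "pmf (map_pmf (\<lambda>w. (rvUY w, rvX w)) Q) ((u, y), x) = pmf QUXY (u, x, y)"
      by (simp add: map_pmf_comp split_def)
    have c: "pmf (map_pmf (\<lambda>w. (rvV w, rvUY w)) Q) (v, (u, y)) = pmf QUY (u, y) * pmf (\<mu> (u, y)) v"
      using cond2 by (simp add: is_cond_law_def)
    have "pmf Q (u, v, x, y) * pmf QUY (u, y) = pmf QUY (u, y) * pmf (\<mu> (u, y)) v * pmf QUXY (u, x, y)"
      using chain2[unfolded markov_chain_def, rule_format, of v "(u, y)" x] unfolding a b c .
    then show ?thesis using False by simp
  qed
  then show ?thesis unfolding QUXY_eq .
qed

lemma sum_QUXY_x: "(\<Sum>x\<in>UNIV. pmf P0 (x, y) * pmf (\<kappa> x) u) = pmf QUY (u, y)"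
proof -
  have "pmf (map_pmf (\<lambda>(u, x, y). (u, y)) QUXY) (u, y) = (\<Sum>x\<in>UNIV. pmf QUXY (u, x, y))"
    by (rule pmf_map_eq_sum) (auto simp: inj_on_def)
  then show ?thesis unfolding QUXY_eq by (simp add: map_pmf_comp split_def)
qed

lemma sum_QUY: "(\<Sum>y\<in>UNIV. pmf QUY (u, y)) = pmf QU u"
proof -
  have "pmf (map_pmf (\<lambda>(u, y). u) QUY) u = (\<Sum>y\<in>UNIV. pmf QUY (u, y))"
    by (rule pmf_map_eq_sum) (auto simp: inj_on_def)
  then show ?thesis by (simp add: map_pmf_comp split_def)
qed

lemma sum_QUV: "(\<Sum>v\<in>SV. pmf QUV (u, v)) = pmf QU u"
proof -
  have "pmf (map_pmf (\<lambda>(u, v). u) QUV) u = (\<Sum>v\<in>SV. pmf QUV (u, v))"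
    by (rule pmf_map_eq_sum) (auto simp: inj_on_def dest: set_Q)
  then show ?thesis by (simp add: map_pmf_comp split_def)
qed

lemma sum_QUVY: "(\<Sum>v\<in>SV. pmf QUVY (u, v, y)) = pmf QUY (u, y)"
proof -
  have "pmf (map_pmf (\<lambda>(u, v, y). (u, y)) QUVY) (u, y) = (\<Sum>v\<in>SV. pmf QUVY (u, v, y))"
    by (rule pmf_map_eq_sum) (auto simp: inj_on_def dest: set_Q)
  then show ?thesis by (simp add: map_pmf_comp split_def)
qed

lemma sum_QUX: "(\<Sum>u\<in>SU. pmf QUX (u, x)) = pmf (map_pmf rvX Q) x"
proof -
  have "pmf (map_pmf (\<lambda>(u, x). x) QUX) x = (\<Sum>u\<in>SU. pmf QUX (u, x))"
    by (rule pmf_map_eq_sum) (auto simp: inj_on_def dest: set_Q)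
  then show ?thesis by (simp add: map_pmf_comp split_def)
qed

lemma sum_P0: "(\<Sum>y\<in>UNIV. pmf P0 (x, y)) = pmf (map_pmf rvX Q) x"
proof -
  have "pmf (map_pmf (\<lambda>(x, y). x) P0) x = (\<Sum>y\<in>UNIV. pmf P0 (x, y))"
    by (rule pmf_map_eq_sum) (auto simp: inj_on_def)
  then show ?thesis unfolding marg[symmetric] by (simp add: map_pmf_comp split_def)
qed

lemma sum_QU: "sum (pmf QU) SU = 1"
  by (intro sum_pmf_eq_1) (auto dest: set_Q)

lemma support_pos:
  assumes "(u, v, x, y) \<in> set_pmf Q"
  shows "0 < pmf P0 (x, y)" "0 < pmf (\<kappa> x) u" "0 < pmf (\<mu> (u, y)) v" "0 < pmf QU u" "0 < pmf QUV (u, v)"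
    "0 < q2 v u"
proof -
  have "0 < pmf Q (u, v, x, y)" using assms by (simp add: pmf_positive)
  then show "0 < pmf P0 (x, y)" "0 < pmf (\<kappa> x) u" "0 < pmf (\<mu> (u, y)) v"
    unfolding pmf_Q by (auto simp: zero_less_mult_iff order_less_le)
  show "0 < pmf QU u" "0 < pmf QUV (u, v)"
    using assms by (auto intro!: pmf_positive image_eqI[where x="(u, v, x, y)"])
  then show "0 < q2 v u" by (simp add: q2_def)
qed

section \<open>Mutual informations as averages of information densities\<close>

lemma mut_info_eq_I1: "mut_info Q rvU rvX = I1"
  unfolding mut_info_eq_sum[OF fin] I1_def
proof (intro sum.cong refl arg_cong2[where f="(*)"])
  fix w assume w: "w \<in> set_pmf Q"
  obtain u v x y where [simp]: "w = (u, v, x, y)" by (cases w)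
  have "pmf (map_pmf rvX Q) x \<noteq> 0" using w by (force simp: pmf_eq_0_set_pmf)
  moreover have "map_pmf (\<lambda>w. (rvU w, rvX w)) Q = QUX" by (simp add: split_def)
  ultimately show "log 2 (pmf (map_pmf (\<lambda>w. (rvU w, rvX w)) Q) (rvU w, rvX w) /
      (pmf (map_pmf rvU Q) (rvU w) * pmf (map_pmf rvX Q) (rvX w))) = info1 w"
    by (simp add: QUX_eq info1_def)
qed

text \<open>The two logarithms of the chain rule share the marginal of \<open>V\<close>, which
  cancels pointwise on the support and leaves the ratio of \<open>\<mu>\<close> to
  \<open>q2\<close>.\<close>

lemma cond_mut_info_eq_I2: "cond_mut_info Q rvV rvY rvU = I2"
  unfolding cond_mut_info_eq_diff mut_info_eq_sum[OF fin] I2_def sum_subtractf[symmetric] right_diff_distrib[symmetric]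
proof (intro sum.cong refl arg_cong2[where f="(*)"])
  fix w assume w: "w \<in> set_pmf Q"
  obtain u v x y where [simp]: "w = (u, v, x, y)" by (cases w)
  have pos: "0 < pmf QUV (u, v)" "0 < pmf QU u" "0 < pmf (\<mu> (u, y)) v" using w support_pos[of u v x y] by auto
  have y: "0 < pmf QUY (u, y)" using w by (auto intro!: pmf_positive image_eqI[where x="(u, v, x, y)"])
  have v: "0 < pmf (map_pmf rvV Q) v" using w by (auto intro!: pmf_positive image_eqI[where x="(u, v, x, y)"])
  have "pmf (map_pmf (\<lambda>(u, v, y). (v, (y, u))) QUVY) ((\<lambda>(u, v, y). (v, (y, u))) (u, v, y)) = pmf QUVY (u, v, y)"
    by (rule pmf_map_inj') (auto simp: inj_on_def)
  then have a: "pmf (map_pmf (\<lambda>w. (rvV w, rvY w, rvU w)) Q) (v, y, u) = pmf QUY (u, y) * pmf (\<mu> (u, y)) v"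
    unfolding QUVY_eq by (simp add: map_pmf_comp split_def)
  have "pmf (map_pmf (\<lambda>(u, y). (y, u)) QUY) ((\<lambda>(u, y). (y, u)) (u, y)) = pmf QUY (u, y)"
    by (rule pmf_map_inj') (auto simp: inj_on_def)
  then have b: "pmf (map_pmf (\<lambda>w. (rvY w, rvU w)) Q) (y, u) = pmf QUY (u, y)"
    by (simp add: map_pmf_comp split_def)
  have "pmf (map_pmf (\<lambda>(u, v). (v, u)) QUV) ((\<lambda>(u, v). (v, u)) (u, v)) = pmf QUV (u, v)"
    by (rule pmf_map_inj') (auto simp: inj_on_def)
  then have c: "pmf (map_pmf (\<lambda>w. (rvV w, rvU w)) Q) (v, u) = pmf QUV (u, v)"
    by (simp add: map_pmf_comp split_def)
  show "log 2 (pmf (map_pmf (\<lambda>w. (rvV w, rvY w, rvU w)) Q) (rvV w, rvY w, rvU w) /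
      (pmf (map_pmf rvV Q) (rvV w) * pmf (map_pmf (\<lambda>w. (rvY w, rvU w)) Q) (rvY w, rvU w))) -
    log 2 (pmf (map_pmf (\<lambda>w. (rvV w, rvU w)) Q) (rvV w, rvU w) /
      (pmf (map_pmf rvV Q) (rvV w) * pmf (map_pmf rvU Q) (rvU w))) = info2 w"
    using pos y v by (simp add: a b c info2_def q2_def log_divide log_mult)
qed

text \<open>Gibbs' inequality, from \<open>ln t \<le> t - 1\<close>. In both uses \<open>g\<close>
  is the ratio of a weight of total mass at most one to the law \<open>Q\<close>.\<close>

lemma sum_log_inverse_nonneg:
  assumes pos: "\<And>w. w \<in> set_pmf Q \<Longrightarrow> 0 < g w" and le: "(\<Sum>w\<in>set_pmf Q. pmf Q w * g w) \<le> 1"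
  shows "0 \<le> (\<Sum>w\<in>set_pmf Q. pmf Q w * log 2 (1 / g w))"
proof -
  have "(\<Sum>w\<in>set_pmf Q. pmf Q w * ln (g w)) \<le> (\<Sum>w\<in>set_pmf Q. pmf Q w * (g w - 1))"
    using pos by (intro sum_mono mult_left_mono ln_le_minus_one) auto
  also have "\<dots> = (\<Sum>w\<in>set_pmf Q. pmf Q w * g w) - 1"
    using fin by (simp add: right_diff_distrib sum_subtractf sum_pmf_eq_1)
  also have "\<dots> \<le> 0" using le by simp
  finally have "0 \<le> - (\<Sum>w\<in>set_pmf Q. pmf Q w * ln (g w)) / ln 2" by (simp add: divide_nonpos_pos)
  also have "\<dots> = (\<Sum>w\<in>set_pmf Q. pmf Q w * log 2 (1 / g w))"
    unfolding sum_negf[symmetric] sum_divide_distrib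
    using pos by (intro sum.cong) (auto simp: log_def ln_div)
  finally show ?thesis .
qed

lemma sum_set_Q_le:
  assumes "\<And>u v x y. 0 \<le> f (u, v, x, y)"
  shows "(\<Sum>w\<in>set_pmf Q. f w) \<le> (\<Sum>u\<in>SU. \<Sum>v\<in>SV. \<Sum>x\<in>UNIV. \<Sum>y\<in>UNIV. f (u, v, x, y) :: real)"
proof -
  have "(\<Sum>w\<in>set_pmf Q. f w) \<le> (\<Sum>w\<in>SU \<times> SV \<times> UNIV \<times> UNIV. f w)"
    using assms by (intro sum_mono2) (auto dest: set_Q)
  also have "\<dots> = (\<Sum>u\<in>SU. \<Sum>v\<in>SV. \<Sum>x\<in>UNIV. \<Sum>y\<in>UNIV. f (u, v, x, y))"
    by (simp add: sum.cartesian_product' del: UNIV_Times_UNIV)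
  finally show ?thesis .
qed

text \<open>Putting \<open>pmf QU u\<close> for \<open>pmf (\<kappa> x) u\<close> in the
  factorisation of \<open>Q\<close> leaves a weight of total mass at most one; only an inequality
  holds since \<open>\<mu>\<close> may charge points outside \<open>SV\<close> at null conditions.
  Nonnegativity makes the change-of-measure factors at least one, as covering requires.\<close>

lemma I1_nonneg: "0 \<le> I1"
proof -
  have "0 \<le> (\<Sum>w\<in>set_pmf Q. pmf Q w * log 2 (1 / (case w of (u, v, x, y) \<Rightarrow> pmf QU u / pmf (\<kappa> x) u)))"
  proof (rule sum_log_inverse_nonneg)
    fix w assume "w \<in> set_pmf Q"
    then show "0 < (case w of (u, v, x, y) \<Rightarrow> pmf QU u / pmf (\<kappa> x) u)"
      using support_pos(2,4) by (cases w) simp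
  next
    have "(\<Sum>w\<in>set_pmf Q. pmf Q w * (case w of (u, v, x, y) \<Rightarrow> pmf QU u / pmf (\<kappa> x) u)) =
      (\<Sum>w\<in>set_pmf Q. (case w of (u, v, x, y) \<Rightarrow> pmf P0 (x, y) * pmf QU u * pmf (\<mu> (u, y)) v))"
    proof (intro sum.cong refl, clarify)
      fix u v x y assume "(u, v, x, y) \<in> set_pmf Q"
      from support_pos[OF this] show "pmf Q (u, v, x, y) * (pmf QU u / pmf (\<kappa> x) u) = pmf P0 (x, y) * pmf QU u * pmf (\<mu> (u, y)) v"
        by (simp add: pmf_Q)
    qed
    also have "\<dots> \<le> (\<Sum>u\<in>SU. \<Sum>v\<in>SV. \<Sum>x\<in>UNIV. \<Sum>y\<in>UNIV. pmf P0 (x, y) * pmf QU u * pmf (\<mu> (u, y)) v)"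
      using sum_set_Q_le[of "\<lambda>(u, v, x, y). pmf P0 (x, y) * pmf QU u * pmf (\<mu> (u, y)) v"] by simp
    also have "\<dots> = (\<Sum>u\<in>SU. \<Sum>x\<in>UNIV. \<Sum>y\<in>UNIV. \<Sum>v\<in>SV. pmf P0 (x, y) * pmf QU u * pmf (\<mu> (u, y)) v)"
      by (intro sum.cong refl) (subst sum.swap, intro sum.cong refl, rule sum.swap)
    also have "\<dots> \<le> (\<Sum>u\<in>SU. \<Sum>x\<in>UNIV. \<Sum>y\<in>UNIV. pmf P0 (x, y) * pmf QU u)"
    proof (intro sum_mono)
      fix u x y
      have "(\<Sum>v\<in>SV. pmf (\<mu> (u, y)) v) \<le> 1"
        by (simp add: measure_measure_pmf_finite[symmetric] prob_space.prob_le_1[OF prob_space_measure_pmf])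
      then have "pmf P0 (x, y) * pmf QU u * (\<Sum>v\<in>SV. pmf (\<mu> (u, y)) v) \<le> pmf P0 (x, y) * pmf QU u * 1"
        by (intro mult_left_mono) auto
      then show "(\<Sum>v\<in>SV. pmf P0 (x, y) * pmf QU u * pmf (\<mu> (u, y)) v) \<le> pmf P0 (x, y) * pmf QU u"
        by (simp add: sum_distrib_left)
    qed
    also have "\<dots> = (\<Sum>u\<in>SU. (\<Sum>z\<in>UNIV. pmf P0 z) * pmf QU u)"
      by (simp add: sum_UNIV_pair sum_distrib_right)
    also have "\<dots> = 1"
      using sum_QU by (simp add: sum_pmf_eq_1)
    finally show "(\<Sum>w\<in>set_pmf Q. pmf Q w * (case w of (u, v, x, y) \<Rightarrow> pmf QU u / pmf (\<kappa> x) u)) \<le> 1" .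
  qed
  then show ?thesis unfolding I1_def info1_def by (simp add: split_def)
qed

lemma q2_nonneg: "0 \<le> q2 v u"
  by (simp add: q2_def)

lemma sum_q2_le: "(\<Sum>v\<in>SV. q2 v u) \<le> 1"
  unfolding q2_def sum_divide_distrib[symmetric] sum_QUV by simp

lemma I2_nonneg: "0 \<le> I2"
proof -
  have "0 \<le> (\<Sum>w\<in>set_pmf Q. pmf Q w * log 2 (1 / (case w of (u, v, x, y) \<Rightarrow> q2 v u / pmf (\<mu> (u, y)) v)))"
  proof (rule sum_log_inverse_nonneg)
    fix w assume "w \<in> set_pmf Q"
    then show "0 < (case w of (u, v, x, y) \<Rightarrow> q2 v u / pmf (\<mu> (u, y)) v)"
      using support_pos(3,6) by (cases w) simp
  next
    have "(\<Sum>w\<in>set_pmf Q. pmf Q w * (case w of (u, v, x, y) \<Rightarrow> q2 v u / pmf (\<mu> (u, y)) v)) =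
      (\<Sum>w\<in>set_pmf Q. (case w of (u, v, x, y) \<Rightarrow> pmf P0 (x, y) * pmf (\<kappa> x) u * q2 v u))"
    proof (intro sum.cong refl, clarify)
      fix u v x y assume "(u, v, x, y) \<in> set_pmf Q"
      from support_pos[OF this] show "pmf Q (u, v, x, y) * (q2 v u / pmf (\<mu> (u, y)) v) = pmf P0 (x, y) * pmf (\<kappa> x) u * q2 v u"
        by (simp add: pmf_Q)
    qed
    also have "\<dots> \<le> (\<Sum>u\<in>SU. \<Sum>v\<in>SV. \<Sum>x\<in>UNIV. \<Sum>y\<in>UNIV. pmf P0 (x, y) * pmf (\<kappa> x) u * q2 v u)"
      using sum_set_Q_le[of "\<lambda>(u, v, x, y). pmf P0 (x, y) * pmf (\<kappa> x) u * q2 v u"] q2_nonneg by simp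
    also have "\<dots> = (\<Sum>u\<in>SU. \<Sum>v\<in>SV. (\<Sum>x\<in>UNIV. \<Sum>y\<in>UNIV. pmf P0 (x, y) * pmf (\<kappa> x) u) * q2 v u)"
      by (simp add: sum_distrib_right)
    also have "\<dots> = (\<Sum>u\<in>SU. (\<Sum>x\<in>UNIV. \<Sum>y\<in>UNIV. pmf P0 (x, y) * pmf (\<kappa> x) u) * (\<Sum>v\<in>SV. q2 v u))"
      by (simp add: sum_distrib_left)
    also have "\<dots> \<le> (\<Sum>u\<in>SU. (\<Sum>x\<in>UNIV. \<Sum>y\<in>UNIV. pmf P0 (x, y) * pmf (\<kappa> x) u) * 1)"
      using sum_q2_le by (intro sum_mono mult_left_mono sum_nonneg) auto
    also have "\<dots> = (\<Sum>u\<in>SU. (\<Sum>y\<in>UNIV. \<Sum>x\<in>UNIV. pmf P0 (x, y) * pmf (\<kappa> x) u))"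
      unfolding mult_1_right by (intro sum.cong refl sum.swap)
    also have "\<dots> = 1" unfolding sum_QUXY_x sum_QUY by (rule sum_QU)
    finally show "(\<Sum>w\<in>set_pmf Q. pmf Q w * (case w of (u, v, x, y) \<Rightarrow> q2 v u / pmf (\<mu> (u, y)) v)) \<le> 1" .
  qed
  then show ?thesis unfolding I2_def info2_def by (simp add: split_def)
qed

section \<open>Admissible laws and compactness\<close>

lemma tilde_set_marginals:
  assumes "T \<in> tilde_set Q"
  shows "map_pmf (\<lambda>(u, v, x, y). (u, v, x)) T = QUVX" "map_pmf (\<lambda>(u, v, x, y). (u, v, y)) T = QUVY"
    "map_pmf (\<lambda>(u, v, x, y). (u, v)) T = QUV"
proof -
  show x: "map_pmf (\<lambda>(u, v, x, y). (u, v, x)) T = QUVX" and "map_pmf (\<lambda>(u, v, x, y). (u, v, y)) T = QUVY"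
    using assms by (simp_all add: tilde_set_def)
  have "map_pmf (\<lambda>(u, v, x). (u, v)) (map_pmf (\<lambda>(u, v, x, y). (u, v, x)) T) = map_pmf (\<lambda>(u, v, x). (u, v)) QUVX"
    unfolding x ..
  then show "map_pmf (\<lambda>(u, v, x, y). (u, v)) T = QUV"
    by (simp add: map_pmf_comp split_def)
qed

lemma Q_in_tilde_set: "Q \<in> tilde_set Q"
  by (simp add: tilde_set_def)

text \<open>An admissible law may charge quadruples outside the support of \<open>Q\<close>, but
  their parts \<open>(u, v, x)\<close> and \<open>(u, v, y)\<close> each extend to points of that
  support. Hence every factor of \<open>bar_law\<close> other than \<open>P1\<close> stays
  positive.\<close>

lemma tilde_set_support:
  assumes T: "T \<in> tilde_set Q" and w: "(u, v, x, y) \<in> set_pmf T"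
  shows "u \<in> SU" "v \<in> SV" "0 < pmf (\<kappa> x) u" "0 < pmf (\<mu> (u, y)) v" "0 < pmf QU u" "0 < q2 v u"
proof -
  have "(u, v, x) \<in> set_pmf QUVX"
    unfolding tilde_set_marginals(1)[OF T, symmetric] using w by (auto intro!: image_eqI[where x="(u, v, x, y)"])
  then obtain y' where y': "(u, v, x, y') \<in> set_pmf Q" by auto
  have "(u, v, y) \<in> set_pmf QUVY"
    unfolding tilde_set_marginals(2)[OF T, symmetric] using w by (auto intro!: image_eqI[where x="(u, v, x, y)"])
  then obtain x' where x': "(u, v, x', y) \<in> set_pmf Q" by auto
  show "u \<in> SU" "v \<in> SV" using set_Q[OF y'] by auto
  show "0 < pmf (\<kappa> x) u" "0 < pmf (\<mu> (u, y)) v" "0 < pmf QU u" "0 < q2 v u"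
    using support_pos[OF y'] support_pos[OF x'] by auto
qed

lemma tilde_set_subset:
  assumes T: "T \<in> tilde_set Q"
  shows "set_pmf T \<subseteq> SU \<times> SV \<times> UNIV \<times> UNIV"
  using tilde_set_support(1,2)[OF T] by auto

lemma tilde_set_finite: "T \<in> tilde_set Q \<Longrightarrow> finite (set_pmf T)"
  by (rule finite_subset[OF tilde_set_subset]) auto

text \<open>\<open>info1\<close> factors through \<open>(u, v, x)\<close> and \<open>info2\<close>
  through \<open>(u, v, y)\<close>, and these two marginals are what defines
  \<open>tilde_set Q\<close>.\<close>

lemma sum_tilde_set:
  assumes T: "T \<in> tilde_set Q"
  shows "(\<Sum>w\<in>set_pmf T. pmf T w * info1 w) = I1" "(\<Sum>w\<in>set_pmf T. pmf T w * info2 w) = I2"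
proof -
  have 1: "info1 = (\<lambda>w. (\<lambda>(u, v, x). log 2 (pmf (\<kappa> x) u / pmf QU u)) ((\<lambda>(u, v, x, y). (u, v, x)) w))"
    by (auto simp: info1_def)
  have 2: "info2 = (\<lambda>w. (\<lambda>(u, v, y). log 2 (pmf (\<mu> (u, y)) v / q2 v u)) ((\<lambda>(u, v, x, y). (u, v, y)) w))"
    by (auto simp: info2_def)
  show "(\<Sum>w\<in>set_pmf T. pmf T w * info1 w) = I1"
    unfolding I1_def 1 sum_pmf_comp_map[OF fin, symmetric] sum_pmf_comp_map[OF tilde_set_finite[OF T], symmetric]
    unfolding tilde_set_marginals[OF T] ..
  show "(\<Sum>w\<in>set_pmf T. pmf T w * info2 w) = I2"
    unfolding I2_def 2 sum_pmf_comp_map[OF fin, symmetric] sum_pmf_comp_map[OF tilde_set_finite[OF T], symmetric]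
    unfolding tilde_set_marginals[OF T] ..
qed

lemma tilde_set_QUV:
  assumes T: "T \<in> tilde_set Q"
  shows "(\<Sum>z\<in>UNIV. pair_law T ((u, v), z)) = pmf QUV (u, v)"
proof -
  have "pmf (map_pmf (\<lambda>(u, v, x, y). (u, v)) T) (u, v) = (\<Sum>z\<in>UNIV. pmf T ((\<lambda>(x, y). (u, v, x, y)) z))"
    by (rule pmf_map_eq_sum) (auto simp: inj_on_def)
  then show ?thesis unfolding tilde_set_marginals[OF T] pair_law_def by (simp add: split_def)
qed

text \<open>On the support of \<open>T\<close>, the logarithm of \<open>bar_law\<close> is that of
  \<open>P1\<close> plus that of \<open>QUV\<close> plus \<open>info1\<close> plus
  \<open>info2\<close>. The first two terms give \<open>rate_fun\<close>, because \<open>T\<close>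
  has the same marginal \<open>QUV\<close>, and the information densities average to the constant
  \<open>I1 + I2\<close>. Only a zero of \<open>P1\<close> can make the divergence infinite.\<close>

lemma kl_div_tilde_set:
  fixes P1 :: "('x \<times> 'y) pmf"
  assumes T: "T \<in> tilde_set Q"
  shows "kl_div T (bar_law P1 \<kappa> \<mu>) =
    (if \<forall>(u, v, x, y)\<in>set_pmf T. pmf P1 (x, y) \<noteq> 0
     then ereal (rate_fun (SU \<times> SV) (pmf P1) (pair_law T) - (I1 + I2)) else \<infinity>)"
proof -
  have ac: "set_pmf T \<subseteq> set_pmf (bar_law P1 \<kappa> \<mu>) \<longleftrightarrow> (\<forall>(u, v, x, y)\<in>set_pmf T. pmf P1 (x, y) \<noteq> 0)"
  proof -
    have "(u, v, x, y) \<in> set_pmf (bar_law P1 \<kappa> \<mu>) \<longleftrightarrow> pmf P1 (x, y) \<noteq> 0" if "(u, v, x, y) \<in> set_pmf T" for u v x y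
      using tilde_set_support[OF T that] by (simp add: set_pmf_iff pmf_bar_law)
    then show ?thesis by fastforce
  qed
  show ?thesis
  proof (cases "\<forall>(u, v, x, y)\<in>set_pmf T. pmf P1 (x, y) \<noteq> 0")
    case False
    show ?thesis unfolding kl_div_eq_sum[OF tilde_set_finite[OF T]] ac if_not_P[OF False] ..
  next
    case True
    let ?S = "SU \<times> SV \<times> (UNIV :: 'x set) \<times> (UNIV :: 'y set)"
    define h where "h = (\<lambda>(u, v, x, y). xlog (pmf T (u, v, x, y)) - pmf T (u, v, x, y) * log 2 (pmf P1 (x, y))
      - pmf T (u, v, x, y) * log 2 (pmf QUV (u, v)))"
    have "(\<Sum>w\<in>set_pmf T. pmf T w * log 2 (pmf T w / pmf (bar_law P1 \<kappa> \<mu>) w)) =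
      (\<Sum>w\<in>set_pmf T. h w - (pmf T w * info1 w + pmf T w * info2 w))"
    proof (intro sum.cong refl)
      fix w assume w: "w \<in> set_pmf T"
      obtain u v x y where [simp]: "w = (u, v, x, y)" by (cases w)
      have t: "0 < pmf T (u, v, x, y)" using w by (simp add: pmf_positive)
      have "pmf P1 (x, y) \<noteq> 0" using True w by auto
      then have p: "0 < pmf P1 (x, y)" by (simp add: order_less_le)
      have s: "0 < pmf (\<kappa> x) u" "0 < pmf (\<mu> (u, y)) v" "0 < pmf QU u" "0 < q2 v u"
        using tilde_set_support[OF T] w by auto
      have q: "pmf QUV (u, v) = pmf QU u * q2 v u" using s by (simp add: q2_def)
      show "pmf T w * log 2 (pmf T w / pmf (bar_law P1 \<kappa> \<mu>) w) = h w - (pmf T w * info1 w + pmf T w * info2 w)"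
        using t p s by (simp add: h_def info1_def info2_def pmf_bar_law xlog_def log_divide log_mult q)
          (simp add: algebra_simps)
    qed
    also have "\<dots> = (\<Sum>w\<in>set_pmf T. h w) - (I1 + I2)"
      by (simp add: sum_subtractf sum.distrib sum_tilde_set[OF T])
    also have "(\<Sum>w\<in>set_pmf T. h w) = (\<Sum>w\<in>?S. h w)"
    proof (intro sum.mono_neutral_left ballI)
      show "set_pmf T \<subseteq> ?S" by (rule tilde_set_subset[OF T])
      fix w assume "w \<in> ?S - set_pmf T"
      then show "h w = 0" by (cases w) (simp add: h_def xlog_def set_pmf_iff)
    qed auto
    also have "\<dots> = (\<Sum>u\<in>SU. \<Sum>v\<in>SV. (\<Sum>z\<in>UNIV. xlog (pair_law T ((u, v), z)) - pair_law T ((u, v), z) * log 2 (pmf P1 z))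
        - (\<Sum>z\<in>UNIV. pair_law T ((u, v), z)) * log 2 (pmf QUV (u, v)))"
      by (simp add: sum.cartesian_product' sum_UNIV_pair h_def sum_subtractf sum_distrib_right del: UNIV_Times_UNIV)
    also have "\<dots> = rate_fun (SU \<times> SV) (pmf P1) (pair_law T)"
      unfolding rate_fun_def tilde_set_QUV[OF T]
      by (simp add: sum.cartesian_product' tilde_set_QUV[OF T] xlog_def)
    finally show ?thesis
      unfolding kl_div_eq_sum[OF tilde_set_finite[OF T]] ac if_P[OF True] by simp
  qed
qed

text \<open>The marginals are required only in the limit, so the lemma serves both for sequences
  inside \<open>tilde_set Q\<close>, in the attainment of the minimum, and for types accepted with
  shrinking tolerance. Vanishing where \<open>P1\<close> does survives the limit, which therefore
  has finite divergence.\<close>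

lemma tilde_set_compact:
  fixes P1 :: "('x \<times> 'y) pmf" and T :: "nat \<Rightarrow> (nat \<times> nat) \<times> ('x \<times> 'y) \<Rightarrow> real"
  assumes T0: "\<And>k s. 0 \<le> T k s"
    and mx: "\<And>u v x. u \<in> SU \<Longrightarrow> v \<in> SV \<Longrightarrow> (\<lambda>k. \<Sum>y\<in>UNIV. T k ((u, v), (x, y))) \<longlonglongrightarrow> pmf QUVX (u, v, x)"
    and my: "\<And>u v y. u \<in> SU \<Longrightarrow> v \<in> SV \<Longrightarrow> (\<lambda>k. \<Sum>x\<in>UNIV. T k ((u, v), (x, y))) \<longlonglongrightarrow> pmf QUVY (u, v, y)"
    and T1: "\<And>k. (\<Sum>s\<in>(SU \<times> SV) \<times> UNIV. T k s) = 1"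
    and ac: "\<And>k u v z. u \<in> SU \<Longrightarrow> v \<in> SV \<Longrightarrow> pmf P1 z = 0 \<Longrightarrow> T k ((u, v), z) = 0"
  shows "\<exists>r T'. strict_mono r \<and> T' \<in> tilde_set Q \<and> (\<forall>(u, v, x, y)\<in>set_pmf T'. pmf P1 (x, y) \<noteq> 0) \<and>
    (\<lambda>k. rate_fun (SU \<times> SV) (pmf P1) (T (r k))) \<longlonglongrightarrow> rate_fun (SU \<times> SV) (pmf P1) (pair_law T')"
proof -
  let ?S = "(SU \<times> SV) \<times> (UNIV :: ('x \<times> 'y) set)"
  have "\<bar>T k s\<bar> \<le> 1" if "s \<in> ?S" for k s
  proof -
    have "T k s \<le> (\<Sum>s\<in>?S. T k s)" using that T0 by (intro member_le_sum) auto
    then show ?thesis using T1[of k] T0[of k s] by simp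
  qed
  then have "\<exists>r L. strict_mono r \<and> (\<forall>s\<in>?S. (\<lambda>k. T (r k) s) \<longlonglongrightarrow> L s)"
    by (intro finite_pointwise_convergent_subsequence[where B=1]) auto
  then obtain r L where r: "strict_mono r" and L': "\<forall>s\<in>?S. (\<lambda>k. T (r k) s) \<longlonglongrightarrow> L s"
    by (elim exE conjE)
  note L = bspec[OF L']
  \<comment> \<open>\<open>L\<close> is a limit only on the finite index set; extending it by zero
    gives the mass function of a law on all quadruples.\<close>
  define f where "f = (\<lambda>(u, v, x, y). if u \<in> SU \<and> v \<in> SV then L ((u, v), (x, y)) else 0)"
  have f0: "0 \<le> f w" for w
  proof -
    obtain u v x y where [simp]: "w = (u, v, x, y)" by (cases w)
    show ?thesis
    proof (cases "u \<in> SU \<and> v \<in> SV")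
      case True
      then have "0 \<le> L ((u, v), (x, y))"
        using L[of "((u, v), (x, y))"] T0 by (intro LIMSEQ_le_const) auto
      then show ?thesis by (simp add: f_def)
    qed (auto simp: f_def)
  qed
  have "(\<lambda>k. \<Sum>s\<in>?S. T (r k) s) \<longlonglongrightarrow> (\<Sum>s\<in>?S. L s)" using L by (intro tendsto_sum) auto
  then have L1: "(\<Sum>s\<in>?S. L s) = 1" unfolding T1 by (simp add: LIMSEQ_const_iff)
  let ?S' = "SU \<times> SV \<times> (UNIV :: 'x set) \<times> (UNIV :: 'y set)"
  have f1: "(\<Sum>w\<in>?S'. f w) = 1"
  proof -
    have "(\<Sum>w\<in>?S'. f w) = (\<Sum>u\<in>SU. \<Sum>v\<in>SV. \<Sum>x\<in>UNIV. \<Sum>y\<in>UNIV. L ((u, v), (x, y)))"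
      by (simp add: sum.cartesian_product' f_def del: UNIV_Times_UNIV)
    also have "\<dots> = (\<Sum>s\<in>?S. L s)"
      by (simp add: sum.cartesian_product' sum_UNIV_pair)
    finally show ?thesis using L1 by simp
  qed
  have supp: "f w \<noteq> 0 \<Longrightarrow> w \<in> ?S'" for w
    by (cases w) (auto simp: f_def split: if_splits)
  have "(\<integral>\<^sup>+w. ennreal (f w) \<partial>count_space UNIV) = (\<Sum>w\<in>?S'. ennreal (f w))"
  proof (rule nn_integral_count_space')
    show "ennreal (f w) = 0" if "w \<notin> ?S'" for w
    proof -
      have "f w = 0" using supp[of w] that by blast
      then show ?thesis by simp
    qed
  qed simp_all
  also have "\<dots> = 1" using f0 f1 by (simp add: sum_ennreal)
  finally have nn: "(\<integral>\<^sup>+w. ennreal (f w) \<partial>count_space UNIV) = 1" .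
  define T' where "T' = embed_pmf f"
  have pT': "pmf T' w = f w" for w unfolding T'_def using f0 nn by (rule pmf_embed_pmf)
  have sT': "set_pmf T' \<subseteq> ?S'" using supp by (auto simp: set_pmf_iff pT')
  have "map_pmf (\<lambda>(u, v, x, y). (u, v, x)) T' = QUVX"
  proof (rule pmf_eqI, clarify)
    fix u v x
    show "pmf (map_pmf (\<lambda>(u, v, x, y). (u, v, x)) T') (u, v, x) = pmf QUVX (u, v, x)"
    proof (cases "u \<in> SU \<and> v \<in> SV")
      case True
      have "pmf (map_pmf (\<lambda>(u, v, x, y). (u, v, x)) T') (u, v, x) = (\<Sum>y\<in>UNIV. pmf T' (u, v, x, y))"
        by (rule pmf_map_eq_sum) (auto simp: inj_on_def)
      also have "\<dots> = (\<Sum>y\<in>UNIV. L ((u, v), (x, y)))" using True by (simp add: pT' f_def)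
      finally have e: "pmf (map_pmf (\<lambda>(u, v, x, y). (u, v, x)) T') (u, v, x) = (\<Sum>y\<in>UNIV. L ((u, v), (x, y)))" .
      have "(\<lambda>k. \<Sum>y\<in>UNIV. T (r k) ((u, v), (x, y))) \<longlonglongrightarrow> (\<Sum>y\<in>UNIV. L ((u, v), (x, y)))"
        using True by (intro tendsto_sum L) auto
      moreover have "(\<lambda>k. \<Sum>y\<in>UNIV. T (r k) ((u, v), (x, y))) \<longlonglongrightarrow> pmf QUVX (u, v, x)"
        using LIMSEQ_subseq_LIMSEQ[OF mx r] True by (simp add: o_def)
      ultimately show ?thesis unfolding e by (rule LIMSEQ_unique)
    next
      case False
      then have "(u, v, x) \<notin> set_pmf (map_pmf (\<lambda>(u, v, x, y). (u, v, x)) T')" "(u, v, x) \<notin> set_pmf QUVX"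
        using sT' set_Q by auto
      then show ?thesis by (simp only: set_pmf_iff not_not)
    qed
  qed
  moreover have "map_pmf (\<lambda>(u, v, x, y). (u, v, y)) T' = QUVY"
  proof (rule pmf_eqI, clarify)
    fix u v y
    show "pmf (map_pmf (\<lambda>(u, v, x, y). (u, v, y)) T') (u, v, y) = pmf QUVY (u, v, y)"
    proof (cases "u \<in> SU \<and> v \<in> SV")
      case True
      have "pmf (map_pmf (\<lambda>(u, v, x, y). (u, v, y)) T') (u, v, y) = (\<Sum>x\<in>UNIV. pmf T' (u, v, x, y))"
        by (rule pmf_map_eq_sum) (auto simp: inj_on_def)
      also have "\<dots> = (\<Sum>x\<in>UNIV. L ((u, v), (x, y)))" using True by (simp add: pT' f_def)
      finally have e: "pmf (map_pmf (\<lambda>(u, v, x, y). (u, v, y)) T') (u, v, y) = (\<Sum>x\<in>UNIV. L ((u, v), (x, y)))" .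
      have "(\<lambda>k. \<Sum>x\<in>UNIV. T (r k) ((u, v), (x, y))) \<longlonglongrightarrow> (\<Sum>x\<in>UNIV. L ((u, v), (x, y)))"
        using True by (intro tendsto_sum L) auto
      moreover have "(\<lambda>k. \<Sum>x\<in>UNIV. T (r k) ((u, v), (x, y))) \<longlonglongrightarrow> pmf QUVY (u, v, y)"
        using LIMSEQ_subseq_LIMSEQ[OF my r] True by (simp add: o_def)
      ultimately show ?thesis unfolding e by (rule LIMSEQ_unique)
    next
      case False
      then have "(u, v, y) \<notin> set_pmf (map_pmf (\<lambda>(u, v, x, y). (u, v, y)) T')" "(u, v, y) \<notin> set_pmf QUVY"
        using sT' set_Q by auto
      then show ?thesis by (simp only: set_pmf_iff not_not)
    qed
  qed
  ultimately have "T' \<in> tilde_set Q" by (simp add: tilde_set_def)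
  moreover have "\<forall>(u, v, x, y)\<in>set_pmf T'. pmf P1 (x, y) \<noteq> 0"
  proof clarify
    fix u v x y assume w: "(u, v, x, y) \<in> set_pmf T'" and p: "pmf P1 (x, y) = 0"
    have uv: "u \<in> SU" "v \<in> SV" using w sT' by auto
    then have "(\<lambda>k. T (r k) ((u, v), (x, y))) \<longlonglongrightarrow> L ((u, v), (x, y))" by (intro L) auto
    then have "L ((u, v), (x, y)) = 0" using ac[OF uv p] by (simp add: LIMSEQ_const_iff)
    then show False using w uv by (simp add: set_pmf_iff pT' f_def)
  qed
  moreover have "(\<lambda>k. rate_fun (SU \<times> SV) (pmf P1) (T (r k))) \<longlonglongrightarrow> rate_fun (SU \<times> SV) (pmf P1) (pair_law T')"
  proof (rule tendsto_rate_fun)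
    fix w and z :: "'x \<times> 'y" assume "w \<in> SU \<times> SV"
    moreover obtain u v x y where "w = (u, v)" "z = (x, y)" by (cases w, cases z)
    ultimately show "(\<lambda>k. T (r k) (w, z)) \<longlonglongrightarrow> pair_law T' (w, z)"
      using L[of "(w, z)"] by (auto simp: pT' f_def)
  qed (use T0 in auto)
  ultimately show ?thesis using r by blast
qed

lemma pair_law_sums:
  assumes T: "T \<in> tilde_set Q"
  shows "u \<in> SU \<Longrightarrow> v \<in> SV \<Longrightarrow> (\<Sum>y\<in>UNIV. pair_law T ((u, v), (x, y))) = pmf QUVX (u, v, x)"
    and "u \<in> SU \<Longrightarrow> v \<in> SV \<Longrightarrow> (\<Sum>x\<in>UNIV. pair_law T ((u, v), (x, y))) = pmf QUVY (u, v, y)"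
    and "(\<Sum>s\<in>(SU \<times> SV) \<times> UNIV. pair_law T s) = 1"
proof -
  have "pmf (map_pmf (\<lambda>(u, v, x, y). (u, v, x)) T) (u, v, x) = (\<Sum>y\<in>UNIV. pmf T (u, v, x, y))"
    by (rule pmf_map_eq_sum) (auto simp: inj_on_def)
  then show "(\<Sum>y\<in>UNIV. pair_law T ((u, v), (x, y))) = pmf QUVX (u, v, x)"
    unfolding tilde_set_marginals[OF T] by simp
  have "pmf (map_pmf (\<lambda>(u, v, x, y). (u, v, y)) T) (u, v, y) = (\<Sum>x\<in>UNIV. pmf T (u, v, x, y))"
    by (rule pmf_map_eq_sum) (auto simp: inj_on_def)
  then show "(\<Sum>x\<in>UNIV. pair_law T ((u, v), (x, y))) = pmf QUVY (u, v, y)"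
    unfolding tilde_set_marginals[OF T] by simp
  have "(\<Sum>w\<in>SU \<times> SV \<times> UNIV \<times> UNIV. pmf T w) = 1"
    by (rule sum_pmf_eq_1) (use tilde_set_subset[OF T] in auto)
  then show "(\<Sum>s\<in>(SU \<times> SV) \<times> UNIV. pair_law T s) = 1"
    by (simp add: sum.cartesian_product' sum_UNIV_pair del: UNIV_Times_UNIV)
qed

lemma kl_div_attains_min:
  fixes P1 :: "('x \<times> 'y) pmf"
  shows "\<exists>T\<in>tilde_set Q. \<forall>T'\<in>tilde_set Q. kl_div T (bar_law P1 \<kappa> \<mu>) \<le> kl_div T' (bar_law P1 \<kappa> \<mu>)"
proof -
  define D where "D T = kl_div T (bar_law P1 \<kappa> \<mu>)" for T
  let ?R = "rate_fun (SU \<times> SV) (pmf P1)"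
  define i where "i = Inf (D ` tilde_set Q)"
  have le: "i \<le> D T'" if "T' \<in> tilde_set Q" for T'
    unfolding i_def using that by (intro Inf_lower) auto
  have "\<exists>T\<in>tilde_set Q. D T \<le> i"
  proof (cases "i = \<infinity>")
    case True
    then show ?thesis using Q_in_tilde_set by (intro bexI[of _ Q]) auto
  next
    case False
    have "D ` tilde_set Q \<noteq> {}" using Q_in_tilde_set by auto
    from Inf_as_limit[OF this] obtain d where d: "\<forall>n. d n \<in> D ` tilde_set Q" "d \<longlonglongrightarrow> i"
      unfolding i_def by auto
    \<comment> \<open>The divergence jumps to infinity at zeros of \<open>P1\<close> while
      \<open>rate_fun\<close> is continuous, so the minimising sequence is cut down to a tail of
      finite values before passing to a limit.\<close>
    have "i < \<infinity>" using False by simp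
    from order_tendstoD(2)[OF d(2) this] obtain N where N: "\<And>n. n \<ge> N \<Longrightarrow> d n < \<infinity>"
      by (auto simp: eventually_sequentially)
    have "\<forall>n. \<exists>T. T \<in> tilde_set Q \<and> D T = d (n + N)" using d(1) by (metis imageE)
    then obtain T where T: "\<And>n. T n \<in> tilde_set Q" "\<And>n. D (T n) = d (n + N)" by metis
    have "\<forall>(u, v, x, y)\<in>set_pmf (T n). pmf P1 (x, y) \<noteq> 0" for n
    proof (rule ccontr)
      assume "\<not> ?thesis"
      from if_not_P[OF this] have "D (T n) = \<infinity>" unfolding D_def kl_div_tilde_set[OF T(1)] .
      then show False using N[of "n + N"] T(2)[of n] by simp
    qed
    note ac = this
    have DT: "D (T n) = ereal (?R (pair_law (T n)) - (I1 + I2))" for n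
      unfolding D_def kl_div_tilde_set[OF T(1)] by (rule if_P[OF ac])
    have "\<exists>r T'. strict_mono r \<and> T' \<in> tilde_set Q \<and> (\<forall>(u, v, x, y)\<in>set_pmf T'. pmf P1 (x, y) \<noteq> 0) \<and>
      (\<lambda>k. ?R (pair_law (T (r k)))) \<longlonglongrightarrow> ?R (pair_law T')"
    proof (rule tilde_set_compact)
      fix k u v x y and z :: "'x \<times> 'y"
      assume uv: "u \<in> SU" "v \<in> SV"
      show "(\<lambda>k. \<Sum>y\<in>UNIV. pair_law (T k) ((u, v), (x, y))) \<longlonglongrightarrow> pmf QUVX (u, v, x)"
        unfolding pair_law_sums(1)[OF T(1) uv] by simp
      show "(\<lambda>k. \<Sum>x\<in>UNIV. pair_law (T k) ((u, v), (x, y))) \<longlonglongrightarrow> pmf QUVY (u, v, y)"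
        unfolding pair_law_sums(2)[OF T(1) uv] by simp
      assume "pmf P1 z = 0"
      then have "(u, v, fst z, snd z) \<notin> set_pmf (T k)" using ac[of k] by auto
      then show "pair_law (T k) ((u, v), z) = 0" by (simp add: pair_law_def set_pmf_iff split_def)
    next
      show "0 \<le> pair_law (T k) s" for k s by (simp add: pair_law_def split_def)
      show "(\<Sum>s\<in>(SU \<times> SV) \<times> UNIV. pair_law (T k) s) = 1" for k by (rule pair_law_sums(3)[OF T(1)])
    qed
    then obtain r T' where r: "strict_mono r" "T' \<in> tilde_set Q" "\<forall>(u, v, x, y)\<in>set_pmf T'. pmf P1 (x, y) \<noteq> 0"
      "(\<lambda>k. ?R (pair_law (T (r k)))) \<longlonglongrightarrow> ?R (pair_law T')" by blast
    have "(\<lambda>k. ereal (?R (pair_law (T (r k))) - (I1 + I2))) \<longlonglongrightarrow> ereal (?R (pair_law T') - (I1 + I2))"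
      by (intro tendsto_intros r)
    moreover have "(\<lambda>k. ereal (?R (pair_law (T (r k))) - (I1 + I2))) \<longlonglongrightarrow> i"
      unfolding DT[symmetric] T(2)
      using LIMSEQ_subseq_LIMSEQ[OF LIMSEQ_ignore_initial_segment[OF d(2), of N] r(1)] by (simp add: o_def)
    ultimately have "ereal (?R (pair_law T') - (I1 + I2)) = i" by (rule LIMSEQ_unique)
    then have "D T' = i" unfolding D_def kl_div_tilde_set[OF r(2)] if_P[OF r(3)] .
    then show ?thesis using r(2) by auto
  qed
  then obtain T where T: "T \<in> tilde_set Q" "D T \<le> i" by (rule bexE)
  have "D T \<le> D T'" if "T' \<in> tilde_set Q" for T'
    using T(2) le[OF that] by (rule order_trans)
  then show ?thesis using T(1) unfolding D_def by (intro bexI[of _ T] ballI)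
qed

text \<open>What acceptance by both tests and positive probability under \<open>P1\<close> reveal
  about the joint type of \<open>(u, v, x, y)\<close>. It is a predicate on functions because types
  arise as normalised counts.\<close>

definition approx_law :: "('x \<times> 'y) pmf \<Rightarrow> real \<Rightarrow> ((nat \<times> nat) \<times> 'x \<times> 'y \<Rightarrow> real) \<Rightarrow> bool" where
  "approx_law P1 \<eta> T \<longleftrightarrow> (\<forall>s. 0 \<le> T s) \<and> (\<Sum>s\<in>(SU \<times> SV) \<times> UNIV. T s) = 1 \<and>
    (\<forall>u\<in>SU. \<forall>v\<in>SV. \<forall>x. \<bar>(\<Sum>y\<in>UNIV. T ((u, v), (x, y))) - pmf QUVX (u, v, x)\<bar> \<le> \<eta>) \<and>
    (\<forall>u\<in>SU. \<forall>v\<in>SV. \<forall>y. \<bar>(\<Sum>x\<in>UNIV. T ((u, v), (x, y))) - pmf QUVY (u, v, y)\<bar> \<le> \<eta>) \<and>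
    (\<forall>w\<in>SU \<times> SV. \<forall>z. pmf P1 z = 0 \<longrightarrow> T (w, z) = 0)"

lemma approx_law_compact:
  assumes T: "\<And>k. approx_law P1 (inverse (real (Suc k))) (T k)"
  shows "\<exists>r T'. strict_mono r \<and> T' \<in> tilde_set Q \<and> (\<forall>(u, v, x, y)\<in>set_pmf T'. pmf P1 (x, y) \<noteq> 0) \<and>
      (\<lambda>k. rate_fun (SU \<times> SV) (pmf P1) (T (r k))) \<longlonglongrightarrow> rate_fun (SU \<times> SV) (pmf P1) (pair_law T')"
proof (rule tilde_set_compact)
  fix k u v x y and z :: "'x \<times> 'y"
  assume uv: "u \<in> SU" "v \<in> SV"
  show "(\<lambda>k. \<Sum>y\<in>UNIV. T k ((u, v), (x, y))) \<longlonglongrightarrow> pmf QUVX (u, v, x)"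
    by (rule tendsto_of_inverse_Suc_bound) (use T uv in \<open>simp add: approx_law_def\<close>)
  show "(\<lambda>k. \<Sum>x\<in>UNIV. T k ((u, v), (x, y))) \<longlonglongrightarrow> pmf QUVY (u, v, y)"
    by (rule tendsto_of_inverse_Suc_bound) (use T uv in \<open>simp add: approx_law_def\<close>)
  assume "pmf P1 z = 0"
  then show "T k ((u, v), z) = 0" using T[of k] uv by (cases z) (simp add: approx_law_def)
next
  show "0 \<le> T k s" for k s using T[of k] by (simp only: approx_law_def)
  show "(\<Sum>s\<in>(SU \<times> SV) \<times> UNIV. T k s) = 1" for k using T[of k] by (simp only: approx_law_def)
qed

text \<open>If no tolerance worked, violators with tolerance \<open>1 / (k + 1)\<close> would have a
  subsequential limit in \<open>tilde_set Q\<close> with divergence at most \<open>E\<close>.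
  Infinite divergences are covered too, since the limit still vanishes where \<open>P1\<close>
  does.\<close>

lemma approx_law_rate:
  fixes P1 :: "('x \<times> 'y) pmf"
  assumes E: "\<And>T. T \<in> tilde_set Q \<Longrightarrow> ereal E < kl_div T (bar_law P1 \<kappa> \<mu>)"
  shows "\<exists>\<eta>>0. \<forall>T. approx_law P1 \<eta> T \<longrightarrow> E + I1 + I2 \<le> rate_fun (SU \<times> SV) (pmf P1) T"
proof (rule ccontr)
  let ?R = "rate_fun (SU \<times> SV) (pmf P1)"
  assume *: "\<not> ?thesis"
  have "\<exists>T. approx_law P1 (inverse (real (Suc k))) T \<and> ?R T < E + I1 + I2" for k
  proof -
    have "0 < inverse (real (Suc k))" by simp
    then show ?thesis using * not_le by blast
  qed
  then have "\<exists>T. \<forall>k. approx_law P1 (inverse (real (Suc k))) (T k) \<and> ?R (T k) < E + I1 + I2"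
    by (intro choice allI)
  then obtain T where T': "\<forall>k. approx_law P1 (inverse (real (Suc k))) (T k) \<and> ?R (T k) < E + I1 + I2" ..
  note T = conjunct1[OF spec[OF T']] conjunct2[OF spec[OF T']]
  obtain r T' where r: "T' \<in> tilde_set Q" "\<forall>(u, v, x, y)\<in>set_pmf T'. pmf P1 (x, y) \<noteq> 0"
    "(\<lambda>k. ?R (T (r k))) \<longlonglongrightarrow> ?R (pair_law T')"
    using approx_law_compact[OF T(1)] by (elim exE conjE)
  have "?R (pair_law T') \<le> E + I1 + I2"
    by (rule LIMSEQ_le_const2[OF r(3)]) (auto intro!: exI less_imp_le T(2))
  then have "kl_div T' (bar_law P1 \<kappa> \<mu>) \<le> ereal E"
    unfolding kl_div_tilde_set[OF r(1)] if_P[OF r(2)] by simp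
  then show False using E[OF r(1)] by simp
qed

section \<open>Codebooks for sequences\<close>

lemma sum_\<kappa>: "pmf (map_pmf rvX Q) x \<noteq> 0 \<Longrightarrow> (\<Sum>u\<in>SU. pmf (\<kappa> x) u) = 1"
  using sum_QUX[of x] unfolding QUX_eq sum_distrib_left[symmetric] by simp

lemma sum_\<mu>: "pmf QUY (u, y) \<noteq> 0 \<Longrightarrow> (\<Sum>v\<in>SV. pmf (\<mu> (u, y)) v) = 1"
  using sum_QUVY[of u y] unfolding QUVY_eq sum_distrib_left[symmetric] by simp

lemma sum_q2: "pmf QU u \<noteq> 0 \<Longrightarrow> (\<Sum>v\<in>SV. q2 v u) = 1"
  unfolding q2_def sum_divide_distrib[symmetric] sum_QUV by simp

definition atypical_info1 where
  "atypical_info1 n \<delta> = {ws. real n * \<delta> < \<bar>(\<Sum>i<n. (\<lambda>(u, x). log 2 (pmf (\<kappa> x) u / pmf QU u)) (ws ! i)) - real n * I1\<bar>}"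

definition atypical_info2 where
  "atypical_info2 n \<delta> = {ws. real n * \<delta> < \<bar>(\<Sum>i<n. (\<lambda>(u, v, y). log 2 (pmf (\<mu> (u, y)) v / q2 v u)) (ws ! i)) - real n * I2\<bar>}"

lemma prob_info1_tendsto:
  assumes "\<delta> > 0"
  shows "(\<lambda>n. measure_pmf.prob (replicate_pmf n QUX) (atypical_info1 n \<delta>)) \<longlonglongrightarrow> 0"
proof -
  have "I1 = (\<Sum>z\<in>set_pmf QUX. pmf QUX z * (\<lambda>(u, x). log 2 (pmf (\<kappa> x) u / pmf QU u)) z)"
    unfolding sum_pmf_comp_map[OF fin] I1_def info1_def by (simp add: split_def)
  then show ?thesis unfolding atypical_info1_def using weak_law_replicate_pmf[of QUX \<delta>] fin assms by simp
qed

lemma prob_info2_tendsto: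
  assumes "\<delta> > 0"
  shows "(\<lambda>n. measure_pmf.prob (replicate_pmf n QUVY) (atypical_info2 n \<delta>)) \<longlonglongrightarrow> 0"
proof -
  have "I2 = (\<Sum>z\<in>set_pmf QUVY. pmf QUVY z * (\<lambda>(u, v, y). log 2 (pmf (\<mu> (u, y)) v / q2 v u)) z)"
    unfolding sum_pmf_comp_map[OF fin] I2_def info2_def by (simp add: split_def)
  then show ?thesis unfolding atypical_info2_def using weak_law_replicate_pmf[of QUVY \<delta>] fin assms by simp
qed

text \<open>The one-shot bound for memoryless weights. Its three error terms become probabilities
  under i.i.d. sampling from \<open>Q\<close>, \<open>QUX\<close> and \<open>QUVY\<close>, to which
  the weak law applies.\<close>

lemma interactive_codebooks:
  fixes Bad :: "nat list \<Rightarrow> nat list \<Rightarrow> 'x list \<Rightarrow> 'y list \<Rightarrow> bool"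
  defines "\<eta> n \<equiv> measure_pmf.prob (replicate_pmf n Q) {ws. Bad (map rvU ws) (map rvV ws) (map rvX ws) (map rvY ws)}"
  assumes d: "\<delta> \<ge> 0" and th: "\<theta>\<^sub>1 > 0" "\<theta>\<^sub>2 > 0" and M: "M\<^sub>1 > 0" "M\<^sub>2 > 0"
  shows "\<exists>CU eU CV eV. CU \<subseteq> seqs n SU \<and> CU \<noteq> {} \<and> card CU \<le> M\<^sub>1 \<and> (\<forall>x. eU x \<in> CU) \<and>
    (\<forall>u\<in>seqs n SU. CV u \<subseteq> seqs n SV \<and> CV u \<noteq> {} \<and> card (CV u) \<le> M\<^sub>2 \<and> (\<forall>y. eV u y \<in> CV u)) \<and>
    measure_pmf.prob (replicate_pmf n P0) {zs. Bad (eU (map fst zs)) (eV (eU (map fst zs)) (map snd zs)) (map fst zs) (map snd zs)} \<le>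
      \<theta>\<^sub>1 + (\<theta>\<^sub>2 + \<eta> n / \<theta>\<^sub>2 + measure_pmf.prob (replicate_pmf n QUVY) (atypical_info2 n \<delta>)
        + exp (- (real M\<^sub>2 / 2 powr (real n * (I2 + \<delta>))))) / \<theta>\<^sub>1
      + measure_pmf.prob (replicate_pmf n QUX) (atypical_info1 n \<delta>)
      + exp (- (real M\<^sub>1 / 2 powr (real n * (I1 + \<delta>))))"
proof -
  let ?SX = "seqs n (UNIV :: 'x set)" and ?SY = "seqs n (UNIV :: 'y set)"
  let ?SU = "seqs n SU" and ?SV = "seqs n SV"
  define p where "p xs ys = (\<Prod>i<n. pmf P0 (xs ! i, ys ! i))" for xs ys
  define k where "k us xs = (\<Prod>i<n. pmf (\<kappa> (xs ! i)) (us ! i))" for us xs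
  define m where "m vs us ys = (\<Prod>i<n. pmf (\<mu> (us ! i, ys ! i)) (vs ! i))" for vs us ys
  define q1n where "q1n us = (\<Prod>i<n. pmf QU (us ! i))" for us
  define q2n where "q2n vs us = (\<Prod>i<n. q2 (vs ! i) (us ! i))" for vs us
  \<comment> \<open>The tolerated likelihood ratio is 2 to the power \<open>n\<close> times the mean
    information density plus the slack \<delta>; exceeding it is a deviation that the weak law makes
    improbable.\<close>
  define c1 where "c1 = 2 powr (real n * (I1 + \<delta>))"
  define c2 where "c2 = 2 powr (real n * (I2 + \<delta>))"
  have c: "c1 \<ge> 1" "c2 \<ge> 1"
    using I1_nonneg I2_nonneg d by (auto simp: c1_def c2_def intro!: ge_one_powr_ge_zero)
  have sp: "(\<Sum>ys\<in>?SY. p xs ys) = (\<Prod>i<n. pmf (map_pmf rvX Q) (xs ! i))" for xs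
    unfolding p_def using sum_prod_seqs[where f="\<lambda>i y. pmf P0 (xs ! i, y)" and n=n and A=UNIV] by (simp add: sum_P0)
  have spk: "(\<Sum>xs\<in>?SX. p xs ys * k us xs) = (\<Prod>i<n. pmf QUY (us ! i, ys ! i))" for us ys
    unfolding p_def k_def prod.distrib[symmetric]
    using sum_prod_seqs[where f="\<lambda>i x. pmf P0 (x, ys ! i) * pmf (\<kappa> x) (us ! i)" and n=n and A=UNIV]
    by (simp add: sum_QUXY_x)
  have spku: "(\<Sum>ys\<in>?SY. \<Sum>xs\<in>?SX. p xs ys * k us xs) = q1n us" for us
    unfolding spk q1n_def
    using sum_prod_seqs[where f="\<lambda>i y. pmf QUY (us ! i, y)" and n=n and A=UNIV] by (simp add: sum_QUY)
  have nn: "0 \<le> p xs ys" "0 \<le> k us xs" "0 \<le> m vs us ys" "0 \<le> q1n us" "0 \<le> q2n vs us" for us vs xs ys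
    unfolding p_def k_def m_def q1n_def q2n_def using q2_nonneg by (auto intro: prod_nonneg)
  have main: "\<exists>CU eU CV eV. CU \<subseteq> ?SU \<and> CU \<noteq> {} \<and> card CU \<le> M\<^sub>1 \<and> (\<forall>x. eU x \<in> CU) \<and>
    (\<forall>u\<in>?SU. CV u \<subseteq> ?SV \<and> CV u \<noteq> {} \<and> card (CV u) \<le> M\<^sub>2 \<and> (\<forall>y. eV u y \<in> CV u)) \<and>
    (\<Sum>x\<in>?SX. \<Sum>y\<in>?SY. p x y * of_bool (Bad (eU x) (eV (eU x) y) x y)) \<le>
      \<theta>\<^sub>1 + (\<theta>\<^sub>2 + (\<Sum>u\<in>?SU. \<Sum>y\<in>?SY. \<Sum>v\<in>?SV. \<Sum>x\<in>?SX. p x y * k u x * m v u y * of_bool (Bad u v x y)) / \<theta>\<^sub>2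
       + (\<Sum>u\<in>?SU. \<Sum>y\<in>?SY. \<Sum>v\<in>?SV. (\<Sum>x\<in>?SX. p x y * k u x) * m v u y * of_bool (q2n v u * c2 < m v u y))
       + exp (- (real M\<^sub>2 / c2))) / \<theta>\<^sub>1
       + (\<Sum>x\<in>?SX. \<Sum>u\<in>?SU. (\<Sum>y\<in>?SY. p x y) * k u x * of_bool (q1n u * c1 < k u x)) + exp (- (real M\<^sub>1 / c1))"
  proof (rule interactive_one_shot)
    show "?SV \<noteq> {}"
    proof -
      obtain v where "v \<in> SV" using SV_ne by auto
      then have "replicate n v \<in> ?SV" by (auto simp: seqs_def)
      then show ?thesis by blast
    qed
    show "sum q1n ?SU = 1"
      unfolding q1n_def[abs_def] using sum_prod_seqs[where f="\<lambda>i u. pmf QU u" and n=n and A=SU] by (simp add: sum_QU)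
    show "(\<Sum>v\<in>?SV. q2n v u) = 1" if u: "u \<in> ?SU" "(\<Sum>y\<in>?SY. \<Sum>x\<in>?SX. p x y * k u x) \<noteq> 0" for u
    proof -
      have "(\<Sum>v\<in>?SV. q2n v u) = (\<Prod>i<n. \<Sum>v\<in>SV. q2 v (u ! i))"
        unfolding q2n_def by (rule sum_prod_seqs)
      also have "\<dots> = 1"
        using u(2) unfolding spku q1n_def by (intro prod.neutral ballI sum_q2) (auto simp: prod_zero_iff)
      finally show ?thesis .
    qed
    show "(\<Sum>x\<in>?SX. \<Sum>y\<in>?SY. p x y) = 1"
      unfolding sp using sum_prod_seqs[where f="\<lambda>i x. pmf (map_pmf rvX Q) x" and n=n and A=UNIV]
      by (simp add: sum_pmf_eq_1)
    show "(\<Sum>u\<in>?SU. k u x) = 1" if "(\<Sum>y\<in>?SY. p x y) \<noteq> 0" for x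
    proof -
      have "(\<Sum>u\<in>?SU. k u x) = (\<Prod>i<n. \<Sum>u\<in>SU. pmf (\<kappa> (x ! i)) u)"
        unfolding k_def by (rule sum_prod_seqs)
      also have "\<dots> = 1"
        using that unfolding sp by (intro prod.neutral ballI sum_\<kappa>) (auto simp: prod_zero_iff)
      finally show ?thesis .
    qed
    show "(\<Sum>v\<in>?SV. m v u y) = 1" if "(\<Sum>x\<in>?SX. p x y * k u x) \<noteq> 0" for u y
    proof -
      have "(\<Sum>v\<in>?SV. m v u y) = (\<Prod>i<n. \<Sum>v\<in>SV. pmf (\<mu> (u ! i, y ! i)) v)"
        unfolding m_def by (rule sum_prod_seqs)
      also have "\<dots> = 1"
        using that unfolding spk by (intro prod.neutral ballI sum_\<mu>) (auto simp: prod_zero_iff)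
      finally show ?thesis .
    qed
  qed (use nn c th M in \<open>simp_all add: finite_seqs del: seqs_UNIV\<close>)
  have prob_eq: "(\<Sum>x\<in>?SX. \<Sum>y\<in>?SY. p x y * of_bool (Bad (eU x) (eV (eU x) y) x y)) =
    measure_pmf.prob (replicate_pmf n P0) {zs. Bad (eU (map fst zs)) (eV (eU (map fst zs)) (map snd zs)) (map fst zs) (map snd zs)}"
    for eU eV
  proof -
    have "measure_pmf.prob (replicate_pmf n P0) {zs. Bad (eU (map fst zs)) (eV (eU (map fst zs)) (map snd zs)) (map fst zs) (map snd zs)} =
      (\<Sum>x\<in>?SX. \<Sum>y\<in>?SY. (\<Prod>i<n. pmf P0 (x ! i, y ! i)) * of_bool
        (Bad (eU (map fst (zip x y))) (eV (eU (map fst (zip x y))) (map snd (zip x y))) (map fst (zip x y)) (map snd (zip x y))))"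
      by (rule prob_replicate_pmf_pair) auto
    also have "\<dots> = (\<Sum>x\<in>?SX. \<Sum>y\<in>?SY. p x y * of_bool (Bad (eU x) (eV (eU x) y) x y))"
      by (intro sum.cong refl) (simp add: p_def)
    finally show ?thesis by simp
  qed
  have eta_eq: "(\<Sum>u\<in>?SU. \<Sum>y\<in>?SY. \<Sum>v\<in>?SV. \<Sum>x\<in>?SX. p x y * k u x * m v u y * of_bool (Bad u v x y)) = \<eta> n"
  proof -
    have "\<eta> n = (\<Sum>ws\<in>seqs n (SU \<times> SV \<times> UNIV \<times> UNIV). (\<Prod>i<n. pmf Q (ws ! i)) *
      of_bool (Bad (map rvU ws) (map rvV ws) (map rvX ws) (map rvY ws)))"
      unfolding \<eta>_def by (rule prob_replicate_pmf) (auto dest: set_Q)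
    also have "\<dots> = (\<Sum>u\<in>?SU. \<Sum>v\<in>?SV. \<Sum>x\<in>?SX. \<Sum>y\<in>?SY. p x y * k u x * m v u y * of_bool (Bad u v x y))"
      unfolding sum_seqs_zip
    proof (intro sum.cong refl)
      fix u v x y assume l: "u \<in> ?SU" "v \<in> ?SV" "x \<in> ?SX" "y \<in> ?SY"
      let ?w = "zip u (zip v (zip x y))"
      have len: "length u = n" "length v = n" "length x = n" "length y = n" using l length_seqs by auto
      have "map rvU ?w = u" "map rvV ?w = v" "map rvX ?w = x" "map rvY ?w = y"
        using len by (auto intro!: nth_equalityI)
      moreover have "(\<Prod>i<n. pmf Q (?w ! i)) = p x y * k u x * m v u y"
        unfolding p_def k_def m_def prod.distrib[symmetric] using len by (intro prod.cong) (auto simp: pmf_Q)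
      ultimately show "(\<Prod>i<n. pmf Q (?w ! i)) * of_bool (Bad (map rvU ?w) (map rvV ?w) (map rvX ?w) (map rvY ?w)) =
        p x y * k u x * m v u y * of_bool (Bad u v x y)" by simp
    qed
    also have "\<dots> = (\<Sum>u\<in>?SU. \<Sum>v\<in>?SV. \<Sum>y\<in>?SY. \<Sum>x\<in>?SX. p x y * k u x * m v u y * of_bool (Bad u v x y))"
      by (intro sum.cong refl sum.swap)
    also have "\<dots> = (\<Sum>u\<in>?SU. \<Sum>y\<in>?SY. \<Sum>v\<in>?SV. \<Sum>x\<in>?SX. p x y * k u x * m v u y * of_bool (Bad u v x y))"
      by (intro sum.cong refl sum.swap)
    finally show ?thesis by simp
  qed
  have info1_le: "(\<Sum>x\<in>?SX. \<Sum>u\<in>?SU. (\<Sum>y\<in>?SY. p x y) * k u x * of_bool (q1n u * c1 < k u x)) \<le>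
    measure_pmf.prob (replicate_pmf n QUX) (atypical_info1 n \<delta>)"
  proof -
    have "measure_pmf.prob (replicate_pmf n QUX) (atypical_info1 n \<delta>) =
      (\<Sum>u\<in>?SU. \<Sum>x\<in>?SX. (\<Prod>i<n. pmf QUX (u ! i, x ! i)) * of_bool (real n * \<delta> < \<bar>(\<Sum>i<n. (\<lambda>(u, x). log 2 (pmf (\<kappa> x) u / pmf QU u)) (zip u x ! i)) - real n * I1\<bar>))"
      unfolding atypical_info1_def by (rule prob_replicate_pmf_pair) (auto dest: set_Q)
    also have "\<dots> = (\<Sum>x\<in>?SX. \<Sum>u\<in>?SU. (\<Prod>i<n. pmf QUX (u ! i, x ! i)) * of_bool (real n * \<delta> < \<bar>(\<Sum>i<n. (\<lambda>(u, x). log 2 (pmf (\<kappa> x) u / pmf QU u)) (zip u x ! i)) - real n * I1\<bar>))"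
      by (rule sum.swap)
    also have "\<dots> \<ge> (\<Sum>x\<in>?SX. \<Sum>u\<in>?SU. (\<Sum>y\<in>?SY. p x y) * k u x * of_bool (q1n u * c1 < k u x))"
    proof (intro sum_mono)
      fix x u assume l: "x \<in> ?SX" "u \<in> ?SU"
      have len: "length u = n" "length x = n" using l length_seqs by auto
      have e: "(\<Sum>y\<in>?SY. p x y) * k u x = (\<Prod>i<n. pmf QUX (u ! i, x ! i))"
        unfolding sp k_def prod.distrib[symmetric] by (simp add: QUX_eq)
      show "(\<Sum>y\<in>?SY. p x y) * k u x * of_bool (q1n u * c1 < k u x) \<le>
        (\<Prod>i<n. pmf QUX (u ! i, x ! i)) * of_bool (real n * \<delta> < \<bar>(\<Sum>i<n. (\<lambda>(u, x). log 2 (pmf (\<kappa> x) u / pmf QU u)) (zip u x ! i)) - real n * I1\<bar>)"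
      \<comment> \<open>Taking logarithms requires every factor to be positive, which a nonzero
        product provides; pairs of sequences of mass zero contribute nothing.\<close>
      proof (cases "(\<Prod>i<n. pmf QUX (u ! i, x ! i)) \<noteq> 0 \<and> q1n u * c1 < k u x")
        case True
        have pos: "0 < pmf (\<kappa> (x ! i)) (u ! i)" "0 < pmf QU (u ! i)" if "i < n" for i
        proof -
          have "0 < pmf QUX (u ! i, x ! i)" by (rule prod_pos_imp_pos[OF _ _ that]) (use True in auto)
          then have "(u ! i, x ! i) \<in> set_pmf QUX" by (simp only: pmf_positive_iff)
          then obtain v y where "(u ! i, v, x ! i, y) \<in> set_pmf Q" by auto
          from support_pos[OF this] show "0 < pmf (\<kappa> (x ! i)) (u ! i)" "0 < pmf QU (u ! i)" by auto
        qed
        have "real n * \<delta> < \<bar>(\<Sum>i<n. log 2 (pmf (\<kappa> (x ! i)) (u ! i) / pmf QU (u ! i))) - real n * I1\<bar>"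
          by (rule log_ratio_deviation) (use pos True in \<open>auto simp: k_def q1n_def c1_def\<close>)
        then have "real n * \<delta> < \<bar>(\<Sum>i<n. (\<lambda>(u, x). log 2 (pmf (\<kappa> x) u / pmf QU u)) (zip u x ! i)) - real n * I1\<bar>"
          using len by simp
        then show ?thesis unfolding e using True by simp
      next
        case False
        have "0 \<le> (\<Prod>i<n. pmf QUX (u ! i, x ! i))" by (intro prod_nonneg) auto
        then show ?thesis unfolding e using False by auto
      qed
    qed
    finally show ?thesis .
  qed
  have info2_le: "(\<Sum>u\<in>?SU. \<Sum>y\<in>?SY. \<Sum>v\<in>?SV. (\<Sum>x\<in>?SX. p x y * k u x) * m v u y * of_bool (q2n v u * c2 < m v u y)) \<le>
    measure_pmf.prob (replicate_pmf n QUVY) (atypical_info2 n \<delta>)"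
  proof -
    let ?D = "\<lambda>u v y. real n * \<delta> < \<bar>(\<Sum>i<n. (\<lambda>(u, v, y). log 2 (pmf (\<mu> (u, y)) v / q2 v u)) (zip u (zip v y) ! i)) - real n * I2\<bar>"
    have "measure_pmf.prob (replicate_pmf n QUVY) (atypical_info2 n \<delta>) =
      (\<Sum>u\<in>?SU. \<Sum>w\<in>seqs n (SV \<times> UNIV). (\<Prod>i<n. pmf QUVY (u ! i, w ! i)) * of_bool (real n * \<delta> < \<bar>(\<Sum>i<n. (\<lambda>(u, v, y). log 2 (pmf (\<mu> (u, y)) v / q2 v u)) (zip u w ! i)) - real n * I2\<bar>))"
      unfolding atypical_info2_def by (rule prob_replicate_pmf_pair) (auto dest: set_Q)
    also have "\<dots> = (\<Sum>u\<in>?SU. \<Sum>v\<in>?SV. \<Sum>y\<in>?SY. (\<Prod>i<n. pmf QUVY (u ! i, zip v y ! i)) * of_bool (?D u v y))"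
      unfolding sum_seqs_zip ..
    also have "\<dots> = (\<Sum>u\<in>?SU. \<Sum>y\<in>?SY. \<Sum>v\<in>?SV. (\<Prod>i<n. pmf QUVY (u ! i, zip v y ! i)) * of_bool (?D u v y))"
      by (intro sum.cong refl sum.swap)
    also have "\<dots> \<ge> (\<Sum>u\<in>?SU. \<Sum>y\<in>?SY. \<Sum>v\<in>?SV. (\<Sum>x\<in>?SX. p x y * k u x) * m v u y * of_bool (q2n v u * c2 < m v u y))"
    proof (intro sum_mono)
      fix u y v assume l: "u \<in> ?SU" "y \<in> ?SY" "v \<in> ?SV"
      have len: "length u = n" "length v = n" "length y = n" using l length_seqs by auto
      have e: "(\<Sum>x\<in>?SX. p x y * k u x) * m v u y = (\<Prod>i<n. pmf QUVY (u ! i, v ! i, y ! i))"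
        unfolding spk m_def prod.distrib[symmetric] by (simp add: QUVY_eq)
      have e': "(\<Prod>i<n. pmf QUVY (u ! i, zip v y ! i)) = (\<Prod>i<n. pmf QUVY (u ! i, v ! i, y ! i))"
        using len by (intro prod.cong) auto
      show "(\<Sum>x\<in>?SX. p x y * k u x) * m v u y * of_bool (q2n v u * c2 < m v u y) \<le>
        (\<Prod>i<n. pmf QUVY (u ! i, zip v y ! i)) * of_bool (?D u v y)"
      proof (cases "(\<Prod>i<n. pmf QUVY (u ! i, v ! i, y ! i)) \<noteq> 0 \<and> q2n v u * c2 < m v u y")
        case True
        have pos: "0 < pmf (\<mu> (u ! i, y ! i)) (v ! i)" "0 < q2 (v ! i) (u ! i)" if "i < n" for i
        proof -
          have "0 < pmf QUVY (u ! i, v ! i, y ! i)" by (rule prod_pos_imp_pos[OF _ _ that]) (use True in auto)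
          then have "(u ! i, v ! i, y ! i) \<in> set_pmf QUVY" by (simp only: pmf_positive_iff)
          then obtain x where "(u ! i, v ! i, x, y ! i) \<in> set_pmf Q" by auto
          from support_pos[OF this] show "0 < pmf (\<mu> (u ! i, y ! i)) (v ! i)" "0 < q2 (v ! i) (u ! i)" by auto
        qed
        have "real n * \<delta> < \<bar>(\<Sum>i<n. log 2 (pmf (\<mu> (u ! i, y ! i)) (v ! i) / q2 (v ! i) (u ! i))) - real n * I2\<bar>"
          by (rule log_ratio_deviation) (use pos True in \<open>auto simp: m_def q2n_def c2_def\<close>)
        then have "?D u v y" using len by simp
        then show ?thesis unfolding e e' using True by simp
      next
        case False
        have "0 \<le> (\<Prod>i<n. pmf QUVY (u ! i, v ! i, y ! i))" by (intro prod_nonneg) auto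
        then show ?thesis unfolding e e' using False by auto
      qed
    qed
    finally show ?thesis .
  qed
  from main obtain CU eU CV eV where C: "CU \<subseteq> ?SU" "CU \<noteq> {}" "card CU \<le> M\<^sub>1" "\<forall>x. eU x \<in> CU"
    "\<forall>u\<in>?SU. CV u \<subseteq> ?SV \<and> CV u \<noteq> {} \<and> card (CV u) \<le> M\<^sub>2 \<and> (\<forall>y. eV u y \<in> CV u)"
    and le: "(\<Sum>x\<in>?SX. \<Sum>y\<in>?SY. p x y * of_bool (Bad (eU x) (eV (eU x) y) x y)) \<le>
      \<theta>\<^sub>1 + (\<theta>\<^sub>2 + \<eta> n / \<theta>\<^sub>2
       + (\<Sum>u\<in>?SU. \<Sum>y\<in>?SY. \<Sum>v\<in>?SV. (\<Sum>x\<in>?SX. p x y * k u x) * m v u y * of_bool (q2n v u * c2 < m v u y))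
       + exp (- (real M\<^sub>2 / c2))) / \<theta>\<^sub>1
       + (\<Sum>x\<in>?SX. \<Sum>u\<in>?SU. (\<Sum>y\<in>?SY. p x y) * k u x * of_bool (q1n u * c1 < k u x)) + exp (- (real M\<^sub>1 / c1))"
    unfolding eta_eq by (elim exE conjE)
  note le
  also have "\<theta>\<^sub>1 + (\<theta>\<^sub>2 + \<eta> n / \<theta>\<^sub>2
       + (\<Sum>u\<in>?SU. \<Sum>y\<in>?SY. \<Sum>v\<in>?SV. (\<Sum>x\<in>?SX. p x y * k u x) * m v u y * of_bool (q2n v u * c2 < m v u y))
       + exp (- (real M\<^sub>2 / c2))) / \<theta>\<^sub>1
       + (\<Sum>x\<in>?SX. \<Sum>u\<in>?SU. (\<Sum>y\<in>?SY. p x y) * k u x * of_bool (q1n u * c1 < k u x)) + exp (- (real M\<^sub>1 / c1)) \<le>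
     \<theta>\<^sub>1 + (\<theta>\<^sub>2 + \<eta> n / \<theta>\<^sub>2 + measure_pmf.prob (replicate_pmf n QUVY) (atypical_info2 n \<delta>)
        + exp (- (real M\<^sub>2 / c2))) / \<theta>\<^sub>1
      + measure_pmf.prob (replicate_pmf n QUX) (atypical_info1 n \<delta>) + exp (- (real M\<^sub>1 / c1))"
    using th by (intro add_mono divide_right_mono info1_le info2_le order_refl less_imp_le)
  finally show ?thesis
    unfolding prob_eq c1_def c2_def using C
    by (intro exI[of _ CU] exI[of _ eU] exI[of _ CV] exI[of _ eV] conjI)
qed

section \<open>Typicality and error exponent\<close>

text \<open>Typicality with one additive tolerance for all cells. Cells of probability zero may also
  be hit, so an accepted type can violate the support as well as the values of the prescribed
  marginals.\<close>

definition typX where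
  "typX n \<eta> us vs xs \<longleftrightarrow> (\<forall>u\<in>SU. \<forall>v\<in>SV. \<forall>x.
    \<bar>real (card {i. i < n \<and> (us ! i, vs ! i, xs ! i) = (u, v, x)}) / real n - pmf QUVX (u, v, x)\<bar> \<le> \<eta>)"

definition typY where
  "typY n \<eta> us vs ys \<longleftrightarrow> (\<forall>u\<in>SU. \<forall>v\<in>SV. \<forall>y.
    \<bar>real (card {i. i < n \<and> (us ! i, vs ! i, ys ! i) = (u, v, y)}) / real n - pmf QUVY (u, v, y)\<bar> \<le> \<eta>)"

lemma atypical_tendsto:
  assumes e: "\<eta> > 0"
  shows "(\<lambda>n. measure_pmf.prob (replicate_pmf n Q) {ws. \<not> (typX n \<eta> (map rvU ws) (map rvV ws) (map rvX ws) \<and>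
    typY n \<eta> (map rvU ws) (map rvV ws) (map rvY ws))}) \<longlonglongrightarrow> 0"
proof -
  define FX where "FX n = {ws :: (nat \<times> nat \<times> 'x \<times> 'y) list. \<exists>b\<in>SU \<times> SV \<times> UNIV. \<not> \<bar>real (card {i. i < n \<and> (\<lambda>(u, v, x, y). (u, v, x)) (ws ! i) = b}) / real n - pmf QUVX b\<bar> \<le> \<eta>}" for n
  define FY where "FY n = {ws :: (nat \<times> nat \<times> 'x \<times> 'y) list. \<exists>b\<in>SU \<times> SV \<times> UNIV. \<not> \<bar>real (card {i. i < n \<and> (\<lambda>(u, v, x, y). (u, v, y)) (ws ! i) = b}) / real n - pmf QUVY b\<bar> \<le> \<eta>}" for n
  have "(\<lambda>n. measure_pmf.prob (replicate_pmf n Q) (FX n)) \<longlonglongrightarrow> 0"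
    unfolding FX_def by (rule frequency_tendsto) (use fin e in auto)
  moreover have "(\<lambda>n. measure_pmf.prob (replicate_pmf n Q) (FY n)) \<longlonglongrightarrow> 0"
    unfolding FY_def by (rule frequency_tendsto) (use fin e in auto)
  ultimately have lim: "(\<lambda>n. measure_pmf.prob (replicate_pmf n Q) (FX n) + measure_pmf.prob (replicate_pmf n Q) (FY n)) \<longlonglongrightarrow> 0 + 0"
    by (rule tendsto_add)
  have "measure_pmf.prob (replicate_pmf n Q) {ws. \<not> (typX n \<eta> (map rvU ws) (map rvV ws) (map rvX ws) \<and>
      typY n \<eta> (map rvU ws) (map rvV ws) (map rvY ws))} \<le>
      measure_pmf.prob (replicate_pmf n Q) (FX n) + measure_pmf.prob (replicate_pmf n Q) (FY n)" for n
  proof -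
    have "measure_pmf.prob (replicate_pmf n Q) {ws. \<not> (typX n \<eta> (map rvU ws) (map rvV ws) (map rvX ws) \<and>
      typY n \<eta> (map rvU ws) (map rvV ws) (map rvY ws))} \<le> measure_pmf.prob (replicate_pmf n Q) (FX n \<union> FY n)"
    proof (rule prob_pmf_mono)
      fix ws assume "ws \<in> set_pmf (replicate_pmf n Q)"
      then have len: "length ws = n" by (simp add: set_replicate_pmf)
      assume "ws \<in> {ws. \<not> (typX n \<eta> (map rvU ws) (map rvV ws) (map rvX ws) \<and>
        typY n \<eta> (map rvU ws) (map rvV ws) (map rvY ws))}"
      then consider "\<not> typX n \<eta> (map rvU ws) (map rvV ws) (map rvX ws)" | "\<not> typY n \<eta> (map rvU ws) (map rvV ws) (map rvY ws)"
        by blast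
      then show "ws \<in> FX n \<union> FY n"
      proof cases
        case 1
        then obtain u v x where b: "(u, v, x) \<in> SU \<times> SV \<times> UNIV"
          and *: "\<not> \<bar>real (card {i. i < n \<and> (map rvU ws ! i, map rvV ws ! i, map rvX ws ! i) = (u, v, x)}) / real n - pmf QUVX (u, v, x)\<bar> \<le> \<eta>"
          unfolding typX_def by blast
        have "{i. i < n \<and> (map rvU ws ! i, map rvV ws ! i, map rvX ws ! i) = (u, v, x)} =
          {i. i < n \<and> (\<lambda>(u, v, x, y). (u, v, x)) (ws ! i) = (u, v, x)}"
          using len by (auto simp: split_def)
        then show ?thesis using b * unfolding FX_def by (intro UnI1 CollectI bexI[OF _ b]) simp
      next
        case 2
        then obtain u v y where b: "(u, v, y) \<in> SU \<times> SV \<times> UNIV"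
          and *: "\<not> \<bar>real (card {i. i < n \<and> (map rvU ws ! i, map rvV ws ! i, map rvY ws ! i) = (u, v, y)}) / real n - pmf QUVY (u, v, y)\<bar> \<le> \<eta>"
          unfolding typY_def by blast
        have "{i. i < n \<and> (map rvU ws ! i, map rvV ws ! i, map rvY ws ! i) = (u, v, y)} =
          {i. i < n \<and> (\<lambda>(u, v, x, y). (u, v, y)) (ws ! i) = (u, v, y)}"
          using len by (auto simp: split_def)
        then show ?thesis using b * unfolding FY_def by (intro UnI2 CollectI bexI[OF _ b]) simp
      qed
    qed
    also have "\<dots> \<le> measure_pmf.prob (replicate_pmf n Q) (FX n) + measure_pmf.prob (replicate_pmf n Q) (FY n)"
      by (rule measure_Un_le) auto
    finally show ?thesis .
  qed
  note le = this
  show ?thesis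
  proof (rule tendsto_sandwich[OF _ _ tendsto_const])
    show "(\<lambda>n. measure_pmf.prob (replicate_pmf n Q) (FX n) + measure_pmf.prob (replicate_pmf n Q) (FY n)) \<longlonglongrightarrow> 0"
      using lim by simp
  qed (intro always_eventually allI le measure_nonneg)+
qed

text \<open>The two tests see only marginals of the joint type, obtained by summing its counts over
  \<open>y\<close> or over \<open>x\<close>; together they make it an \<open>approx_law\<close>, and
  the method of types applies with \<open>(u, v)\<close> as the fixed first variable.\<close>

lemma typical_prob_le:
  fixes P1 :: "('x \<times> 'y) pmf"
  assumes rate: "\<And>T. approx_law P1 \<eta> T \<Longrightarrow> F \<le> rate_fun (SU \<times> SV) (pmf P1) T"
    and n: "n > 0" and us: "us \<in> seqs n SU" and vs: "vs \<in> seqs n SV"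
  shows "measure_pmf.prob (replicate_pmf n P1) {zs. typX n \<eta> us vs (map fst zs) \<and> typY n \<eta> us vs (map snd zs)} \<le>
    (real n + 1) ^ card ((SU \<times> SV) \<times> (UNIV :: ('x \<times> 'y) set)) * 2 powr (- (real n * F))"
proof (rule prob_le_types[where ws="zip us vs"])
  have len: "length us = n" "length vs = n" using us vs length_seqs by auto
  then show l: "length (zip us vs) = n" by simp
  show sub: "set (zip us vs) \<subseteq> SU \<times> SV"
    using us vs by (auto simp: seqs_def dest: set_zip_leftD set_zip_rightD)
  show "n > 0" by (rule n)
  fix zs :: "('x \<times> 'y) list"
  assume lz: "length zs = n" and tp: "typX n \<eta> us vs (map fst zs) \<and> typY n \<eta> us vs (map snd zs)"
    and ac: "\<And>w z. w \<in> SU \<times> SV \<Longrightarrow> pmf P1 z = 0 \<Longrightarrow> type_count (zip us vs) zs (w, z) = 0"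
  let ?N = "type_count (zip us vs) zs"
  have N: "real (?N ((u, v), (x, y))) = (\<Sum>i<n. of_bool (us ! i = u \<and> vs ! i = v \<and> fst (zs ! i) = x \<and> snd (zs ! i) = y))" for u v x y
  proof -
    have "{i. i < length (zip us vs) \<and> (zip us vs ! i, zs ! i) = ((u, v), (x, y))} =
      {i. i < n \<and> us ! i = u \<and> vs ! i = v \<and> fst (zs ! i) = x \<and> snd (zs ! i) = y}"
      using len by (auto simp: prod_eq_iff)
    then show ?thesis unfolding type_count_def using card_eq_sum_of_bool by simp
  qed
  have sx: "(\<Sum>y\<in>UNIV. real (?N ((u, v), (x, y)))) = real (card {i. i < n \<and> (us ! i, vs ! i, map fst zs ! i) = (u, v, x)})" for u v x
  proof -
    have "(\<Sum>y\<in>UNIV. real (?N ((u, v), (x, y)))) =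
      (\<Sum>i<n. \<Sum>y\<in>UNIV. of_bool (us ! i = u \<and> vs ! i = v \<and> fst (zs ! i) = x \<and> snd (zs ! i) = y))"
      unfolding N by (rule sum.swap)
    also have "\<dots> = (\<Sum>i<n. of_bool ((us ! i, vs ! i, map fst zs ! i) = (u, v, x)))"
    proof (intro sum.cong refl)
      fix i assume i: "i \<in> {..<n}"
      show "(\<Sum>y\<in>UNIV. of_bool (us ! i = u \<and> vs ! i = v \<and> fst (zs ! i) = x \<and> snd (zs ! i) = y)) =
        (of_bool ((us ! i, vs ! i, map fst zs ! i) = (u, v, x)) :: real)"
      proof (cases "us ! i = u \<and> vs ! i = v \<and> fst (zs ! i) = x")
        case True
        then show ?thesis using i lz by simp
      next
        case False
        then show ?thesis using i lz by auto
      qed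
    qed
    finally show ?thesis unfolding card_eq_sum_of_bool .
  qed
  have sy: "(\<Sum>x\<in>UNIV. real (?N ((u, v), (x, y)))) = real (card {i. i < n \<and> (us ! i, vs ! i, map snd zs ! i) = (u, v, y)})" for u v y
  proof -
    have "(\<Sum>x\<in>UNIV. real (?N ((u, v), (x, y)))) =
      (\<Sum>i<n. \<Sum>x\<in>UNIV. of_bool (us ! i = u \<and> vs ! i = v \<and> fst (zs ! i) = x \<and> snd (zs ! i) = y))"
      unfolding N by (rule sum.swap)
    also have "\<dots> = (\<Sum>i<n. of_bool ((us ! i, vs ! i, map snd zs ! i) = (u, v, y)))"
    proof (intro sum.cong refl)
      fix i assume i: "i \<in> {..<n}"
      show "(\<Sum>x\<in>UNIV. of_bool (us ! i = u \<and> vs ! i = v \<and> fst (zs ! i) = x \<and> snd (zs ! i) = y)) =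
        (of_bool ((us ! i, vs ! i, map snd zs ! i) = (u, v, y)) :: real)"
      proof (cases "us ! i = u \<and> vs ! i = v \<and> snd (zs ! i) = y")
        case True
        then show ?thesis using i lz by simp
      next
        case False
        then show ?thesis using i lz by auto
      qed
    qed
    finally show ?thesis unfolding card_eq_sum_of_bool .
  qed
  show "F \<le> rate_fun (SU \<times> SV) (pmf P1) (\<lambda>s. real (?N s) / real n)"
  proof (rule rate, unfold approx_law_def, intro conjI)
    show "\<forall>s. 0 \<le> real (?N s) / real n" by simp
    have "(\<Sum>s\<in>(SU \<times> SV) \<times> UNIV. real (?N s) * 1) = (\<Sum>i<length (zip us vs). 1)"
      by (rule sum_type_count) (use sub in auto)
    then show "(\<Sum>s\<in>(SU \<times> SV) \<times> UNIV. real (?N s) / real n) = 1"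
      using n l by (simp add: sum_divide_distrib[symmetric])
    show "\<forall>u\<in>SU. \<forall>v\<in>SV. \<forall>x. \<bar>(\<Sum>y\<in>UNIV. real (?N ((u, v), (x, y))) / real n) - pmf QUVX (u, v, x)\<bar> \<le> \<eta>"
      unfolding sum_divide_distrib[symmetric] sx by (rule conjunct1[OF tp, unfolded typX_def])
    show "\<forall>u\<in>SU. \<forall>v\<in>SV. \<forall>y. \<bar>(\<Sum>x\<in>UNIV. real (?N ((u, v), (x, y))) / real n) - pmf QUVY (u, v, y)\<bar> \<le> \<eta>"
      unfolding sum_divide_distrib[symmetric] sy by (rule conjunct2[OF tp, unfolded typY_def])
    show "\<forall>w\<in>SU \<times> SV. \<forall>z. pmf P1 z = 0 \<longrightarrow> real (?N (w, z)) / real n = 0"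
      using ac by simp
  qed
qed simp_all

text \<open>The strict inequality in \<open>E\<close> is what buys a positive typicality tolerance.
  The second error exponent is \<open>E + I1 + I2\<close> per pair of codewords, and the union over
  all pairs consumes \<open>I1 + I2\<close> again.\<close>

lemma feasible_exponent_below_kl:
  fixes P1 :: "('x \<times> 'y) pmf"
  assumes R: "I1 + I2 \<le> R" and E: "\<And>T. T \<in> tilde_set Q \<Longrightarrow> ereal E < kl_div T (bar_law P1 \<kappa> \<mu>)"
    and eps: "\<epsilon> > 0"
  shows "feasible_exponent P0 P1 R \<epsilon> 1 E"
  unfolding feasible_exponent_def
proof (intro allI impI)
  fix \<delta> :: real assume \<delta>: "\<delta> > 0"
  \<comment> \<open>Each codebook exponent exceeds its information by \<open>2 * d\<close>, so both
    together use \<open>4 * d = \<delta> / 2\<close>. The other half of \<delta> absorbs rounding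
    and the number of types.\<close>
  define d where "d = \<delta> / 8"
  have d: "d > 0" "4 * d = \<delta> / 2" using \<delta> by (auto simp: d_def)
  define D where "D = card ((SU \<times> SV) \<times> (UNIV :: ('x \<times> 'y) set))"
  obtain \<eta> where \<eta>: "\<eta> > 0" and rate: "\<forall>T. approx_law P1 \<eta> T \<longrightarrow> E + I1 + I2 \<le> rate_fun (SU \<times> SV) (pmf P1) T"
  proof -
    have "\<exists>\<eta>>0. \<forall>T. approx_law P1 \<eta> T \<longrightarrow> E + I1 + I2 \<le> rate_fun (SU \<times> SV) (pmf P1) T"
      by (rule approx_law_rate) (rule E)
    then show ?thesis using that by (elim exE conjE)
  qed
  define M1 where "M1 n = nat \<lceil>2 powr (real n * (I1 + 2 * d))\<rceil>" for n
  define M2 where "M2 n = nat \<lceil>2 powr (real n * (I2 + 2 * d))\<rceil>" for n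
  have g1: "1 \<le> 2 powr (real n * (I1 + 2 * d))" "1 \<le> 2 powr (real n * (I2 + 2 * d))" for n
    using I1_nonneg I2_nonneg d by (auto intro!: ge_one_powr_ge_zero)
  have M1: "2 powr (real n * (I1 + 2 * d)) \<le> real (M1 n)" "real (M1 n) \<le> 2 * 2 powr (real n * (I1 + 2 * d))" for n
    unfolding M1_def using g1[of n] by linarith+
  have M2: "2 powr (real n * (I2 + 2 * d)) \<le> real (M2 n)" "real (M2 n) \<le> 2 * 2 powr (real n * (I2 + 2 * d))" for n
    unfolding M2_def using g1[of n] by linarith+
  have Mpos: "0 < M1 n" "0 < M2 n" for n using M1(1)[of n] M2(1)[of n] g1[of n] by linarith+
  \<comment> \<open>The error bound tends to \<open>\<theta>1 + \<theta>2 / \<theta>1\<close>, which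
    with these choices is \<open>\<epsilon> / 2\<close>.\<close>
  define \<theta>1 where "\<theta>1 = \<epsilon> / 4"
  define \<theta>2 where "\<theta>2 = \<theta>1 * \<epsilon> / 4"
  have th: "\<theta>1 > 0" "\<theta>2 > 0" using eps by (auto simp: \<theta>1_def \<theta>2_def)
  define Bad where "Bad n us vs xs ys \<longleftrightarrow> \<not> (typX n \<eta> us vs xs \<and> typY n \<eta> us vs ys)" for n us vs xs ys
  define \<alpha> where "\<alpha> n = \<theta>1 + (\<theta>2 + measure_pmf.prob (replicate_pmf n Q) {ws. Bad n (map rvU ws) (map rvV ws) (map rvX ws) (map rvY ws)} / \<theta>2
        + measure_pmf.prob (replicate_pmf n QUVY) (atypical_info2 n d)
        + exp (- (real (M2 n) / 2 powr (real n * (I2 + d))))) / \<theta>1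
      + measure_pmf.prob (replicate_pmf n QUX) (atypical_info1 n d)
      + exp (- (real (M1 n) / 2 powr (real n * (I1 + d))))" for n
  have "\<alpha> \<longlonglongrightarrow> \<theta>1 + (\<theta>2 + 0 / \<theta>2 + 0 + 0) / \<theta>1 + 0 + 0"
    unfolding \<alpha>_def[abs_def] Bad_def
    using th by (intro tendsto_add tendsto_divide tendsto_const atypical_tendsto \<eta> prob_info1_tendsto prob_info2_tendsto
      d exp_codebook_tendsto M1 M2) auto
  moreover have "\<theta>1 + (\<theta>2 + 0 / \<theta>2 + 0 + 0) / \<theta>1 + 0 + 0 < \<epsilon>"
    using eps by (simp add: \<theta>1_def \<theta>2_def)
  ultimately have ev_alpha: "\<forall>\<^sub>F n in sequentially. \<alpha> n < \<epsilon>" by (rule order_tendstoD(2))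
  have "(\<lambda>n. (3 + real D * log 2 (real n + 1)) / real n) \<longlonglongrightarrow> 0" by real_asymp
  then have ev_n: "\<forall>\<^sub>F n in sequentially. (3 + real D * log 2 (real n + 1)) / real n < \<delta> / 2"
    using \<delta> by (intro order_tendstoD(2)) auto
  show "\<forall>\<^sub>F n in sequentially. \<exists>c :: ('x, 'y) code. is_code 1 n c \<and>
        exponent n (err_beta P1 1 n c) \<ge> ereal (E - \<delta>) \<and> code_rate 1 n c \<le> R + \<delta> \<and> err_alpha P0 1 n c \<le> \<epsilon>"
    using ev_alpha ev_n eventually_gt_at_top[of 0]
  proof eventually_elim
    case (elim n)
    then have al: "\<alpha> n < \<epsilon>" and nb: "(3 + real D * log 2 (real n + 1)) / real n < \<delta> / 2" and n: "n > 0" by auto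
    have D0: "0 \<le> real D * log 2 (real n + 1)" by simp
    obtain CU eU CV eV where CU: "CU \<subseteq> seqs n SU" "card CU \<le> M1 n" "\<forall>x. eU x \<in> CU"
      and CV: "\<forall>u\<in>seqs n SU. CV u \<subseteq> seqs n SV \<and> CV u \<noteq> {} \<and> card (CV u) \<le> M2 n \<and> (\<forall>y. eV u y \<in> CV u)"
      and err: "measure_pmf.prob (replicate_pmf n P0) {zs. Bad n (eU (map fst zs)) (eV (eU (map fst zs)) (map snd zs)) (map fst zs) (map snd zs)} \<le> \<alpha> n"
      using interactive_codebooks[OF less_imp_le[OF d(1)] th Mpos(1)[of n] Mpos(2)[of n], of n "Bad n"]
      unfolding \<alpha>_def by (elim exE conjE)
    have finCU: "finite CU" using CU(1) by (rule finite_subset) simp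
    have CV': "finite (CV u) \<and> card (CV u) \<le> M2 n \<and> (\<forall>ys. eV u ys \<in> CV u)" if "u \<in> CU" for u
      using CV CU(1) that finite_subset[of "CV u" "seqs n SV"] by auto
    obtain c :: "('x, 'y) code" where c: "is_code 1 n c" "fsize c 0 = M1 n" "gsize c 0 = Suc (M2 n)"
      and dec: "\<And>zs. decides_one 1 c zs \<longleftrightarrow> \<not> (typX n \<eta> (eU (map fst zs)) (eV (eU (map fst zs)) (map snd zs)) (map fst zs) \<and>
         typY n \<eta> (eU (map fst zs)) (eV (eU (map fst zs)) (map snd zs)) (map snd zs))"
    proof -
      have "\<exists>c :: ('x, 'y) code. is_code 1 n c \<and> fsize c 0 = M1 n \<and> gsize c 0 = Suc (M2 n) \<and>
        (\<forall>zs. decides_one 1 c zs \<longleftrightarrow> \<not> (typX n \<eta> (eU (map fst zs)) (eV (eU (map fst zs)) (map snd zs)) (map fst zs) \<and>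
          typY n \<eta> (eU (map fst zs)) (eV (eU (map fst zs)) (map snd zs)) (map snd zs)))"
        by (rule interactive_code_exists[OF finCU CU(2) spec[OF CU(3)] CV'])
      then show ?thesis using that by (elim exE conjE) simp
    qed
    have "err_alpha P0 1 n c \<le> \<epsilon>"
      using err al unfolding err_alpha_def dec Bad_def by simp
    moreover have "code_rate 1 n c \<le> R + \<delta>"
    proof -
      \<comment> \<open>Rounding up costs a factor 2 in each codebook, and the reserved message of B
        turns the second 2 into at most 4. The product 8 is the origin of the constant 3.\<close>
      have "real (M1 n) * real (Suc (M2 n)) \<le> (2 * 2 powr (real n * (I1 + 2 * d))) * (4 * 2 powr (real n * (I2 + 2 * d)))"
        using M1[of n] M2[of n] g1[of n] by (intro mult_mono) auto
      also have "\<dots> = 2 powr 3 * 2 powr (real n * (I1 + I2 + 4 * d))"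
        by (simp add: powr_add[symmetric] algebra_simps)
      also have "\<dots> = 2 powr (3 + real n * (I1 + I2 + 4 * d))" by (simp only: powr_add)
      finally have "log 2 (real (M1 n) * real (Suc (M2 n))) \<le> 3 + real n * (I1 + I2 + 4 * d)"
        using Mpos[of n] by (subst log_le_iff) auto
      then have "code_rate 1 n c \<le> (3 + real n * (I1 + I2 + 4 * d)) / real n"
        unfolding code_rate_def using c n by (simp add: divide_right_mono)
      also have "\<dots> = 3 / real n + (I1 + I2 + 4 * d)" using n by (simp add: add_divide_distrib)
      also have "3 / real n \<le> (3 + real D * log 2 (real n + 1)) / real n"
        using D0 n by (intro divide_right_mono) auto
      finally show ?thesis using nb R d(2) by linarith
    qed
    moreover have "exponent n (err_beta P1 1 n c) \<ge> ereal (E - \<delta>)"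
    proof -
      let ?A = "\<lambda>us vs. {zs :: ('x \<times> 'y) list. typX n \<eta> us vs (map fst zs) \<and> typY n \<eta> us vs (map snd zs)}"
      let ?P = "measure_pmf.prob (replicate_pmf n P1)"
      let ?b = "(real n + 1) ^ D * 2 powr (- (real n * (E + I1 + I2)))"
      have "{zs. \<not> decides_one 1 c zs} \<subseteq> (\<Union>us\<in>CU. \<Union>vs\<in>CV us. ?A us vs)"
      proof
        fix zs assume "zs \<in> {zs. \<not> decides_one 1 c zs}"
        then have "zs \<in> ?A (eU (map fst zs)) (eV (eU (map fst zs)) (map snd zs))" unfolding dec by simp
        then show "zs \<in> (\<Union>us\<in>CU. \<Union>vs\<in>CV us. ?A us vs)" using CU(3) CV' by blast
      qed
      then have "err_beta P1 1 n c \<le> ?P (\<Union>us\<in>CU. \<Union>vs\<in>CV us. ?A us vs)"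
        unfolding err_beta_def by (intro prob_pmf_mono) (rule subsetD)
      also have "\<dots> \<le> (\<Sum>us\<in>CU. ?P (\<Union>vs\<in>CV us. ?A us vs))"
        using finCU by (intro prob_pmf_UN_le) auto
      also have "\<dots> \<le> (\<Sum>us\<in>CU. \<Sum>vs\<in>CV us. ?P (?A us vs))"
        using CV' by (intro sum_mono prob_pmf_UN_le) auto
      also have "\<dots> \<le> (\<Sum>us\<in>CU. \<Sum>vs\<in>CV us. ?b)"
      proof (intro sum_mono)
        fix us vs assume "us \<in> CU" "vs \<in> CV us"
        then have "us \<in> seqs n SU" "vs \<in> seqs n SV" using CU(1) CV by auto
        then show "?P (?A us vs) \<le> ?b"
          unfolding D_def by (intro typical_prob_le n) (simp_all add: rate)
      qed
      also have "\<dots> = (\<Sum>us\<in>CU. real (card (CV us))) * ?b" by (simp add: sum_distrib_right)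
      also have "\<dots> \<le> (real (M1 n) * real (M2 n)) * ?b"
      proof (rule mult_right_mono)
        have "(\<Sum>us\<in>CU. real (card (CV us))) \<le> (\<Sum>us\<in>CU. real (M2 n))" using CV' by (intro sum_mono) auto
        also have "\<dots> \<le> real (M1 n) * real (M2 n)" using CU(2) by (simp add: mult_right_mono)
        finally show "(\<Sum>us\<in>CU. real (card (CV us))) \<le> real (M1 n) * real (M2 n)" .
      qed simp
      also have "\<dots> \<le> ((2 * 2 powr (real n * (I1 + 2 * d))) * (2 * 2 powr (real n * (I2 + 2 * d)))) * ?b"
        using M1[of n] M2[of n] by (intro mult_right_mono mult_mono) auto
      also have "\<dots> \<le> 2 powr (- (real n * (E - \<delta>)))"
      proof -
        have p: "(real n + 1) ^ D = 2 powr (real D * log 2 (real n + 1))"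
        proof -
          have "2 powr (log 2 (real n + 1) * real D) = (real n + 1) ^ D"
            unfolding powr_powr[symmetric] by (simp add: powr_realpow)
          then show ?thesis by (simp add: mult.commute)
        qed
        have "((2 * 2 powr (real n * (I1 + 2 * d))) * (2 * 2 powr (real n * (I2 + 2 * d)))) * ?b =
          2 powr 2 * 2 powr (real n * (I1 + 2 * d)) * 2 powr (real n * (I2 + 2 * d)) * 2 powr (real D * log 2 (real n + 1))
          * 2 powr (- (real n * (E + I1 + I2)))"
          unfolding p by simp
        also have "\<dots> = 2 powr (2 + real n * (I1 + 2 * d) + real n * (I2 + 2 * d) + real D * log 2 (real n + 1) + - (real n * (E + I1 + I2)))"
          by (simp only: powr_add)
        \<comment> \<open>After cancelling \<open>I1 + I2\<close>, the loss against \<open>E\<close>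
          consists of \<open>4 * d\<close> from the codebooks and the polynomial and constant
          factors, each at most \<open>\<delta> / 2\<close> per symbol.\<close>
        also have "\<dots> \<le> 2 powr (- (real n * (E - \<delta>)))"
        proof (rule powr_mono)
          have "3 + real D * log 2 (real n + 1) \<le> real n * (\<delta> / 2)"
            using nb n by (simp add: field_simps)
          moreover have "\<delta> = 8 * d" by (simp add: d_def)
          ultimately show "2 + real n * (I1 + 2 * d) + real n * (I2 + 2 * d) + real D * log 2 (real n + 1) + - (real n * (E + I1 + I2))
            \<le> - (real n * (E - \<delta>))"
            by (simp add: algebra_simps)
        qed simp
        finally show ?thesis .
      qed
      finally have b: "err_beta P1 1 n c \<le> 2 powr (- (real n * (E - \<delta>)))" .
      show ?thesis
      proof (cases "err_beta P1 1 n c = 0")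
        case False
        then have "0 < err_beta P1 1 n c" by (simp add: err_beta_def order_less_le)
        then have "log 2 (err_beta P1 1 n c) \<le> - (real n * (E - \<delta>))"
          using b by (subst log_le_iff) auto
        then have "E - \<delta> \<le> - log 2 (err_beta P1 1 n c) / real n"
          using n by (simp add: field_simps)
        then show ?thesis using False by (simp add: exponent_def)
      qed (simp add: exponent_def)
    qed
    ultimately show ?case using c by blast
  qed
qed

end

section \<open>Monotonicity in \<epsilon>, the limit and the supremum\<close>

lemma feasible_exponent_mono:
  assumes "feasible_exponent P0 P1 R \<epsilon> K E" "\<epsilon> \<le> \<epsilon>'"
  shows "feasible_exponent P0 P1 R \<epsilon>' K E"
  unfolding feasible_exponent_def
proof (intro allI impI)
  fix \<delta> :: real assume "\<delta> > 0"
  with assms(1) have "\<forall>\<^sub>F n in sequentially. \<exists>c. is_code K n c \<and> exponent n (err_beta P1 K n c) \<ge> ereal (E - \<delta>) \<and>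
    code_rate K n c \<le> R + \<delta> \<and> err_alpha P0 K n c \<le> \<epsilon>" unfolding feasible_exponent_def by blast
  then show "\<forall>\<^sub>F n in sequentially. \<exists>c. is_code K n c \<and> exponent n (err_beta P1 K n c) \<ge> ereal (E - \<delta>) \<and>
    code_rate K n c \<le> R + \<delta> \<and> err_alpha P0 K n c \<le> \<epsilon>'"
    by (rule eventually_mono) (use assms(2) order_trans in blast)
qed

lemma tendsto_at_right_0_INF:
  fixes f :: "real \<Rightarrow> 'b :: {complete_linorder, linorder_topology}"
  assumes mono: "\<And>a b. a \<le> b \<Longrightarrow> f a \<le> f b"
  shows "(f \<longlongrightarrow> (INF a\<in>{0<..}. f a)) (at_right 0)"
proof (rule order_tendstoI)
  fix l assume "l < (INF a\<in>{0<..}. f a)"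
  then have "l < f a" if "a > 0" for a
    using that INF_lower[of a "{0<..}" f] by (auto intro: less_le_trans)
  then show "\<forall>\<^sub>F a in at_right 0. l < f a"
    by (auto simp: eventually_at_right_field intro!: exI[of _ 1])
next
  fix l assume "(INF a\<in>{0<..}. f a) < l"
  then obtain a where a: "a > 0" "f a < l" by (auto simp: INF_less_iff)
  have "f b < l" if "b < a" for b using mono[of b a] a that by (auto intro: le_less_trans)
  then show "\<forall>\<^sub>F a in at_right 0. f a < l"
    using a by (auto simp: eventually_at_right_field intro!: exI[of _ a])
qed

lemma aux_vars_aux_set:
  assumes "Q \<in> aux_set P0 R" "is_cond_law Q rvU rvX \<kappa>" "is_cond_law Q rvV rvUY \<mu>"
  shows "aux_vars P0 Q \<kappa> \<mu>"
  using assms by (simp add: aux_set_def aux_vars_def)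

lemma optimal_exponent_ge:
  assumes Q: "Q \<in> aux_set P0 R" and aux: "aux_vars P0 Q \<kappa> \<mu>" and eps: "\<epsilon> > 0"
  shows "(INF T \<in> tilde_set Q. kl_div T (bar_law P1 \<kappa> \<mu>)) \<le> optimal_exponent P0 P1 R \<epsilon> 1"
proof -
  let ?I = "INF T \<in> tilde_set Q. kl_div T (bar_law P1 \<kappa> \<mu>)"
  have "aux_vars.I1 Q \<kappa> + aux_vars.I2 Q \<mu> \<le> R"
    using Q by (simp add: aux_set_def aux_vars.mut_info_eq_I1[OF aux] aux_vars.cond_mut_info_eq_I2[OF aux])
  then have "feasible_exponent P0 P1 R \<epsilon> 1 E" if "ereal E < ?I" for E
    using that eps by (intro aux_vars.feasible_exponent_below_kl[OF aux]) (auto intro: less_le_trans INF_lower)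
  then have "ereal E \<le> optimal_exponent P0 P1 R \<epsilon> 1" if "ereal E < ?I" for E
    unfolding optimal_exponent_def using that by (intro SUP_upper) auto
  \<comment> \<open>The infimum may be infinite, so it is approached by real exponents from below: a
    gap between the two sides would contain one.\<close>
  then show ?thesis
    by (meson ereal_dense2 less_imp_le linorder_not_le)
qed

text \<open>\<open>kU Q\<close> and \<open>kV Q\<close> are arbitrary versions of the conditional
  laws, so the bound holds for every choice at null events. The first conjunct shows that each
  \<open>INF\<close> in the second is a minimum, and the existence of the limit \<open>L\<close> is
  part of the conclusion.\<close>

theorem proposition1:
  fixes P0 P1 :: "('x::finite \<times> 'y::finite) pmf" and R :: real
    and kU :: "('x, 'y) joint \<Rightarrow> 'x \<Rightarrow> nat pmf"
    and kV :: "('x, 'y) joint \<Rightarrow> nat \<times> 'y \<Rightarrow> nat pmf"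
  assumes "R \<ge> 0"
    and "\<And>Q. Q \<in> aux_set P0 R \<Longrightarrow> is_cond_law Q rvU rvX (kU Q)"
    and "\<And>Q. Q \<in> aux_set P0 R \<Longrightarrow> is_cond_law Q rvV rvUY (kV Q)"
  shows "(\<forall>Q \<in> aux_set P0 R. \<exists>T \<in> tilde_set Q. \<forall>T' \<in> tilde_set Q.
            kl_div T (bar_law P1 (kU Q) (kV Q)) \<le> kl_div T' (bar_law P1 (kU Q) (kV Q))) \<and>
         (\<exists>L. ((\<lambda>\<epsilon>. optimal_exponent P0 P1 R \<epsilon> 1) \<longlongrightarrow> L) (at_right 0) \<and>
            L \<ge> (SUP Q \<in> aux_set P0 R. INF T \<in> tilde_set Q.
                  kl_div T (bar_law P1 (kU Q) (kV Q))))"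
proof -
  have aux: "aux_vars P0 Q (kU Q) (kV Q)" if "Q \<in> aux_set P0 R" for Q
    using that assms(2,3) by (intro aux_vars_aux_set) auto
  let ?f = "\<lambda>\<epsilon>. optimal_exponent P0 P1 R \<epsilon> 1"
  have "?f a \<le> ?f b" if "a \<le> b" for a b
    unfolding optimal_exponent_def using that feasible_exponent_mono by (intro SUP_subset_mono) auto
  \<comment> \<open>The infimum runs over all positive \<epsilon>, including values above 1; by
    monotonicity it is determined by the small ones.\<close>
  then have "(?f \<longlongrightarrow> (INF \<epsilon>\<in>{0<..}. ?f \<epsilon>)) (at_right 0)" by (rule tendsto_at_right_0_INF)
  moreover have "(SUP Q \<in> aux_set P0 R. INF T \<in> tilde_set Q. kl_div T (bar_law P1 (kU Q) (kV Q))) \<le> (INF \<epsilon>\<in>{0<..}. ?f \<epsilon>)"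
    by (intro SUP_least INF_greatest optimal_exponent_ge aux) auto
  ultimately show ?thesis
    using aux_vars.kl_div_attains_min[OF aux] by blast
qed

end
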